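(* Let $S$ be a non-singular step set with positive weights, let $L,K\ge0$ be integers with $M=L+K+1\ge2$ even, and let $(p,q)\in\mathbb{Z}^2$ with $p>0$, $q\ge0$. For every integer $j\in[-L,K]$, the series ${\sf Q}_j(x,y;t)$ counting weighted walks in the $M$-quadrant cone $\Pi_{L,K}$ starting at $(0,(p,q))$ and ending in $\tilde\Gamma_j$ is D-finite in $x$ and in $y$.
   Context: $S\subset\{-1,0,1\}^2\setminus\{(0,0)\}$ is non-singular if for every line through the origin each open half-plane it bounds contains an element of $S$; each $s\in S$ has weight $w_s>0$. Let $\mathcal{Q}_0=\{(i,j):i,j>0\}$, $\tilde{\mathcal{Q}}_0=\{(i,j):i>0,j\ge0\}$, $r(a,b)=(-b,a)$, $\mathcal{Q}_s=r^s(\mathcal{Q}_0)$, $\tilde{\mathcal{Q}}_s=r^s(\tilde{\mathcal{Q}}_0)$ for $s\in\mathbb{Z}$. Let $\Gamma_s=\{s\}\times\mathcal{Q}_s$, $\tilde\Gamma_s=\{s\}\times\tilde{\mathcal{Q}}_s$ and $\Pi=\bigcup_s\tilde\Gamma_s$; a step from $(s_1,(a_1,b_1))$ to $(s_2,(a_2,b_2))$ in $\Pi$ is allowed iff $(a_2-a_1,b_2-b_1)\in S$ and $|s_1-s_2|\le1$, with the weight of that element of $S$. The $M$-quadrant cone is $\Pi_{L,K}=\Gamma_{-L}\cup\tilde\Gamma_{-L+1}\cup\dots\cup\tilde\Gamma_K$. For $-L\le j\le K$, $q_j(a,b;n)$ is the total weight (product of step weights) of walks of $n$ allowed steps in $\Pi_{L,K}$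 (all visited points in $\Pi_{L,K}$) from $(0,(p,q))$ to $(j,(a,b))$, and ${\sf Q}_j(x,y;t)=\sum_{n,a,b}q_j(a,b;n)x^ay^bt^n$. D-finite in $x$: satisfies a non-trivial linear differential equation in $x$ with coefficients polynomial in $x$. *)

theory Defs
  imports "HOL-Computational_Algebra.Formal_Laurent_Series" "HOL-Library.Product_Plus"
begin

section \<open>Step sets and the cone\<close>

text \<open>Every open half-plane bounded by a line through the origin is
  \<open>{(x, y). u * x + v * y > 0}\<close> for some real \<open>(u, v) \<noteq> (0, 0)\<close>; the opposite half-plane
  is given by \<open>(-u, -v)\<close>.\<close>

definition non_singular :: "(int \<times> int) set \<Rightarrow> bool" where
  "non_singular S \<longleftrightarrow>
     (\<forall>u v :: real. (u, v) \<noteq> (0, 0) \<longrightarrow> (\<exists>(i, j)\<in>S. u * of_int i + v * of_int j > 0))"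

definition rot :: "int \<times> int \<Rightarrow> int \<times> int" where
  "rot = (\<lambda>(a, b). (- b, a))"

definition rot_pow :: "int \<Rightarrow> int \<times> int \<Rightarrow> int \<times> int" where
  "rot_pow s = (if s \<ge> 0 then rot ^^ nat s else inv rot ^^ nat (- s))"

definition quadrant :: "int \<Rightarrow> (int \<times> int) set" where
  "quadrant s = rot_pow s ` {(i, j). i > 0 \<and> j > 0}"

definition quadrant' :: "int \<Rightarrow> (int \<times> int) set" where
  "quadrant' s = rot_pow s ` {(i, j). i > 0 \<and> j \<ge> 0}"

definition Gam :: "int \<Rightarrow> (int \<times> (int \<times> int)) set" where
  "Gam s = {s} \<times> quadrant s"

definition Gam' :: "int \<Rightarrow> (int \<times> (int \<times> int)) set" where
  "Gam' s = {s} \<times> quadrant' s"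

definition cone :: "nat \<Rightarrow> nat \<Rightarrow> (int \<times> (int \<times> int)) set" where
  "cone L K = Gam (- int L) \<union> (\<Union>s\<in>{- int L + 1..int K}. Gam' s)"

section \<open>Weighted walks\<close>

definition allowed ::
  "(int \<times> int) set \<Rightarrow> int \<times> (int \<times> int) \<Rightarrow> int \<times> (int \<times> int) \<Rightarrow> bool" where
  "allowed S u v \<longleftrightarrow> snd v - snd u \<in> S \<and> \<bar>fst u - fst v\<bar> \<le> 1"

text \<open>A walk of \<open>n\<close> steps is the list of its \<open>n + 1\<close> visited points.  There is no walk at
  all if the starting point is outside the cone.\<close>

definition walks ::
  "(int \<times> int) set \<Rightarrow> nat \<Rightarrow> nat \<Rightarrow> int \<times> (int \<times> int) \<Rightarrow> int \<times> (int \<times> int) \<Rightarrow> nat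
     \<Rightarrow> (int \<times> (int \<times> int)) list set" where
  "walks S L K u v n =
     {ps. length ps = Suc n \<and> hd ps = u \<and> last ps = v \<and> set ps \<subseteq> cone L K \<and>
          (\<forall>i<n. allowed S (ps ! i) (ps ! Suc i))}"

definition walk_weight :: "(int \<times> int \<Rightarrow> real) \<Rightarrow> (int \<times> (int \<times> int)) list \<Rightarrow> real" where
  "walk_weight w ps = (\<Prod>i<length ps - 1. w (snd (ps ! Suc i) - snd (ps ! i)))"

definition q_total ::
  "(int \<times> int) set \<Rightarrow> (int \<times> int \<Rightarrow> real) \<Rightarrow> nat \<Rightarrow> nat \<Rightarrow> int \<times> int \<Rightarrow> int
     \<Rightarrow> int \<Rightarrow> int \<Rightarrow> nat \<Rightarrow> real" where
  "q_total S w L K start j a b n =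
     (\<Sum>ps\<in>walks S L K (0, start) (j, (a, b)) n. walk_weight w ps)"

section \<open>Generating functions\<close>

text \<open>
  For each \<open>n\<close> only finitely many \<open>f a b n\<close> are nonzero in the intended use, so
  \<open>\<Sum>n a b. f a b n * x^a * y^b * t^n\<close> is a power series in \<open>t\<close> with coefficients Laurent
  polynomials in \<open>x\<close> and \<open>y\<close>.  It can be viewed in \<open>\<real>((y))((x))[[t]]\<close>, or, exchanging the
  roles of the variables, in \<open>\<real>((x))((y))[[t]]\<close>.  The constant \<open>series_x f\<close> is the first view
  and \<open>series_y f\<close> the second; the differentiation variable is the \<open>fls\<close> directly below
  the \<open>fps\<close>.
\<close>

definition series_x :: "(int \<Rightarrow> int \<Rightarrow> nat \<Rightarrow> real) \<Rightarrow> real fls fls fps" where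
  "series_x f = Abs_fps (\<lambda>n. \<Sum>(a, b)\<in>{(a, b). f a b n \<noteq> 0}.
     fls_const (fls_const (f a b n) * fls_X_intpow b) * fls_X_intpow a)"

definition series_y :: "(int \<Rightarrow> int \<Rightarrow> nat \<Rightarrow> real) \<Rightarrow> real fls fls fps" where
  "series_y f = Abs_fps (\<lambda>n. \<Sum>(a, b)\<in>{(a, b). f a b n \<noteq> 0}.
     fls_const (fls_const (f a b n) * fls_X_intpow a) * fls_X_intpow b)"

section \<open>D-finiteness\<close>

text \<open>
  Elements of \<open>C((x))[[t]]\<close>, with \<open>C\<close> the field of Laurent series in the remaining variable,
  as functions of \<open>x\<close>.  The equation has coefficients polynomial in \<open>x\<close>; the coefficients of
  these polynomials are elements of \<open>C[[t]]\<close>, that is, they may depend arbitrarily on the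
  other variables but not on \<open>x\<close>.
\<close>

definition deriv_x :: "'c::field fls fps \<Rightarrow> 'c fls fps" where
  "deriv_x F = Abs_fps (\<lambda>n. fls_deriv (fps_nth F n))"

definition lift_const :: "'c::field fps \<Rightarrow> 'c fls fps" where
  "lift_const c = Abs_fps (\<lambda>n. fls_const (fps_nth c n))"

definition poly_in_x :: "'c::field fps poly \<Rightarrow> 'c fls fps" where
  "poly_in_x p = poly (map_poly lift_const p) (fps_const fls_X)"

definition D_finite :: "'c::field fls fps \<Rightarrow> bool" where
  "D_finite F \<longleftrightarrow>
     (\<exists>(r::nat) (P :: nat \<Rightarrow> 'c fps poly).
        (\<exists>i\<le>r. P i \<noteq> 0) \<and> (\<Sum>i\<le>r. poly_in_x (P i) * (deriv_x ^^ i) F) = 0)"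

end

(*
  Pair up the quadrants into m half-planes bounded by horizontal rays (rotate by a right angle if
  the outer rays are vertical).  In a half-plane the kernel equation is solved by the kernel method
  in terms of the two bounding rays, and gluing the half-planes along the rays gives a chain
    D (i+1) - D i = \<rho> (A i + A (i+1)) + source,    A 0 = A m = 0,
  where A i counts the walks ending on ray i, D i is a net flow, both supported alternately on
  positive and negative powers of x, and \<rho> is the square root of the discriminant of the kernel.
  Order by order in t such a chain with zero source has only the zero solution.  Multiplication by x
  and the square of the invariant derivation of the kernel curve both respect the chain up to
  finitely many coefficients, a number growing linearly in the degree, with slope independent of the
  order; so some combination of the x^k T^l kills all of them, and uniqueness makes it
  annihilate every A i and D i: these are D-finite in x.

  For D-finiteness in y the rows of a half-plane are eventually F, \<lambda> F, \<lambda>^2 F, ... with \<lambda> algebraic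
  and F D-finite.  Counting the b^l (x d/dx)^n (\<lambda>^(b+k) F) as Lipshitz does for diagonals yields a
  recurrence in b for all but finitely many columns, and the kernel equation then passes it on to the
  remaining ones.
*)
theory Submission
  imports Defs
begin

unbundle fps_syntax

section \<open>Linear dependence over a subring\<close>


lemma exists_linear_dependence:
  fixes v :: "'i \<Rightarrow> 'j \<Rightarrow> 'a::idom"
  assumes "finite J" "finite I" "card J < card I"
    and "\<And>i j. i \<in> I \<Longrightarrow> j \<in> J \<Longrightarrow> v i j \<in> R"
    and "0 \<in> R" "1 \<in> R" "\<And>x y. x \<in> R \<Longrightarrow> y \<in> R \<Longrightarrow> x - y \<in> R"
    and "\<And>x y. x \<in> R \<Longrightarrow> y \<in> R \<Longrightarrow> x * y \<in> R"
  shows "\<exists>c. (\<forall>i. c i \<in> R) \<and> (\<exists>i\<in>I. c i \<noteq> 0) \<and> (\<forall>j\<in>J. (\<Sum>i\<in>I. c i * v i j) = 0)"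
  using assms(1-4)
proof (induction J arbitrary: I v rule: finite_induct)
  case empty
  then have "I \<noteq> {}" by auto
  then show ?case using assms(6) by (intro exI[of _ "\<lambda>_. 1"]) auto
next
  case (insert j0 J)
  show ?case
  proof (cases "\<forall>i\<in>I. v i j0 = 0")
    case True
    have "\<exists>c. (\<forall>i. c i \<in> R) \<and> (\<exists>i\<in>I. c i \<noteq> 0) \<and> (\<forall>j\<in>J. (\<Sum>i\<in>I. c i * v i j) = 0)"
      using insert by (intro insert.IH) auto
    then obtain c where "\<forall>i. c i \<in> R" "\<exists>i\<in>I. c i \<noteq> 0" "\<forall>j\<in>J. (\<Sum>i\<in>I. c i * v i j) = 0"
      by blast
    moreover have "(\<Sum>i\<in>I. c i * v i j0) = 0"
      using True by simp
    ultimately show ?thesis by (intro exI[of _ c]) simp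
  next
    case False
    then obtain i0 where i0: "i0 \<in> I" "v i0 j0 \<noteq> 0" by blast
    define v' where "v' i j = v i j * v i0 j0 - v i j0 * v i0 j" for i j
    have R_sum: "sum f K \<in> R" if "\<And>k. k \<in> K \<Longrightarrow> f k \<in> R" for f :: "'i \<Rightarrow> 'a" and K
    proof -
      have neg: "- x \<in> R" if "x \<in> R" for x
        using assms(7)[OF assms(5) that] by simp
      have "x + y \<in> R" if "x \<in> R" "y \<in> R" for x y
        using assms(7)[OF that(1) neg[OF that(2)]] by simp
      then show ?thesis using that assms(5) by (induction K rule: infinite_finite_induct) auto
    qed
    have "\<exists>c. (\<forall>i. c i \<in> R) \<and> (\<exists>i\<in>I-{i0}. c i \<noteq> 0) \<and>
            (\<forall>j\<in>J. (\<Sum>i\<in>I-{i0}. c i * v' i j) = 0)"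
      using insert i0 by (intro insert.IH) (auto simp: v'_def intro!: assms(7,8))
    then obtain c where c: "\<forall>i. c i \<in> R" "\<exists>i\<in>I-{i0}. c i \<noteq> 0"
      "\<And>j. j \<in> J \<Longrightarrow> (\<Sum>i\<in>I-{i0}. c i * v' i j) = 0" by blast
    define s where "s = (\<Sum>i\<in>I-{i0}. c i * v i j0)"
    define d where "d i = (if i = i0 then - s else c i * v i0 j0)" for i
    have d: "(\<Sum>i\<in>I. d i * v i j) = (\<Sum>i\<in>I-{i0}. c i * v' i j)" for j
    proof -
      have "(\<Sum>i\<in>I. d i * v i j) = d i0 * v i0 j + (\<Sum>i\<in>I-{i0}. d i * v i j)"
        using i0 insert.prems(1) by (simp add: sum.remove)
      also have "(\<Sum>i\<in>I-{i0}. d i * v i j) = (\<Sum>i\<in>I-{i0}. c i * v i j * v i0 j0)"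
        by (intro sum.cong) (auto simp: d_def)
      also have "d i0 * v i0 j = (\<Sum>i\<in>I-{i0}. - (c i * v i j0 * v i0 j))"
        by (simp add: d_def s_def sum_distrib_right sum_negf)
      finally show ?thesis
        by (simp add: sum.distrib[symmetric] v'_def algebra_simps)
    qed
    have "(\<Sum>i\<in>I-{i0}. c i * v' i j0) = 0"
      by (rule sum.neutral) (simp add: v'_def)
    then have "\<forall>j\<in>insert j0 J. (\<Sum>i\<in>I. d i * v i j) = 0"
      using d c(3) by auto
    moreover have "s \<in> R"
      using c(1) insert.prems(3) by (auto simp: s_def intro!: assms(8) R_sum)
    then have "- s \<in> R"
      using assms(7)[OF assms(5)] by fastforce
    then have "\<forall>i. d i \<in> R"
      using c(1) i0 insert.prems(3) by (auto simp: d_def intro!: assms(8))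
    moreover have "\<exists>i\<in>I. d i \<noteq> 0"
      using c(2) i0 by (auto simp: d_def)
    ultimately show ?thesis by blast
  qed
qed

section \<open>Laurent polynomials and the Euler derivation\<close>

definition theta :: "'c::field_char_0 fls fps \<Rightarrow> 'c fls fps" where
  "theta F = Abs_fps (\<lambda>n. fls_X * fls_deriv (F $ n))"

definition xpow :: "int \<Rightarrow> 'c::field_char_0 fls fps" where
  "xpow k = fps_const (fls_X_intpow k)"

definition xcoeff :: "'c::field_char_0 fls fps \<Rightarrow> int \<Rightarrow> 'c fps" where
  "xcoeff F a = Abs_fps (\<lambda>n. F $ n $$ a)"

definition supp_ge :: "int \<Rightarrow> 'c::field_char_0 fls fps \<Rightarrow> bool" where
  "supp_ge m F \<longleftrightarrow> (\<forall>n a. a < m \<longrightarrow> F $ n $$ a = 0)"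

definition supp_le :: "int \<Rightarrow> 'c::field_char_0 fls fps \<Rightarrow> bool" where
  "supp_le m F \<longleftrightarrow> (\<forall>n a. m < a \<longrightarrow> F $ n $$ a = 0)"

definition band :: "int \<Rightarrow> 'c::field_char_0 fls fps \<Rightarrow> bool" where
  "band B F \<longleftrightarrow> supp_ge (- B) F \<and> supp_le B F"

definition Lpoly :: "'c::field_char_0 fls fps set" where
  "Lpoly = {F. \<exists>B. band B F}"

lemma theta_nth [simp]: "theta F $ n $$ a = of_int a * F $ n $$ a"
proof -
  show ?thesis
    by (simp add: theta_def fls_X_times_conv_shift)
qed

lemma fls_fps_eqI: "(\<And>n a. F $ n $$ a = G $ n $$ a) \<Longrightarrow> F = (G :: 'c::zero fls fps)"
  by (simp add: fps_eq_iff fls_eq_iff)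

lemma xcoeff_nth [simp]: "xcoeff F a $ n = F $ n $$ a"
  by (simp add: xcoeff_def)

lemma xcoeff_eqI: "(\<And>a. xcoeff F a = xcoeff G a) \<Longrightarrow> F = G"
  by (rule fls_fps_eqI) (metis xcoeff_nth)

lemma theta_add [simp]: "theta (F + G) = theta F + theta G"
  by (rule fls_fps_eqI) (simp add: algebra_simps)

lemma theta_diff [simp]: "theta (F - G) = theta F - theta G"
  by (rule fls_fps_eqI) (simp add: algebra_simps)

lemma theta_0 [simp]: "theta 0 = 0"
  by (rule fls_fps_eqI) simp

lemma theta_sum [simp]: "theta (\<Sum>i\<in>I. f i) = (\<Sum>i\<in>I. theta (f i))"
  by (induction I rule: infinite_finite_induct) auto

lemma theta_mult: "theta (F * G) = theta F * G + F * theta G"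
proof (rule fps_ext)
  fix n
  have "theta (F * G) $ n = (\<Sum>i=0..n. fls_X * (fls_deriv (F $ i) * G $ (n - i) + F $ i * fls_deriv (G $ (n - i))))"
    by (simp add: theta_def fps_mult_nth fls_deriv_sum sum_distrib_left add.commute)
  also have "\<dots> = (theta F * G + F * theta G) $ n"
    unfolding fps_add_nth fps_mult_nth sum.distrib[symmetric]
    by (intro sum.cong refl) (simp add: theta_def algebra_simps)
  finally show "theta (F * G) $ n = (theta F * G + F * theta G) $ n" .
qed

lemma theta_1 [simp]: "theta 1 = 0"
  by (rule fls_fps_eqI) (simp add: fps_one_nth)

lemma theta_power: "theta (F ^ n) = of_nat n * F ^ (n - 1) * theta F"
proof (induction n)
  case (Suc n)
  then show ?case by (cases n) (simp_all add: theta_mult algebra_simps)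
qed simp

lemma xcoeff_add [simp]: "xcoeff (F + G) a = xcoeff F a + xcoeff G a"
  by (rule fps_ext) simp

lemma xcoeff_diff [simp]: "xcoeff (F - G) a = xcoeff F a - xcoeff G a"
  by (rule fps_ext) simp

lemma xcoeff_0 [simp]: "xcoeff 0 a = 0"
  by (rule fps_ext) simp

lemma xcoeff_sum [simp]: "xcoeff (\<Sum>i\<in>I. f i) a = (\<Sum>i\<in>I. xcoeff (f i) a)"
  by (induction I rule: infinite_finite_induct) auto

lemma xcoeff_theta [simp]: "xcoeff (theta F) a = of_int a * xcoeff F a"
  by (rule fps_ext) (simp add: fps_of_int[symmetric])

lemma xcoeff_theta_pow [simp]: "xcoeff ((theta ^^ k) F) a = of_int a ^ k * xcoeff F a"
  by (induction k) auto

lemma fls_sum_nth: "(\<Sum>i\<in>I. f i :: 'c::comm_monoid_add fls) $$ a = (\<Sum>i\<in>I. f i $$ a)"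
  by (induction I rule: infinite_finite_induct) auto

lemma lift_const_mult_nth [simp]: "(lift_const c * F) $ n $$ a = (c * xcoeff F a) $ n"
  by (simp add: lift_const_def fps_mult_nth fls_sum_nth)

lemma xcoeff_lift_const_mult [simp]: "xcoeff (lift_const c * F) a = c * xcoeff F a"
  by (rule fps_ext) simp

lemma xpow_mult_nth [simp]: "(xpow k * F) $ n $$ a = F $ n $$ (a - k)"
  by (simp add: xpow_def fls_X_intpow_times_conv_shift)

lemma xcoeff_xpow_mult [simp]: "xcoeff (xpow k * F) a = xcoeff F (a - k)"
  by (rule fps_ext) simp

lemma xpow_nth: "xpow k $ n $$ a = (if n = 0 \<and> a = k then 1 else 0)"
  by (simp add: xpow_def)

lemma xcoeff_xpow: "xcoeff (xpow k) a = (if a = k then 1 else 0)"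
  by (rule fps_ext) (simp add: xpow_nth)

lemma xpow_0 [simp]: "xpow 0 = 1"
  by (rule fls_fps_eqI) (simp add: xpow_nth fps_one_nth)

lemma xpow_nonzero [simp]: "xpow k \<noteq> 0"
  by (simp add: xpow_def)

lemma xpow_add: "xpow (j + k) = xpow j * xpow k"
  by (rule fls_fps_eqI) (simp add: xpow_nth)

lemma lift_const_0 [simp]: "lift_const 0 = 0"
  by (rule fls_fps_eqI) (simp add: lift_const_def)

lemma lift_const_1 [simp]: "lift_const 1 = 1"
  by (rule fls_fps_eqI) (simp add: lift_const_def fps_one_nth)

lemma lift_const_eq_0_iff [simp]: "lift_const c = 0 \<longleftrightarrow> c = 0"
  by (auto simp: lift_const_def fps_eq_iff)

lemma lift_const_nth [simp]: "lift_const c $ n $$ a = (if a = 0 then c $ n else 0)"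
  by (simp add: lift_const_def)

lemma xcoeff_lift_const: "xcoeff (lift_const c) a = (if a = 0 then c else 0)"
  by (rule fps_ext) simp

lemma lift_const_add: "lift_const (a + b) = lift_const a + lift_const b"
  by (rule fls_fps_eqI) simp

lemma lift_const_mult: "lift_const (a * b) = lift_const a * lift_const (b :: 'c::field_char_0 fps)"
  by (rule xcoeff_eqI) (simp add: xcoeff_lift_const)

lemma theta_lift_const [simp]: "theta (lift_const c) = 0"
  by (rule fls_fps_eqI) simp

lemma theta_lift_const_mult [simp]: "theta (lift_const c * F) = lift_const c * theta F"
  by (simp add: theta_mult)

lemma fps_X_eq_lift_const: "fps_X = lift_const fps_X"
  by (rule fls_fps_eqI) (simp add: fps_X_nth)

lemma theta_fps_X [simp]: "theta fps_X = 0"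
  by (simp add: fps_X_eq_lift_const)

lemma of_nat_eq_lift_const: "of_nat k = lift_const (of_nat k)"
  by (induction k) (simp_all add: lift_const_add)

lemma numeral_eq_lift_const: "numeral k = lift_const (numeral k)"
  using of_nat_eq_lift_const[of "numeral k"] by simp

lemma theta_numeral_mult [simp]: "theta (numeral k * F) = numeral k * theta F"
  by (simp add: numeral_eq_lift_const)

subsection \<open>Supports\<close>

lemma supp_ge_mono: "supp_ge m F \<Longrightarrow> m' \<le> m \<Longrightarrow> supp_ge m' F"
  by (simp add: supp_ge_def)

lemma supp_le_mono: "supp_le m F \<Longrightarrow> m \<le> m' \<Longrightarrow> supp_le m' F"
  by (simp add: supp_le_def)

lemma band_mono: "band m F \<Longrightarrow> m \<le> m' \<Longrightarrow> band m' F"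
  by (auto simp: band_def intro: supp_ge_mono supp_le_mono)

lemma supp_ge_add: "supp_ge m F \<Longrightarrow> supp_ge m G \<Longrightarrow> supp_ge m (F + G)"
  and supp_le_add: "supp_le m F \<Longrightarrow> supp_le m G \<Longrightarrow> supp_le m (F + G)"
  and supp_ge_diff: "supp_ge m F \<Longrightarrow> supp_ge m G \<Longrightarrow> supp_ge m (F - G)"
  and supp_le_diff: "supp_le m F \<Longrightarrow> supp_le m G \<Longrightarrow> supp_le m (F - G)"
  and supp_ge_minus: "supp_ge m F \<Longrightarrow> supp_ge m (- F)"
  and supp_le_minus: "supp_le m F \<Longrightarrow> supp_le m (- F)"
  and supp_ge_theta: "supp_ge m F \<Longrightarrow> supp_ge m (theta F)"
  and supp_le_theta: "supp_le m F \<Longrightarrow> supp_le m (theta F)"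
  and supp_ge_0 [simp]: "supp_ge m 0"
  and supp_le_0 [simp]: "supp_le m 0"
  by (simp_all add: supp_ge_def supp_le_def)

lemma supp_ge_sum: "(\<And>i. i \<in> I \<Longrightarrow> supp_ge m (f i)) \<Longrightarrow> supp_ge m (sum f I)"
  by (induction I rule: infinite_finite_induct) (auto intro: supp_ge_add)

lemma supp_le_sum: "(\<And>i. i \<in> I \<Longrightarrow> supp_le m (f i)) \<Longrightarrow> supp_le m (sum f I)"
  by (induction I rule: infinite_finite_induct) (auto intro: supp_le_add)

lemma supp_ge_mult:
  assumes "supp_ge p F" "supp_ge q G"
  shows "supp_ge (p + q) (F * G)"
proof -
  have *: "(f * g) $$ a = 0" if "\<And>a. a < p \<Longrightarrow> f $$ a = 0" "\<And>a. a < q \<Longrightarrow> g $$ a = 0" "a < p + q"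
    for f g :: "'a fls" and a
  proof -
    have "f $$ i * g $$ (a - i) = 0" for i
      using that by (cases "i < p") auto
    then show ?thesis unfolding fls_times_nth(2) by (intro sum.neutral) blast
  qed
  show ?thesis
    unfolding supp_ge_def using assms
    by (auto simp: fps_mult_nth fls_sum_nth supp_ge_def intro!: sum.neutral *)
qed

lemma supp_le_mult:
  assumes "supp_le p F" "supp_le q G"
  shows "supp_le (p + q) (F * G)"
proof -
  have *: "(f * g) $$ a = 0" if "\<And>a. a > p \<Longrightarrow> f $$ a = 0" "\<And>a. a > q \<Longrightarrow> g $$ a = 0" "a > p + q"
    for f g :: "'a fls" and a
  proof -
    have "f $$ i * g $$ (a - i) = 0" for i
      using that by (cases "i > p") auto
    then show ?thesis unfolding fls_times_nth(2) by (intro sum.neutral) blast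
  qed
  show ?thesis
    unfolding supp_le_def using assms
    by (auto simp: fps_mult_nth fls_sum_nth supp_le_def intro!: sum.neutral *)
qed

lemma supp_ge_lift_const_mult: "supp_ge m F \<Longrightarrow> supp_ge m (lift_const c * F)"
  and supp_le_lift_const_mult: "supp_le m F \<Longrightarrow> supp_le m (lift_const c * F)"
proof -
  have "xcoeff F a = 0 \<Longrightarrow> (lift_const c * F) $ n $$ a = 0" for n a
    by simp
  then show "supp_ge m F \<Longrightarrow> supp_ge m (lift_const c * F)" "supp_le m F \<Longrightarrow> supp_le m (lift_const c * F)"
    by (auto simp: supp_ge_def supp_le_def fps_eq_iff simp del: lift_const_mult_nth)
qed

lemma supp_ge_xpow_mult: "supp_ge m F \<Longrightarrow> supp_ge (m + k) (xpow k * F)"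
  and supp_le_xpow_mult: "supp_le m F \<Longrightarrow> supp_le (m + k) (xpow k * F)"
  by (auto simp: supp_ge_def supp_le_def)

lemma band_iff: "band B F \<longleftrightarrow> (\<forall>n a. \<bar>a\<bar> > B \<longrightarrow> F $ n $$ a = 0)"
proof -
  have "\<bar>a\<bar> > B \<longleftrightarrow> a < - B \<or> B < a" for a :: int by auto
  then show ?thesis unfolding band_def supp_ge_def supp_le_def by auto
qed

lemma band_add: "band B F \<Longrightarrow> band B G \<Longrightarrow> band B (F + G)"
  and band_diff: "band B F \<Longrightarrow> band B G \<Longrightarrow> band B (F - G)"
  and band_minus: "band B F \<Longrightarrow> band B (- F)"
  and band_theta: "band B F \<Longrightarrow> band B (theta F)"
  and band_0 [simp]: "band B 0"
  and band_lift_const_mult: "band B F \<Longrightarrow> band B (lift_const c * F)"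
  by (auto simp: band_def intro!: supp_ge_lift_const_mult supp_le_lift_const_mult supp_ge_add
      supp_le_add supp_ge_diff supp_le_diff supp_ge_minus supp_le_minus supp_ge_theta supp_le_theta)

lemma band_mult: "band B F \<Longrightarrow> band C G \<Longrightarrow> band (B + C) (F * G)"
  unfolding band_def using supp_ge_mult[of "-B" F "-C" G] supp_le_mult[of B F C G] by simp

lemma band_sum: "(\<And>i. i \<in> I \<Longrightarrow> band B (f i)) \<Longrightarrow> band B (sum f I)"
  by (induction I rule: infinite_finite_induct) (auto intro: band_add)

lemma band_lift_const: "0 \<le> B \<Longrightarrow> band B (lift_const c)"
  by (auto simp: band_iff)

lemma band_1: "0 \<le> B \<Longrightarrow> band B 1"
  using band_lift_const[of B 1] by simp

lemma band_xpow: "\<bar>k\<bar> \<le> B \<Longrightarrow> band B (xpow k)"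
  by (auto simp: band_iff xpow_nth)

lemma band_power: "band B F \<Longrightarrow> band (int n * B) (F ^ n)"
proof (induction n)
  case (Suc n)
  then show ?case using band_mult[of B F "int n * B" "F ^ n"] by (simp add: algebra_simps)
qed (simp add: band_1)

lemma Lpoly_bands:
  assumes "finite I" "\<And>i. i \<in> I \<Longrightarrow> f i \<in> Lpoly"
  shows "\<exists>B\<ge>0. \<forall>i\<in>I. band B (f i)"
  using assms
proof (induction I rule: finite_induct)
  case (insert j I)
  then obtain B where "B \<ge> 0" "\<forall>i\<in>I. band B (f i)" by blast
  moreover obtain C where "band C (f j)" using insert.prems by (auto simp: Lpoly_def)
  ultimately show ?case by (intro exI[of _ "max B C"]) (auto intro: band_mono)
qed auto

lemma Lpoly_add [intro]: "F \<in> Lpoly \<Longrightarrow> G \<in> Lpoly \<Longrightarrow> F + G \<in> Lpoly"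
proof -
  assume "F \<in> Lpoly" "G \<in> Lpoly"
  then obtain B C where "band B F" "band C G" by (auto simp: Lpoly_def)
  then have "band (max B C) (F + G)" by (intro band_add) (auto intro: band_mono)
  then show ?thesis by (auto simp: Lpoly_def)
qed

lemma Lpoly_minus [intro]: "F \<in> Lpoly \<Longrightarrow> - F \<in> Lpoly"
  by (auto simp: Lpoly_def intro: band_minus)

lemma Lpoly_diff [intro]: "F \<in> Lpoly \<Longrightarrow> G \<in> Lpoly \<Longrightarrow> F - G \<in> Lpoly"
  using Lpoly_add[OF _ Lpoly_minus, of F G] by simp

lemma Lpoly_mult [intro]: "F \<in> Lpoly \<Longrightarrow> G \<in> Lpoly \<Longrightarrow> F * G \<in> Lpoly"
  by (auto simp: Lpoly_def intro: band_mult)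

lemma Lpoly_lift_const [intro, simp]: "lift_const c \<in> Lpoly"
  using band_lift_const[of 0] by (auto simp: Lpoly_def)

lemma Lpoly_xpow [intro, simp]: "xpow k \<in> Lpoly"
  using band_xpow[of k "\<bar>k\<bar>"] by (auto simp: Lpoly_def)

lemma Lpoly_0 [intro, simp]: "0 \<in> Lpoly"
  using Lpoly_lift_const[of 0] by simp

lemma Lpoly_1 [intro, simp]: "1 \<in> Lpoly"
  using Lpoly_lift_const[of 1] by simp

lemma Lpoly_fps_X [intro, simp]: "fps_X \<in> Lpoly"
  by (simp add: fps_X_eq_lift_const)

lemma Lpoly_of_nat [intro, simp]: "of_nat k \<in> Lpoly"
  by (simp add: of_nat_eq_lift_const)

lemma Lpoly_numeral [intro, simp]: "numeral k \<in> Lpoly"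
  by (simp add: numeral_eq_lift_const)

lemma Lpoly_theta [intro]: "F \<in> Lpoly \<Longrightarrow> theta F \<in> Lpoly"
  by (auto simp: Lpoly_def intro: band_theta)

lemma Lpoly_sum [intro]: "(\<And>i. i \<in> I \<Longrightarrow> f i \<in> Lpoly) \<Longrightarrow> sum f I \<in> Lpoly"
  by (induction I rule: infinite_finite_induct) auto

lemma Lpoly_power [intro]: "F \<in> Lpoly \<Longrightarrow> F ^ n \<in> Lpoly"
  by (induction n) auto

lemma band_expansion:
  assumes "band B F"
  shows "F = (\<Sum>k\<in>{-B..B}. lift_const (xcoeff F k) * xpow k)"
proof (rule xcoeff_eqI)
  fix a
  have "xcoeff F a = 0" if "a \<notin> {-B..B}"
    using assms that by (intro fps_ext) (auto simp: band_iff abs_if)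
  then show "xcoeff F a = xcoeff (\<Sum>k\<in>{-B..B}. lift_const (xcoeff F k) * xpow k) a"
    by (auto simp: xcoeff_xpow if_distrib[of "\<lambda>x. _ * x"] sum.delta' sum.delta cong: if_cong)
qed

lemma xcoeff_band_mult:
  assumes "band B P"
  shows "xcoeff (P * F) a = (\<Sum>k\<in>{-B..B}. xcoeff P k * xcoeff F (a - k))"
proof -
  have "P * F = (\<Sum>k\<in>{-B..B}. lift_const (xcoeff P k) * (xpow k * F))"
    by (subst band_expansion[OF assms]) (simp add: sum_distrib_right mult.assoc)
  then show ?thesis by simp
qed


section \<open>D-finite series as elements of finitely generated differential modules\<close>

inductive_set lspan :: "'c::field_char_0 fls fps set \<Rightarrow> 'c fls fps set"
  for G where
  zero [intro, simp]: "0 \<in> lspan G"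
| cons: "m \<in> Lpoly \<Longrightarrow> g \<in> G \<Longrightarrow> x \<in> lspan G \<Longrightarrow> m * g + x \<in> lspan G"

lemma lspan_base: "g \<in> G \<Longrightarrow> g \<in> lspan G"
  using lspan.cons[of 1 g G 0] by simp

lemma lspan_add [intro]: "x \<in> lspan G \<Longrightarrow> y \<in> lspan G \<Longrightarrow> x + y \<in> lspan G"
  by (induction rule: lspan.induct) (auto simp: add.assoc intro: lspan.cons)

lemma lspan_scale [intro]:
  assumes "m \<in> Lpoly" "x \<in> lspan G"
  shows "m * x \<in> lspan G"
  using assms(2)
proof (induction rule: lspan.induct)
  case (cons m' g x)
  then show ?case
    using lspan.cons[of "m * m'" g G "m * x"] assms(1) by (auto simp: algebra_simps)
qed simp

lemma lspan_minus [intro]: "x \<in> lspan G \<Longrightarrow> - x \<in> lspan G"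
  using lspan_scale[of "- 1" x G] Lpoly_minus[OF Lpoly_1] by simp

lemma lspan_diff [intro]: "x \<in> lspan G \<Longrightarrow> y \<in> lspan G \<Longrightarrow> x - y \<in> lspan G"
  using lspan_add[OF _ lspan_minus, of x G y] by simp

lemma lspan_sum [intro]: "(\<And>i. i \<in> I \<Longrightarrow> f i \<in> lspan G) \<Longrightarrow> sum f I \<in> lspan G"
  by (induction I rule: infinite_finite_induct) auto

lemma lspan_subset:
  assumes "G \<subseteq> lspan H"
  shows "lspan G \<subseteq> lspan H"
proof
  fix x assume "x \<in> lspan G"
  then show "x \<in> lspan H" using assms by (induction rule: lspan.induct) auto
qed

lemma lspan_mono: "G \<subseteq> H \<Longrightarrow> x \<in> lspan G \<Longrightarrow> x \<in> lspan H"
  using lspan_subset[of G H] lspan_base by blast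

lemma lspan_finite_repr:
  assumes "finite G" "x \<in> lspan G"
  shows "\<exists>m. (\<forall>g. m g \<in> Lpoly) \<and> x = (\<Sum>g\<in>G. m g * g)"
  using assms(2)
proof (induction rule: lspan.induct)
  case zero
  show ?case by (rule exI[of _ "\<lambda>_. 0"]) simp
next
  case (cons m g x)
  then obtain m' where m': "\<forall>g. m' g \<in> Lpoly" "x = (\<Sum>g\<in>G. m' g * g)" by blast
  have "(\<Sum>h\<in>G. (m' h + (if h = g then m else 0)) * h) = x + (\<Sum>h\<in>G. if h = g then m * h else 0)"
    unfolding m'(2) sum.distrib[symmetric] by (intro sum.cong) (auto simp: algebra_simps)
  also have "\<dots> = m * g + x"
    using assms(1) cons.hyps by (simp add: add.commute)
  finally show ?case
    using m'(1) cons.hyps by (intro exI[of _ "\<lambda>h. m' h + (if h = g then m else 0)"]) auto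
qed

lemma lspan_mult:
  assumes "x \<in> lspan G" "y \<in> lspan H"
  shows "x * y \<in> lspan ((\<lambda>(g, h). g * h) ` (G \<times> H))"
  using assms(1)
proof (induction rule: lspan.induct)
  case (cons m g x)
  have "g * y \<in> lspan ((\<lambda>(g, h). g * h) ` (G \<times> H))"
    using assms(2)
  proof (induction rule: lspan.induct)
    case (cons m' h y)
    have "g * h \<in> (\<lambda>(g, h). g * h) ` (G \<times> H)"
      using cons \<open>g \<in> G\<close> by auto
    then show ?case
      using lspan.cons[OF cons.hyps(1) _ cons.IH, of "g * h"] by (simp add: algebra_simps)
  qed simp
  then show ?case
    using cons by (auto simp: algebra_simps intro!: lspan_add)
      (metis lspan_scale mult.left_commute)
qed simp

definition theta_stable :: "'c::field_char_0 fls fps \<Rightarrow> 'c fls fps set \<Rightarrow> bool" where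
  "theta_stable e G \<longleftrightarrow> finite G \<and> e \<in> Lpoly \<and> e \<noteq> 0 \<and> (\<forall>g\<in>G. e * theta g \<in> lspan G)"

lemma theta_stable_lspan:
  assumes "theta_stable e G" "x \<in> lspan G"
  shows "e * theta x \<in> lspan G"
  using assms(2)
proof (induction rule: lspan.induct)
  case (cons m g x)
  have "e * theta (m * g + x) = (e * theta m) * g + m * (e * theta g) + e * theta x"
    by (simp add: theta_mult algebra_simps)
  moreover have "e * theta m * g \<in> lspan G" "m * (e * theta g) \<in> lspan G"
    using assms(1) cons by (auto simp: theta_stable_def intro: lspan_base)
  ultimately show ?case
    using cons.IH by (simp only:) (intro lspan_add)
qed simp

text \<open>Finitely generated differential modules over the Laurent polynomials (with one denominator for
  the derivation) make closure under sums and products immediate; recurrences and equations are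
  extracted from them by linear dependence.\<close>

definition dfin :: "'c::field_char_0 fls fps \<Rightarrow> bool" where
  "dfin F \<longleftrightarrow> (\<exists>e G. theta_stable e G \<and> F \<in> lspan G)"

definition theta_rel :: "nat \<Rightarrow> (nat \<Rightarrow> 'c::field_char_0 fls fps) \<Rightarrow> 'c fls fps \<Rightarrow> bool" where
  "theta_rel r P F \<longleftrightarrow> (\<forall>i. P i \<in> Lpoly) \<and> (\<Sum>i\<le>r. P i * (theta ^^ i) F) = 0"

lemma theta_rel_of_stable:
  assumes "theta_stable e G" "p \<in> Lpoly" "p \<noteq> 0" "p * F \<in> lspan G"
  shows "\<exists>r P. theta_rel r P F \<and> (\<exists>i\<le>r. P i \<noteq> 0)"
proof -
  have e: "e \<in> Lpoly" "e \<noteq> 0" and G: "finite G" using assms(1) by (auto simp: theta_stable_def)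
  define y where "y j = p ^ Suc j * e ^ j * (theta ^^ j) F" for j
  have y: "y j \<in> lspan G" for j
  proof (induction j)
    case 0
    then show ?case using assms(4) by (simp add: y_def)
  next
    case (Suc j)
    have *: "of_nat j * (e * (e ^ (j - 1) * z)) = of_nat j * (e ^ j * z)" for z :: "'a fls fps"
      by (cases j) (simp_all add: algebra_simps)
    have "theta (y j) = of_nat (Suc j) * p ^ j * theta p * e ^ j * (theta ^^ j) F
        + p ^ Suc j * (of_nat j * e ^ (j - 1) * theta e) * (theta ^^ j) F
        + p ^ Suc j * e ^ j * (theta ^^ Suc j) F"
      unfolding y_def theta_mult theta_power by (simp add: algebra_simps)
    then have "p * (e * theta (y j)) = of_nat (Suc j) * e * theta p * y j
        + p * theta e * (of_nat j * (e * (e ^ (j - 1) * (p ^ Suc j * (theta ^^ j) F)))) + y (Suc j)"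
      by (simp add: y_def algebra_simps)
    then have "p * (e * theta (y j)) = of_nat (Suc j) * e * theta p * y j
        + p * theta e * of_nat j * y j + y (Suc j)"
      unfolding * by (simp add: y_def algebra_simps)
    then have "y (Suc j) = p * (e * theta (y j)) - (of_nat (Suc j) * e * theta p) * y j
        - (p * theta e * of_nat j) * y j"
      by (simp add: algebra_simps)
    moreover have "of_nat (Suc j) * e * theta p \<in> Lpoly" "p * theta e * of_nat j \<in> Lpoly"
      using e assms(2) by (intro Lpoly_mult Lpoly_of_nat Lpoly_theta; simp)+
    ultimately show ?case
      using theta_stable_lspan[OF assms(1) Suc] Suc assms(2) by (metis lspan_diff lspan_scale)
  qed
  have "\<forall>j. \<exists>m. (\<forall>g. m g \<in> Lpoly) \<and> y j = (\<Sum>g\<in>G. m g * g)"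
    using lspan_finite_repr[OF G y] by blast
  then obtain m where m: "\<And>j g. m j g \<in> Lpoly" "\<And>j. y j = (\<Sum>g\<in>G. m j g * g)" by metis
  have "\<exists>c. (\<forall>i. c i \<in> Lpoly) \<and> (\<exists>i\<in>{..card G}. c i \<noteq> 0) \<and> (\<forall>g\<in>G. (\<Sum>i\<le>card G. c i * m i g) = 0)"
    using G m(1) by (intro exists_linear_dependence) auto
  then obtain c where c: "\<And>i. c i \<in> Lpoly" "\<exists>i\<in>{..card G}. c i \<noteq> 0"
      "\<And>g. g \<in> G \<Longrightarrow> (\<Sum>i\<le>card G. c i * m i g) = 0" by blast
  have "(\<Sum>i\<le>card G. c i * y i) = (\<Sum>g\<in>G. (\<Sum>i\<le>card G. c i * m i g) * g)"
    unfolding m(2) sum_distrib_left sum_distrib_right by (subst sum.swap) (simp add: mult.assoc)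
  also have "\<dots> = 0" using c(3) by simp
  finally have "theta_rel (card G) (\<lambda>i. c i * (p ^ Suc i * e ^ i)) F"
    unfolding theta_rel_def using c(1) assms(2) e by (auto simp: y_def mult.assoc simp del: power_Suc)
  moreover have "\<exists>i\<le>card G. c i * (p ^ Suc i * e ^ i) \<noteq> 0"
    using c(2) e assms(3) by auto
  ultimately show ?thesis by blast
qed

lemma dfin_of_theta_rel:
  assumes "theta_rel r P F" "\<exists>i\<le>r. P i \<noteq> 0"
  shows "\<exists>s. theta_rel s P F \<and> P s \<noteq> 0" "dfin F"
proof -
  define s where "s = Max {i. i \<le> r \<and> P i \<noteq> 0}"
  have fin: "finite {i. i \<le> r \<and> P i \<noteq> 0}" by simp
  have s: "s \<le> r" "P s \<noteq> 0"
    using Max_in[OF fin] assms(2) by (auto simp: s_def)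
  have "P i = 0" if "s < i" "i \<le> r" for i
    using Max_ge[OF fin, of i] that unfolding s_def by fastforce
  then have "(\<Sum>i\<le>r. P i * (theta ^^ i) F) = (\<Sum>i\<le>s. P i * (theta ^^ i) F)"
    using s(1) by (intro sum.mono_neutral_right) auto
  then have rel: "theta_rel s P F" using assms(1) by (simp add: theta_rel_def)
  then show "\<exists>s. theta_rel s P F \<and> P s \<noteq> 0" using s(2) by blast
  define G where "G = (\<lambda>i. (theta ^^ i) F) ` {..<s}"
  have top: "P s * (theta ^^ s) F = - (\<Sum>i<s. P i * (theta ^^ i) F)"
    using rel by (simp add: theta_rel_def lessThan_Suc_atMost[symmetric] add_eq_0_iff)
  have P: "\<And>i. P i \<in> Lpoly" using rel by (simp add: theta_rel_def)
  have G: "(theta ^^ i) F \<in> lspan G" if "i < s" for i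
    using that by (auto simp: G_def intro!: lspan_base)
  have "P s * theta ((theta ^^ i) F) \<in> lspan G" if "i < s" for i
  proof (cases "Suc i = s")
    case True
    have "- (\<Sum>i<s. P i * (theta ^^ i) F) \<in> lspan G"
      using P G by (intro lspan_minus lspan_sum lspan_scale) auto
    then show ?thesis using top True by auto
  next
    case False
    then show ?thesis using G[of "Suc i"] that P by auto
  qed
  then have "theta_stable (P s) G"
    using P s(2) by (auto simp: theta_stable_def G_def)
  moreover have "F \<in> lspan G"
  proof (cases "s = 0")
    case True
    then show ?thesis using top s(2) by (simp add: G_def)
  qed (use G[of 0] in auto)
  ultimately show "dfin F" by (auto simp: dfin_def)
qed

lemma dfin_theta_rel:
  assumes "dfin F"
  shows "\<exists>r P. theta_rel r P F \<and> P r \<noteq> 0"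
proof -
  obtain e G where "theta_stable e G" "F \<in> lspan G" using assms by (auto simp: dfin_def)
  then have "\<exists>r P. theta_rel r P F \<and> (\<exists>i\<le>r. P i \<noteq> 0)"
    using theta_rel_of_stable[of e G 1 F] by auto
  then show ?thesis using dfin_of_theta_rel(1) by blast
qed

lemma dfin_cancel:
  assumes "dfin (p * F)" "p \<in> Lpoly" "p \<noteq> 0"
  shows "dfin F"
proof -
  obtain e G where "theta_stable e G" "p * F \<in> lspan G" using assms by (auto simp: dfin_def)
  then show ?thesis using theta_rel_of_stable[of e G p F] assms dfin_of_theta_rel(2) by blast
qed

lemma theta_stable_scale:
  assumes "theta_stable e G" "f \<in> Lpoly" "f \<noteq> 0"
  shows "theta_stable (e * f) G"
  using assms unfolding theta_stable_def by (auto simp: mult.commute[of e] mult.assoc)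

lemma theta_stable_Un:
  assumes "theta_stable e G" "theta_stable e H"
  shows "theta_stable e (G \<union> H)"
  using assms unfolding theta_stable_def by (auto intro: lspan_mono[of G] lspan_mono[of H])

lemma theta_stable_mult:
  assumes "theta_stable e G" "theta_stable e H"
  shows "theta_stable e ((\<lambda>(g, h). g * h) ` (G \<times> H))"
proof -
  have "e * theta (g * h) \<in> lspan ((\<lambda>(g, h). g * h) ` (G \<times> H))" if "g \<in> G" "h \<in> H" for g h
  proof -
    have "e * theta (g * h) = (e * theta g) * h + g * (e * theta h)"
      by (simp add: theta_mult algebra_simps)
    moreover have "e * theta g * h \<in> lspan ((\<lambda>(g, h). g * h) ` (G \<times> H))"
      "g * (e * theta h) \<in> lspan ((\<lambda>(g, h). g * h) ` (G \<times> H))"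
      using assms that by (auto simp: theta_stable_def intro: lspan_mult lspan_base)
    ultimately show ?thesis by (metis lspan_add)
  qed
  then show ?thesis using assms by (auto simp: theta_stable_def)
qed

lemma dfin_common:
  assumes "dfin F" "dfin F'"
  obtains e G H where "theta_stable e G" "theta_stable e H" "F \<in> lspan G" "F' \<in> lspan H"
proof -
  obtain e G where 1: "theta_stable e G" "F \<in> lspan G" using assms by (auto simp: dfin_def)
  obtain f H where 2: "theta_stable f H" "F' \<in> lspan H" using assms by (auto simp: dfin_def)
  have "theta_stable (e * f) G" "theta_stable (f * e) H"
    using theta_stable_scale 1 2 by (auto simp: theta_stable_def)
  then show ?thesis using that 1 2 by (metis mult.commute)
qed

lemma dfin_add:
  assumes "dfin F" "dfin F'"
  shows "dfin (F + F')"
proof -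
  obtain e G H where *: "theta_stable e G" "theta_stable e H" "F \<in> lspan G" "F' \<in> lspan H"
    using dfin_common[OF assms] .
  then have "F + F' \<in> lspan (G \<union> H)"
    using lspan_mono[of G "G \<union> H" F] lspan_mono[of H "G \<union> H" F'] by auto
  then show ?thesis using theta_stable_Un[OF *(1,2)] unfolding dfin_def by blast
qed

lemma dfin_mult:
  assumes "dfin F" "dfin F'"
  shows "dfin (F * F')"
proof -
  obtain e G H where *: "theta_stable e G" "theta_stable e H" "F \<in> lspan G" "F' \<in> lspan H"
    using dfin_common[OF assms] .
  then show ?thesis
    using lspan_mult[OF *(3,4)] theta_stable_mult[OF *(1,2)] unfolding dfin_def by blast
qed

lemma dfin_Lpoly: "F \<in> Lpoly \<Longrightarrow> dfin F"
proof -
  have "theta_stable 1 {1}" by (simp add: theta_stable_def)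
  then show "F \<in> Lpoly \<Longrightarrow> dfin F"
    unfolding dfin_def using lspan.cons[of F 1 "{1}" 0] by auto
qed

lemma dfin_0 [simp]: "dfin 0"
  by (rule dfin_Lpoly) simp

lemma dfin_minus: "dfin F \<Longrightarrow> dfin (- F)"
  using dfin_mult[OF dfin_Lpoly[of "- 1"], of F] Lpoly_minus[OF Lpoly_1] by simp

lemma dfin_diff: "dfin F \<Longrightarrow> dfin F' \<Longrightarrow> dfin (F - F')"
  using dfin_add[OF _ dfin_minus, of F F'] by simp

lemma dfin_sum: "(\<And>i. i \<in> I \<Longrightarrow> dfin (f i)) \<Longrightarrow> dfin (sum f I)"
  by (induction I rule: infinite_finite_induct) (auto intro: dfin_add)

lemma dfin_Lpoly_mult: "p \<in> Lpoly \<Longrightarrow> dfin F \<Longrightarrow> dfin (p * F)"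
  by (rule dfin_mult[OF dfin_Lpoly])

lemma dfin_reflect:
  assumes "dfin F" "\<And>n a. F' $ n $$ a = F $ n $$ (- a)"
  shows "dfin F'"
proof -
  obtain r P where P: "theta_rel r P F" "P r \<noteq> 0" using dfin_theta_rel[OF assms(1)] by blast
  obtain B where B: "\<forall>i\<in>{..r}. band B (P i)"
    using Lpoly_bands[of "{..r}" P] P(1) by (auto simp: theta_rel_def)
  define Q where "Q i = (\<Sum>k\<in>{-B..B}. lift_const ((- 1) ^ i * xcoeff (P i) (- k)) * xpow k)" for i
  have Q: "xcoeff (Q i) k = (if k \<in> {-B..B} then (- 1) ^ i * xcoeff (P i) (- k) else 0)" for i k
    by (auto simp: Q_def xcoeff_xpow if_distrib[of "\<lambda>x. _ * x"] sum.delta' cong: if_cong)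
  have bQ: "band B (Q i)" for i
    unfolding Q_def by (intro band_sum band_lift_const_mult band_xpow) auto
  have F': "xcoeff F' a = xcoeff F (- a)" for a
    by (rule fps_ext) (simp add: assms(2))
  have "xcoeff (\<Sum>i\<le>r. Q i * (theta ^^ i) F') a = xcoeff (\<Sum>i\<le>r. P i * (theta ^^ i) F) (- a)" for a
  proof -
    have "xcoeff (Q i * (theta ^^ i) F') a = xcoeff (P i * (theta ^^ i) F) (- a)" if "i \<le> r" for i
    proof -
      have "xcoeff (Q i * (theta ^^ i) F') a
          = (\<Sum>k\<in>{-B..B}. (- 1) ^ i * xcoeff (P i) (- k) * (of_int (a - k) ^ i * xcoeff F (k - a)))"
        by (subst xcoeff_band_mult[OF bQ]) (auto simp: Q F' simp del: of_int_diff intro!: sum.cong)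
      also have "\<dots> = (\<Sum>k\<in>{-B..B}. (- 1) ^ i * xcoeff (P i) k * (of_int (a + k) ^ i * xcoeff F (- k - a)))"
        by (rule sum.reindex_bij_witness[of _ uminus uminus]) auto
      also have "\<dots> = (\<Sum>k\<in>{-B..B}. xcoeff (P i) k * (of_int (- a - k) ^ i * xcoeff F (- a - k)))"
      proof (intro sum.cong refl)
        fix k
        have "of_int (- a - k) ^ i = (- 1) ^ i * (of_int (a + k) ^ i :: 'a fps)"
          unfolding power_mult_distrib[symmetric] by simp
        moreover have "- k - a = - a - k" by simp
        ultimately show "(- 1) ^ i * xcoeff (P i) k * (of_int (a + k) ^ i * xcoeff F (- k - a))
            = xcoeff (P i) k * (of_int (- a - k) ^ i * xcoeff F (- a - k))"
          by (simp only: mult_ac)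
      qed
      also have "\<dots> = xcoeff (P i * (theta ^^ i) F) (- a)"
        using B that by (subst xcoeff_band_mult[of B]) auto
      finally show ?thesis .
    qed
    then show ?thesis by simp
  qed
  then have "(\<Sum>i\<le>r. Q i * (theta ^^ i) F') = 0"
    using P(1) by (intro xcoeff_eqI) (simp only: theta_rel_def xcoeff_0)
  then have "theta_rel r Q F'"
    using bQ by (auto simp: theta_rel_def Lpoly_def)
  moreover have "Q r \<noteq> 0"
  proof
    assume "Q r = 0"
    then have "xcoeff (P r) (- k) = 0" if "k \<in> {-B..B}" for k
      using Q[of r k] that by (simp split: if_splits)
    from this[of "- k" for k] have "xcoeff (P r) k = 0" if "k \<in> {-B..B}" for k
      using that by force
    then have "P r = 0" using band_expansion[of B "P r"] B by simp
    then show False using P(2) by simp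
  qed
  ultimately show ?thesis using dfin_of_theta_rel(2) by blast
qed

subsection \<open>Passage to the usual derivation and to polynomial coefficients\<close>

primrec stir :: "nat \<Rightarrow> nat \<Rightarrow> 'c::field_char_0 fls fps" where
  "stir 0 = (\<lambda>j. if j = 0 then 1 else 0)"
| "stir (Suc i) = (\<lambda>j. theta (stir i j) + (if j = 0 then 0 else xpow 1 * stir i (j - 1)))"

lemma stir_Lpoly: "stir i j \<in> Lpoly"
  by (induction i arbitrary: j) auto

lemma stir_above: "i < j \<Longrightarrow> stir i j = 0"
  by (induction i arbitrary: j) auto

lemma stir_diag: "stir i i = xpow (int i)"
  by (induction i) (auto simp: stir_above xpow_add)

lemma theta_conv_deriv_x: "theta F = xpow 1 * deriv_x F"
  by (rule fls_fps_eqI) (simp add: deriv_x_def)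

lemma theta_pow_conv_stir:
  "i \<le> N \<Longrightarrow> (theta ^^ i) F = (\<Sum>j\<le>N. stir i j * (deriv_x ^^ j) F)"
proof (induction i)
  case 0
  then show ?case by (simp add: if_distrib[of "\<lambda>x. x * _"] cong: if_cong)
next
  case (Suc i)
  obtain M where N: "N = Suc M" using Suc.prems by (cases N) auto
  have "(theta ^^ Suc i) F = (\<Sum>j\<le>N. theta (stir i j) * (deriv_x ^^ j) F)
      + (\<Sum>j\<le>N. stir i j * (xpow 1 * (deriv_x ^^ Suc j) F))"
    using Suc by (simp add: theta_mult sum.distrib theta_conv_deriv_x[of "(deriv_x ^^ _) F"])
  also have "(\<Sum>j\<le>N. stir i j * (xpow 1 * (deriv_x ^^ Suc j) F))
      = (\<Sum>j\<le>M. stir i j * (xpow 1 * (deriv_x ^^ Suc j) F))"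
    using Suc.prems by (simp add: N stir_above)
  also have "\<dots> = (\<Sum>j\<le>N. (if j = 0 then 0 else xpow 1 * stir i (j - 1)) * (deriv_x ^^ j) F)"
    unfolding N sum.atMost_Suc_shift by (simp add: mult_ac)
  finally show ?case by (simp add: sum.distrib[symmetric] algebra_simps)
qed

lemma poly_in_x_add: "poly_in_x (p + q) = poly_in_x p + poly_in_x (q :: 'c::field_char_0 fps poly)"
proof -
  have "map_poly lift_const (p + q) = map_poly lift_const p + map_poly lift_const q"
    by (rule poly_eqI) (simp add: coeff_map_poly lift_const_add)
  then show ?thesis by (simp add: poly_in_x_def)
qed

lemma poly_in_x_0 [simp]: "poly_in_x 0 = 0"
  by (simp add: poly_in_x_def)

lemma poly_in_x_monom:
  "poly_in_x (monom c k) = lift_const c * xpow (int k)" for c :: "'c::field_char_0 fps"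
proof -
  have "fps_const fls_X ^ k = (xpow (int k) :: 'c fls fps)"
    by (simp add: xpow_def fps_const_power fls_X_power_conv_shift_1)
  then show ?thesis by (simp add: poly_in_x_def map_poly_monom poly_monom)
qed

lemma poly_in_x_surj:
  assumes "supp_ge 0 F" "F \<in> Lpoly"
  shows "\<exists>p. F = poly_in_x p"
proof -
  obtain B where B: "band B F" using assms(2) by (auto simp: Lpoly_def)
  have ge: "xcoeff F k = 0" if "k < 0" for k
    using assms(1) that by (auto simp: supp_ge_def fps_eq_iff)
  define f where "f k = lift_const (xcoeff F k) * xpow k" for k
  have "F = (\<Sum>k\<in>{-B..B}. f k)"
    using band_expansion[OF B] by (simp add: f_def)
  also have "\<dots> = (\<Sum>k\<in>{0..B}. f k)"
    by (rule sum.mono_neutral_right) (auto simp: f_def ge)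
  also have "\<dots> = (\<Sum>k\<in>{..nat B}. f (int k))" if "B \<ge> 0"
    using that by (intro sum.reindex_bij_witness[of _ int nat]) auto
  finally have 1: "F = (\<Sum>k\<in>{..nat B}. f (int k))" if "B \<ge> 0" using that by simp
  have sum: "poly_in_x (sum g K) = (\<Sum>k\<in>K. poly_in_x (g k))"
    if "finite K" for g :: "nat \<Rightarrow> 'a fps poly" and K
    using that by (induction K rule: finite_induct) (auto simp: poly_in_x_add)
  show ?thesis
  proof (cases "B \<ge> 0")
    case True
    then have "F = poly_in_x (\<Sum>k\<in>{..nat B}. monom (xcoeff F (int k)) k)"
      using 1 by (simp add: sum poly_in_x_monom f_def)
    then show ?thesis by blast
  next
    case False
    then have "F = 0" using band_expansion[OF B] by simp
    then show ?thesis using poly_in_x_0 by metis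
  qed
qed

theorem D_finite_if_dfin:
  assumes "dfin F"
  shows "D_finite F"
proof -
  obtain r P where P: "theta_rel r P F" "P r \<noteq> 0" using dfin_theta_rel[OF assms] by blast
  define R where "R j = (\<Sum>i\<le>r. P i * stir i j)" for j
  have "(\<Sum>i\<le>r. P i * (theta ^^ i) F) = (\<Sum>i\<le>r. P i * (\<Sum>j\<le>r. stir i j * (deriv_x ^^ j) F))"
    by (intro sum.cong refl arg_cong2[of _ _ _ _ "(*)"] theta_pow_conv_stir) simp
  also have "\<dots> = (\<Sum>j\<le>r. R j * (deriv_x ^^ j) F)"
    unfolding R_def sum_distrib_left sum_distrib_right by (subst sum.swap) (simp add: mult.assoc)
  finally have rel: "(\<Sum>j\<le>r. R j * (deriv_x ^^ j) F) = 0"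
    using P(1) by (simp add: theta_rel_def)
  have "R r = P r * stir r r"
    unfolding R_def by (subst sum.mono_neutral_right[of _ "{r}"]) (auto simp: stir_above)
  then have Rr: "R r \<noteq> 0" using P(2) by (simp add: stir_diag)
  have RL: "R j \<in> Lpoly" for j
    using P(1) stir_Lpoly unfolding R_def theta_rel_def by (intro Lpoly_sum Lpoly_mult) auto
  then obtain B where B: "\<forall>j\<in>{..r}. band B (R j)"
    using Lpoly_bands[of "{..r}" R] by auto
  have "\<exists>p. xpow B * R j = poly_in_x p" if "j \<le> r" for j
    using B that RL[of j] supp_ge_xpow_mult[of "- B" "R j" B]
    by (intro poly_in_x_surj) (auto simp: band_def)
  then have "\<forall>j. \<exists>p. j \<le> r \<longrightarrow> xpow B * R j = poly_in_x p" by blast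
  then obtain p where p: "\<And>j. j \<le> r \<Longrightarrow> xpow B * R j = poly_in_x (p j)" by metis
  have "(\<Sum>j\<le>r. poly_in_x (p j) * (deriv_x ^^ j) F) = xpow B * (\<Sum>j\<le>r. R j * (deriv_x ^^ j) F)"
    by (simp add: p[symmetric] sum_distrib_left mult.assoc)
  also have "\<dots> = 0" using rel by simp
  finally have "(\<Sum>j\<le>r. poly_in_x (p j) * (deriv_x ^^ j) F) = 0" .
  moreover have "p r \<noteq> 0"
    using p[of r] Rr by auto
  ultimately show ?thesis
    unfolding D_finite_def by (intro exI[of _ r] exI[of _ p]) auto
qed


section \<open>Chains of gluing equations\<close>

definition one_sided :: "bool \<Rightarrow> int \<Rightarrow> 'c::field_char_0 fls fps \<Rightarrow> bool" where
  "one_sided pos m F \<longleftrightarrow> (if pos then supp_ge m F else supp_le (- m) F)"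

locale square_root =
  fixes \<rho> :: "'c::field_char_0 fls fps"
  assumes rho_square: "\<rho> * \<rho> \<in> Lpoly" and rho_nth_0: "\<rho> $ 0 = 1"
begin

abbreviation \<Delta> where "\<Delta> \<equiv> \<rho> * \<rho>"

lemma rho_nonzero: "\<rho> \<noteq> 0"
  using rho_nth_0 by auto

lemma Delta_theta_rho: "2 * \<Delta> * theta \<rho> = \<rho> * theta \<Delta>"
  by (simp add: theta_mult algebra_simps)

definition alg :: "'c fls fps \<Rightarrow> bool" where
  "alg F \<longleftrightarrow> (\<exists>p a b. p \<in> Lpoly \<and> p \<noteq> 0 \<and> a \<in> Lpoly \<and> b \<in> Lpoly \<and> p * F = a + \<rho> * b)"

lemma alg_Lpoly [intro]: "F \<in> Lpoly \<Longrightarrow> alg F"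
  unfolding alg_def by (intro exI[of _ 1] exI[of _ F] exI[of _ 0]) auto

lemma alg_rho [intro]: "alg \<rho>"
  unfolding alg_def by (intro exI[of _ 1] exI[of _ 0] exI[of _ 1]) auto

lemma alg_add [intro]:
  assumes "alg F" "alg G"
  shows "alg (F + G)"
proof -
  obtain p a b where 1: "p \<in> Lpoly" "p \<noteq> 0" "a \<in> Lpoly" "b \<in> Lpoly" "p * F = a + \<rho> * b"
    using assms(1) by (auto simp: alg_def)
  obtain q c d where 2: "q \<in> Lpoly" "q \<noteq> 0" "c \<in> Lpoly" "d \<in> Lpoly" "q * G = c + \<rho> * d"
    using assms(2) by (auto simp: alg_def)
  have "(p * q) * (F + G) = q * (p * F) + p * (q * G)" by (simp add: algebra_simps)
  also have "\<dots> = (q * a + p * c) + \<rho> * (q * b + p * d)" unfolding 1 2 by (simp add: algebra_simps)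
  finally show ?thesis
    unfolding alg_def using 1 2
    by (intro exI[of _ "p * q"] exI[of _ "q * a + p * c"] exI[of _ "q * b + p * d"]) auto
qed

lemma alg_mult [intro]:
  assumes "alg F" "alg G"
  shows "alg (F * G)"
proof -
  obtain p a b where 1: "p \<in> Lpoly" "p \<noteq> 0" "a \<in> Lpoly" "b \<in> Lpoly" "p * F = a + \<rho> * b"
    using assms(1) by (auto simp: alg_def)
  obtain q c d where 2: "q \<in> Lpoly" "q \<noteq> 0" "c \<in> Lpoly" "d \<in> Lpoly" "q * G = c + \<rho> * d"
    using assms(2) by (auto simp: alg_def)
  have "(p * q) * (F * G) = (p * F) * (q * G)" by (simp add: algebra_simps)
  also have "\<dots> = (a * c + \<Delta> * (b * d)) + \<rho> * (a * d + b * c)" unfolding 1 2 by (simp add: algebra_simps)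
  finally show ?thesis
    unfolding alg_def using 1 2 rho_square
    by (intro exI[of _ "p * q"] exI[of _ "a * c + \<Delta> * (b * d)"] exI[of _ "a * d + b * c"]) auto
qed

lemma alg_minus [intro]: "alg F \<Longrightarrow> alg (- F)"
  using alg_mult[OF alg_Lpoly[of "- 1"], of F] Lpoly_minus[OF Lpoly_1] by simp

lemma alg_diff [intro]: "alg F \<Longrightarrow> alg G \<Longrightarrow> alg (F - G)"
  using alg_add[OF _ alg_minus, of F G] by simp

lemma alg_cancel: "alg (q * F) \<Longrightarrow> q \<in> Lpoly \<Longrightarrow> q \<noteq> 0 \<Longrightarrow> alg F"
  unfolding alg_def by (metis Lpoly_mult mult.assoc mult_eq_0_iff)

lemma dfin_rho: "dfin \<rho>"
proof -
  have "theta \<Delta> * \<rho> \<in> lspan {\<rho>}"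
    by (intro lspan_scale Lpoly_theta rho_square lspan_base) simp
  then have "2 * \<Delta> * theta \<rho> \<in> lspan {\<rho>}"
    by (simp only: Delta_theta_rho mult.commute[of \<rho> "theta \<Delta>"])
  moreover have "2 * \<Delta> \<in> Lpoly" "2 * \<Delta> \<noteq> 0"
    using Lpoly_mult[OF Lpoly_numeral rho_square] rho_nonzero by auto
  ultimately have "theta_stable (2 * \<Delta>) {\<rho>}"
    unfolding theta_stable_def by simp
  then show ?thesis unfolding dfin_def by (blast intro: lspan_base)
qed

lemma dfin_alg:
  assumes "alg F"
  shows "dfin F"
proof -
  obtain p a b where "p \<in> Lpoly" "p \<noteq> 0" "a \<in> Lpoly" "b \<in> Lpoly" "p * F = a + \<rho> * b"
    using assms by (auto simp: alg_def)
  then show ?thesis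
    using dfin_cancel[of p F] dfin_add[OF dfin_Lpoly[of a] dfin_mult[OF dfin_rho dfin_Lpoly[of b]]]
    by simp
qed

text \<open>Twice the square of the derivation \<open>\<rho> \<theta>\<close>, which is \<open>d/dz\<close> for the uniformising
  parameter \<open>z\<close> of the kernel curve.  It commutes with \<open>\<rho> \<mapsto> - \<rho>\<close>.\<close>

definition T :: "'c fls fps \<Rightarrow> 'c fls fps" where
  "T f = 2 * \<rho> * theta (\<rho> * theta f)"

definition T' :: "'c fls fps \<Rightarrow> 'c fls fps" where
  "T' f = 2 * theta (\<rho> * theta (\<rho> * f))"

lemma T_expand: "T f = 2 * \<Delta> * theta (theta f) + theta \<Delta> * theta f"
  by (simp add: T_def theta_mult algebra_simps)

lemma T'_expand: "T' f = theta (theta \<Delta> * f + 2 * \<Delta> * theta f)"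
proof -
  have "2 * (\<rho> * theta (\<rho> * f)) = theta \<Delta> * f + 2 * \<Delta> * theta f"
    by (simp add: theta_mult algebra_simps)
  then show ?thesis unfolding T'_def theta_numeral_mult[symmetric] by simp
qed

lemma T_rho: "T (\<rho> * f) = \<rho> * T' f"
  by (simp add: T_def T'_def algebra_simps)

lemma T_pow_rho: "(T ^^ l) (\<rho> * f) = \<rho> * (T' ^^ l) f"
  by (induction l) (auto simp: T_rho)

lemma T_add: "T (f + g) = T f + T g" and T'_add: "T' (f + g) = T' f + T' g"
  by (simp_all add: T_def T'_def algebra_simps)

lemma T_pow_add: "(T ^^ l) (f + g) = (T ^^ l) f + (T ^^ l) g"
  by (induction l) (auto simp: T_add)

lemma T'_pow_add: "(T' ^^ l) (f + g) = (T' ^^ l) f + (T' ^^ l) g"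
  by (induction l) (auto simp: T'_add)

lemma supp_ge_T:
  assumes "band B \<Delta>" "supp_ge m f"
  shows "supp_ge (m - B) (T f)" "supp_ge (m - B) (T' f)"
proof -
  have D: "supp_ge (- B) \<Delta>" "supp_ge (- B) (theta \<Delta>)"
    using assms(1) by (auto simp: band_def supp_ge_theta)
  have D2: "supp_ge (- B) (2 * \<Delta>)"
    using D(1) by (simp add: numeral_eq_lift_const supp_ge_lift_const_mult)
  show "supp_ge (m - B) (T f)"
    unfolding T_expand using supp_ge_mult[OF D2, of m] supp_ge_mult[OF D(2), of m] assms(2)
    by (auto intro!: supp_ge_add supp_ge_theta)
  show "supp_ge (m - B) (T' f)"
    unfolding T'_expand using supp_ge_mult[OF D2, of m] supp_ge_mult[OF D(2), of m] assms(2)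
    by (auto intro!: supp_ge_add supp_ge_theta)
qed

lemma supp_le_T:
  assumes "band B \<Delta>" "supp_le m f"
  shows "supp_le (m + B) (T f)" "supp_le (m + B) (T' f)"
proof -
  have D: "supp_le B \<Delta>" "supp_le B (theta \<Delta>)"
    using assms(1) by (auto simp: band_def supp_le_theta)
  have D2: "supp_le B (2 * \<Delta>)"
    using D(1) by (simp add: numeral_eq_lift_const supp_le_lift_const_mult)
  show "supp_le (m + B) (T f)"
    unfolding T_expand using supp_le_mult[OF D2, of m] supp_le_mult[OF D(2), of m] assms(2)
    by (auto intro!: supp_le_add supp_le_theta simp: add.commute)
  show "supp_le (m + B) (T' f)"
    unfolding T'_expand using supp_le_mult[OF D2, of m] supp_le_mult[OF D(2), of m] assms(2)
    by (auto intro!: supp_le_add supp_le_theta simp: add.commute)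
qed

lemma supp_ge_T_pow:
  assumes "band B \<Delta>" "supp_ge m f"
  shows "supp_ge (m - int l * B) ((T ^^ l) f)" "supp_ge (m - int l * B) ((T' ^^ l) f)"
proof -
  have "supp_ge (m - int l * B) ((T ^^ l) f) \<and> supp_ge (m - int l * B) ((T' ^^ l) f)"
  proof (induction l)
    case (Suc l)
    then show ?case
      using supp_ge_T(1)[OF assms(1), of "m - int l * B"] supp_ge_T(2)[OF assms(1), of "m - int l * B"]
      by (simp add: algebra_simps)
  qed (use assms in simp)
  then show "supp_ge (m - int l * B) ((T ^^ l) f)" "supp_ge (m - int l * B) ((T' ^^ l) f)" by auto
qed

lemma supp_le_T_pow:
  assumes "band B \<Delta>" "supp_le m f"
  shows "supp_le (m + int l * B) ((T ^^ l) f)" "supp_le (m + int l * B) ((T' ^^ l) f)"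
proof -
  have "supp_le (m + int l * B) ((T ^^ l) f) \<and> supp_le (m + int l * B) ((T' ^^ l) f)"
  proof (induction l)
    case (Suc l)
    then show ?case
      using supp_le_T(1)[OF assms(1), of "m + int l * B"] supp_le_T(2)[OF assms(1), of "m + int l * B"]
      by (simp add: algebra_simps)
  qed (use assms in simp)
  then show "supp_le (m + int l * B) ((T ^^ l) f)" "supp_le (m + int l * B) ((T' ^^ l) f)" by auto
qed

lemma dfin_of_T_rel:
  assumes "\<And>l. p l \<in> Lpoly" "(\<Sum>l\<le>r. p l * (T ^^ l) f) = 0" "\<exists>l\<le>r. p l \<noteq> 0"
  shows "dfin f"
proof -
  define s where "s = Max {i. i \<le> r \<and> p i \<noteq> 0}"
  have fin: "finite {i. i \<le> r \<and> p i \<noteq> 0}" by simp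
  have s: "s \<le> r" "p s \<noteq> 0"
    using Max_in[OF fin] assms(3) by (auto simp: s_def)
  have "p i = 0" if "s < i" "i \<le> r" for i
    using Max_ge[OF fin, of i] that unfolding s_def by fastforce
  then have "(\<Sum>i\<le>r. p i * (T ^^ i) f) = (\<Sum>i\<le>s. p i * (T ^^ i) f)"
    using s(1) by (intro sum.mono_neutral_right) auto
  then have top: "p s * (T ^^ s) f = - (\<Sum>i<s. p i * (T ^^ i) f)"
    using assms(2) by (simp add: lessThan_Suc_atMost[symmetric] add_eq_0_iff)
  define G where "G = (\<lambda>i. (T ^^ i) f) ` {..<s} \<union> (\<lambda>i. theta ((T ^^ i) f)) ` {..<s}"
  have G: "(T ^^ i) f \<in> lspan G" "theta ((T ^^ i) f) \<in> lspan G" if "i < s" for i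
    using that by (auto simp: G_def intro!: lspan_base)
  have step: "p s * (T ^^ Suc i) f \<in> lspan G" if "i < s" for i
  proof (cases "Suc i = s")
    case True
    have "- (\<Sum>i<s. p i * (T ^^ i) f) \<in> lspan G"
      using assms(1) G by (intro lspan_minus lspan_sum lspan_scale) auto
    then show ?thesis using top True by auto
  next
    case False
    then show ?thesis using G(1)[of "Suc i"] that assms(1) by auto
  qed
  have pD: "2 * \<Delta> * p s \<in> Lpoly"
    by (rule Lpoly_mult[OF Lpoly_mult[OF Lpoly_numeral rho_square] assms(1)])
  then have *: "2 * \<Delta> * p s * g \<in> lspan G" if "g \<in> lspan G" for g
    using that by (rule lspan_scale)
  have "2 * \<Delta> * p s * theta (theta ((T ^^ i) f)) \<in> lspan G" if "i < s" for i
  proof -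
    have "2 * \<Delta> * p s * theta (theta ((T ^^ i) f))
        = p s * (T ^^ Suc i) f - (p s * theta \<Delta>) * theta ((T ^^ i) f)"
      by (simp add: T_expand[of "(T ^^ i) f"] algebra_simps)
    also have "\<dots> \<in> lspan G"
      by (rule lspan_diff[OF step[OF that]
            lspan_scale[OF Lpoly_mult[OF assms(1) Lpoly_theta[OF rho_square]] G(2)[OF that]]])
    finally show ?thesis .
  qed
  then have "theta_stable (2 * \<Delta> * p s) G"
    using s(2) rho_nonzero pD * G by (auto simp: theta_stable_def G_def)
  moreover have "f \<in> lspan G"
  proof (cases "s = 0")
    case True
    then show ?thesis using top s(2) by (simp add: G_def)
  qed (use G(1)[of 0] in auto)
  ultimately show ?thesis by (auto simp: dfin_def)
qed

lemma rho_mult_nth: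
  assumes "\<And>k. k < n \<Longrightarrow> F $ k = 0"
  shows "(\<rho> * F) $ n = F $ n"
proof -
  have "(\<rho> * F) $ n = (\<Sum>i\<in>{0}. \<rho> $ i * F $ (n - i))"
    unfolding fps_mult_nth by (rule sum.mono_neutral_right) (auto simp: assms)
  then show ?thesis by (simp add: rho_nth_0)
qed

text \<open>The coefficient of \<open>t^n\<close> sees only the constant term 1 of \<open>\<rho>\<close>, and at a given power of
  \<open>x\<close> only every other member of the chain can be nonzero.\<close>

lemma chain_unique:
  assumes m: "m \<ge> 1" and ends: "\<alpha> 0 = 0" "\<alpha> m = 0"
    and eq: "\<And>i. i < m \<Longrightarrow> D (Suc i) - D i = \<rho> * (\<alpha> i + \<alpha> (Suc i))"
    and supp: "\<And>i. i \<le> m \<Longrightarrow> one_sided (even i = par) 1 (\<alpha> i)"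
      "\<And>i. i \<le> m \<Longrightarrow> one_sided (even i = par) 1 (D i)"
    and i: "i \<le> m"
  shows "\<alpha> i = 0 \<and> D i = 0"
proof -
  have "\<forall>i\<le>m. \<alpha> i $ n = 0 \<and> D i $ n = 0" for n
  proof (induction n rule: less_induct)
    case (less n)
    have e: "D (Suc i) $ n $$ a - D i $ n $$ a = \<alpha> i $ n $$ a + \<alpha> (Suc i) $ n $$ a" if "i < m" for i a
    proof -
      have "(D (Suc i) - D i) $ n = (\<alpha> i + \<alpha> (Suc i)) $ n"
        unfolding eq[OF that] using less that by (intro rho_mult_nth) auto
      then show ?thesis
        by (metis fls_minus_nth fls_plus_nth fps_add_nth fps_sub_nth)
    qed
    have z: "\<alpha> i $ n $$ a = 0" "D i $ n $$ a = 0"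
      if "i \<le> m" "\<not> (if even i = par then a > 0 else a < 0)" for i a
      using supp[of i] that by (auto simp: one_sided_def supp_ge_def supp_le_def split: if_splits)
    have "\<alpha> i $ n $$ a = 0 \<and> D i $ n $$ a = 0" if "i \<le> m" for i a
    proof (cases "if even i = par then a > 0 else a < 0")
      case True
      have 1: "- D i $ n $$ a = \<alpha> i $ n $$ a" if "i < m"
        using e[OF that, of a] z[of "Suc i" a] that True by (auto split: if_splits)
      have 2: "D i $ n $$ a = \<alpha> i $ n $$ a" if "i > 0"
        using e[of "i - 1" a] z[of "i - 1" a] that \<open>i \<le> m\<close> True by (auto split: if_splits)
      show ?thesis
      proof (cases "0 < i \<and> i < m")
        case True
        then have "D i $ n $$ a = - D i $ n $$ a" using 1 2 by simp
        then show ?thesis using True 2 by (simp add: eq_neg_iff_add_eq_0 flip: mult_2)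
      next
        case False
        then have "i = 0 \<or> i = m" using \<open>i \<le> m\<close> by auto
        then show ?thesis using 1 2 m ends by auto
      qed
    qed (use z that in blast)
    then show ?case by (simp add: fls_eq_iff)
  qed
  then show ?thesis using i by (simp add: fps_eq_iff)
qed

text \<open>The family \<open>x^k T^l\<close> with \<open>k \<le> d\<close> and \<open>l \<le> r\<close> has \<open>(d + 1) (r + 1)\<close> members, whereas the
  coefficients to be killed number \<open>8 (m + 1) d + O(1)\<close>, so that \<open>r = 8 (m + 1)\<close> and a large \<open>d\<close>
  suffice.\<close>

lemma chain_dfin_polynomial:
  fixes \<alpha> D a b :: "nat \<Rightarrow> 'c fls fps"
  assumes m: "m \<ge> 1" and ends: "\<alpha> 0 = 0" "\<alpha> m = 0"
    and eq: "\<And>i. i < m \<Longrightarrow> D (Suc i) - D i = \<rho> * (\<alpha> i + \<alpha> (Suc i)) + (a i + \<rho> * b i)"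
    and bnd: "B \<ge> 0" "band B \<Delta>" "\<And>i. i \<le> m \<Longrightarrow> band B (a i)" "\<And>i. i \<le> m \<Longrightarrow> band B (b i)"
    and supp: "\<And>i. i \<le> m \<Longrightarrow> one_sided (even i = par) (- B) (\<alpha> i)"
      "\<And>i. i \<le> m \<Longrightarrow> one_sided (even i = par) (- B) (D i)"
    and i: "i \<le> m"
  shows "dfin (\<alpha> i) \<and> dfin (D i)"
proof -
  define r where "r = 8 * (m + 1)"
  define bn where "bn = nat B"
  define d where "d = 4 * (m + 1) * (2 * bn * (r + 1) + 1)"
  define N where "N = int (bn * (r + 1) + d)"
  have N0: "N \<ge> 0" by (simp add: N_def)
  have N: "B + int l * B + int k \<le> N" if "k \<le> d" "l \<le> r" for k l
  proof -
    have "int l * B \<le> int r * B" using that bnd(1) by (intro mult_right_mono) auto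
    then show ?thesis using that bnd(1) by (simp add: N_def bn_def algebra_simps)
  qed
  define I where "I = {..d} \<times> {..r}"
  define J where "J = {..m} \<times> {..<4::nat} \<times> {-N..N}"
  define Z where "Z i q l = (if q = 0 then (T ^^ l) (D i) else if q = 1 then (T' ^^ l) (\<alpha> i)
      else if q = 2 then (T ^^ l) (a i) else (T' ^^ l) (b i))" for i l and q :: nat
  define v where "v = (\<lambda>(k, l) (i, q, x). xcoeff (xpow (int k) * Z i q l) x)"
  have "card J < card I"
  proof -
    have "card J = 4 * (m + 1) * (2 * (bn * (r + 1) + d) + 1)"
    proof -
      have "card {- int n..int n} = 2 * n + 1" for n
        by (simp add: nat_eq_iff)
      then have "card {-N..N} = 2 * (bn * (r + 1) + d) + 1"
        unfolding N_def .
      then show ?thesis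
        by (simp only: J_def card_cartesian_product card_atMost card_lessThan Suc_eq_plus1 mult_ac)
    qed
    also have "\<dots> < (d + 1) * (r + 1)"
      unfolding d_def r_def by (simp add: algebra_simps)
    finally show ?thesis by (simp add: I_def)
  qed
  then have "\<exists>c. (\<forall>i. c i \<in> UNIV) \<and> (\<exists>i\<in>I. c i \<noteq> 0) \<and> (\<forall>j\<in>J. (\<Sum>i\<in>I. c i * v i j) = 0)"
    by (intro exists_linear_dependence) (auto simp: I_def J_def)
  then obtain c where c: "\<exists>i\<in>I. c i \<noteq> 0" "\<And>j. j \<in> J \<Longrightarrow> (\<Sum>i\<in>I. c i * v i j) = 0" by blast
  define L where "L f = (\<Sum>(k,l)\<in>I. lift_const (c (k, l)) * (xpow (int k) * (T ^^ l) f))" for f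
  define L' where "L' f = (\<Sum>(k,l)\<in>I. lift_const (c (k, l)) * (xpow (int k) * (T' ^^ l) f))" for f
  have L_add: "L (f + g) = L f + L g" for f g
    unfolding L_def sum.distrib[symmetric]
    by (intro sum.cong) (auto simp: T_pow_add algebra_simps)
  have L'_add: "L' (f + g) = L' f + L' g" for f g
    unfolding L'_def sum.distrib[symmetric]
    by (intro sum.cong) (auto simp: T'_pow_add algebra_simps)
  have L_rho: "L (\<rho> * f) = \<rho> * L' f" for f
    unfolding L_def L'_def sum_distrib_left by (intro sum.cong) (auto simp: T_pow_rho algebra_simps)
  have van: "xcoeff (L (D i)) x = 0 \<and> xcoeff (L' (\<alpha> i)) x = 0 \<and> xcoeff (L (a i)) x = 0
      \<and> xcoeff (L' (b i)) x = 0" if "i \<le> m" "\<bar>x\<bar> \<le> N" for i x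
    using that c(2)[of "(i, 0, x)"] c(2)[of "(i, 1, x)"] c(2)[of "(i, 2, x)"] c(2)[of "(i, 3, x)"]
    by (auto simp: L_def L'_def J_def v_def Z_def case_prod_unfold abs_le_iff)
  have ge: "supp_ge (- N) (L f) \<and> supp_ge (- N) (L' f)" if "supp_ge (- B) f" for f
  proof -
    have "supp_ge (- N) (xpow (int k) * (T ^^ l) f)" "supp_ge (- N) (xpow (int k) * (T' ^^ l) f)"
      if "k \<le> d" "l \<le> r" for k l
      using supp_ge_T_pow[OF bnd(2) \<open>supp_ge (- B) f\<close>, of l] N[OF that]
      by (auto intro: supp_ge_mono[OF supp_ge_xpow_mult])
    then show ?thesis
      unfolding L_def L'_def I_def by (auto intro!: supp_ge_sum supp_ge_lift_const_mult)
  qed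
  have le: "supp_le N (L f) \<and> supp_le N (L' f)" if "supp_le B f" for f
  proof -
    have "supp_le N (xpow (int k) * (T ^^ l) f)" "supp_le N (xpow (int k) * (T' ^^ l) f)"
      if "k \<le> d" "l \<le> r" for k l
      using supp_le_T_pow[OF bnd(2) \<open>supp_le B f\<close>, of l] N[OF that]
      by (auto intro: supp_le_mono[OF supp_le_xpow_mult])
    then show ?thesis
      unfolding L_def L'_def I_def by (auto intro!: supp_le_sum supp_le_lift_const_mult)
  qed
  have zero: "F = 0" if "band N F" "\<And>x. \<bar>x\<bar> \<le> N \<Longrightarrow> xcoeff F x = 0" for F
  proof -
    have "(\<Sum>k\<in>{-N..N}. lift_const (xcoeff F k) * xpow k) = 0"
      by (rule sum.neutral) (auto simp: that(2))
    then show ?thesis using band_expansion[OF that(1)] by argo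
  qed
  have ab0: "L (a i) = 0" "L' (b i) = 0" if "i \<le> m" for i
    using bnd(3,4)[OF that] van[OF that] ge le by (auto simp: band_def intro!: zero)
  have strict: "one_sided pos 1 F"
    if "one_sided pos (- N) F" "\<And>x. \<bar>x\<bar> \<le> N \<Longrightarrow> xcoeff F x = 0" for F pos
  proof -
    have 1: "F $ n $$ x = 0" if "\<bar>x\<bar> \<le> N" for n x
      using \<open>\<And>x. \<bar>x\<bar> \<le> N \<Longrightarrow> xcoeff F x = 0\<close>[OF that] by (metis xcoeff_nth fps_zero_nth)
    have "F $ n $$ x = 0" if "if pos then x < 1 else - 1 < x" for n x
      using 1[of x n] that \<open>one_sided pos (- N) F\<close>
      by (cases "\<bar>x\<bar> \<le> N") (auto simp: one_sided_def supp_ge_def supp_le_def split: if_splits)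
    then show ?thesis
      by (auto simp: one_sided_def supp_ge_def supp_le_def)
  qed
  have os: "one_sided pos (- N) (L f) \<and> one_sided pos (- N) (L' f)" if "one_sided pos (- B) f" for f pos
    using that ge le by (auto simp: one_sided_def)
  have key: "L' (\<alpha> i) = 0 \<and> L (D i) = 0" if "i \<le> m" for i
  proof (rule chain_unique[where m = m and par = par])
    show "L (D (Suc i)) - L (D i) = \<rho> * (L' (\<alpha> i) + L' (\<alpha> (Suc i)))" if "i < m" for i
    proof -
      have "D (Suc i) = D i + (\<rho> * (\<alpha> i + \<alpha> (Suc i) + b i) + a i)"
        using eq[OF that] by (simp add: algebra_simps)
      then have "L (D (Suc i)) = L (D i) + (\<rho> * (L' (\<alpha> i) + L' (\<alpha> (Suc i)) + L' (b i)) + L (a i))"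
        by (simp only: L_add L'_add L_rho)
      then show ?thesis using ab0[of i] that by simp
    qed
    show "L' (\<alpha> 0) = 0" "L' (\<alpha> m) = 0"
      using L'_add[of 0 0] by (simp_all add: ends)
  qed (use m that supp van os in \<open>auto intro!: strict\<close>)
  define p where "p l = (\<Sum>k\<le>d. lift_const (c (k, l)) * xpow (int k))" for l
  have pL: "p l \<in> Lpoly" for l by (auto simp: p_def)
  have Lp: "L f = (\<Sum>l\<le>r. p l * (T ^^ l) f)" for f
    unfolding L_def p_def I_def sum.cartesian_product[symmetric] sum_distrib_right
    by (subst sum.swap) (simp add: mult.assoc)
  have "xcoeff (p l) (int k) = c (k, l)" if "k \<le> d" for k l
    using that by (simp add: p_def xcoeff_xpow if_distrib[of "\<lambda>x. _ * x"] sum.delta cong: if_cong)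
  then have "\<exists>l\<le>r. p l \<noteq> 0"
    using c(1) unfolding I_def by (metis SigmaE atMost_iff xcoeff_0)
  then have *: "dfin f" if "L f = 0" for f
    using dfin_of_T_rel[where p = p and r = r and f = f] pL that by (simp add: Lp)
  have "dfin (\<rho> * \<alpha> i)"
    using key[OF i] by (intro *) (simp add: L_rho)
  from dfin_mult[OF dfin_rho this] have "dfin (\<Delta> * \<alpha> i)"
    by (simp only: mult.assoc)
  then have "dfin (\<alpha> i)"
    by (rule dfin_cancel[OF _ rho_square]) (simp add: rho_nonzero)
  then show ?thesis using * key[OF i] by blast
qed

theorem chain_dfin:
  fixes \<alpha> D s :: "nat \<Rightarrow> 'c fls fps"
  assumes m: "m \<ge> 1" and ends: "\<alpha> 0 = 0" "\<alpha> m = 0"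
    and eq: "\<And>i. i < m \<Longrightarrow> D (Suc i) - D i = \<rho> * (\<alpha> i + \<alpha> (Suc i)) + s i"
    and s: "\<And>i. i < m \<Longrightarrow> alg (s i)"
    and supp: "\<And>i. i \<le> m \<Longrightarrow> one_sided (even i = par) 1 (\<alpha> i)"
      "\<And>i. i \<le> m \<Longrightarrow> one_sided (even i = par) 1 (D i)"
    and i: "i \<le> m"
  shows "dfin (\<alpha> i) \<and> dfin (D i)"
proof -
  have "\<exists>p. p \<in> Lpoly \<and> p \<noteq> 0 \<and> (\<forall>i<k. \<exists>a\<in>Lpoly. \<exists>b\<in>Lpoly. p * s i = a + \<rho> * b)" if "k \<le> m" for k
    using that
  proof (induction k)
    case 0
    show ?case by (intro exI[of _ 1]) auto
  next
    case (Suc k)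
    then obtain p where p: "p \<in> Lpoly" "p \<noteq> 0"
      "\<And>i. i < k \<Longrightarrow> \<exists>a\<in>Lpoly. \<exists>b\<in>Lpoly. p * s i = a + \<rho> * b" by auto
    obtain q c e where q: "q \<in> Lpoly" "q \<noteq> 0" "c \<in> Lpoly" "e \<in> Lpoly" "q * s k = c + \<rho> * e"
      using s[of k] Suc.prems by (auto simp: alg_def)
    have mul: "\<exists>a\<in>Lpoly. \<exists>b\<in>Lpoly. g * f = a + \<rho> * b"
      if g: "g \<in> Lpoly" and f: "\<exists>a\<in>Lpoly. \<exists>b\<in>Lpoly. f = a + \<rho> * b" for f g
    proof -
      obtain a b where ab: "a \<in> Lpoly" "b \<in> Lpoly" "f = a + \<rho> * b" using f by blast
      then have "g * f = g * a + \<rho> * (g * b)" by (simp add: algebra_simps)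
      then show ?thesis using Lpoly_mult[OF g] ab(1,2) by blast
    qed
    have "\<exists>a\<in>Lpoly. \<exists>b\<in>Lpoly. p * q * s i = a + \<rho> * b" if "i < Suc k" for i
    proof (cases "i = k")
      case True
      then show ?thesis using mul[OF p(1), of "q * s k"] q by (auto simp: mult.assoc)
    next
      case False
      then show ?thesis using mul[OF q(1) p(3)[of i]] that by (auto simp: mult_ac)
    qed
    then show ?case using p(1,2) q(1,2) by (intro exI[of _ "p * q"]) auto
  qed
  from this[of m] obtain p where p: "p \<in> Lpoly" "p \<noteq> 0"
    "\<And>i. i < m \<Longrightarrow> \<exists>a\<in>Lpoly. \<exists>b\<in>Lpoly. p * s i = a + \<rho> * b" by auto
  define good where "good i x \<longleftrightarrow> fst x \<in> Lpoly \<and> snd x \<in> Lpoly \<and> p * s i = fst x + \<rho> * snd x" for i x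
  have "\<exists>x. good i x" if "i < m" for i
    using p(3)[OF that] unfolding good_def by auto
  then obtain ab where ab: "\<And>i. i < m \<Longrightarrow> good i (ab i)" by metis
  define a0 b0 where "a0 i = fst (ab i)" and "b0 i = snd (ab i)" for i
  have ab0: "a0 i \<in> Lpoly \<and> b0 i \<in> Lpoly \<and> p * s i = a0 i + \<rho> * b0 i" if "i < m" for i
    using ab[OF that] by (simp add: good_def a0_def b0_def)
  define a b where "a i = (if i < m then a0 i else 0)" and "b i = (if i < m then b0 i else 0)" for i
  have abL: "a i \<in> Lpoly" "b i \<in> Lpoly" for i using ab0 by (auto simp: a_def b_def)
  obtain B1 where B1: "B1 \<ge> 0" "\<forall>i\<in>{..m}. band B1 (a i)" using Lpoly_bands[of "{..m}" a] abL by auto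
  obtain B2 where B2: "B2 \<ge> 0" "\<forall>i\<in>{..m}. band B2 (b i)" using Lpoly_bands[of "{..m}" b] abL by auto
  obtain B3 where B3: "band B3 \<Delta>" using rho_square by (auto simp: Lpoly_def)
  obtain B4 where B4: "band B4 p" using p(1) by (auto simp: Lpoly_def)
  define B where "B = max (max B1 B2) (max B3 B4)"
  have B: "B \<ge> 0" "band B \<Delta>" "band B p" "\<And>i. i \<le> m \<Longrightarrow> band B (a i)" "\<And>i. i \<le> m \<Longrightarrow> band B (b i)"
    using B1 B2 B3 B4 by (auto simp: B_def intro: band_mono)
  have os: "one_sided pos (- B) (p * F)" if "one_sided pos 1 F" for pos F
    using that B(3) supp_ge_mult[of "- B" p 1 F] supp_le_mult[of B p "- 1" F]
    by (auto simp: one_sided_def band_def intro: supp_ge_mono supp_le_mono)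
  have "dfin (p * \<alpha> i) \<and> dfin (p * D i)"
  proof (rule chain_dfin_polynomial[where m = m and B = B and par = par and a = a and b = b])
    show "p * D (Suc i) - p * D i = \<rho> * (p * \<alpha> i + p * \<alpha> (Suc i)) + (a i + \<rho> * b i)" if "i < m" for i
    proof -
      have "p * D (Suc i) - p * D i = p * (D (Suc i) - D i)" by (simp add: algebra_simps)
      also have "\<dots> = \<rho> * (p * \<alpha> i + p * \<alpha> (Suc i)) + p * s i"
        unfolding eq[OF that] by (simp add: algebra_simps)
      finally show ?thesis using ab0[OF that] that by (simp add: a_def b_def)
    qed
  qed (use m ends B supp i os in auto)
  then show ?thesis using dfin_cancel p by blast
qed

end


section \<open>Coefficients of powers of an algebraic series\<close>

lemma lift_const_minus: "lift_const (- c) = - lift_const c"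
  by (rule fls_fps_eqI) simp

lemma dfin_of_recurrence:
  fixes Y :: "'c::field_char_0 fls fps" and pol :: "nat \<Rightarrow> 'c fps poly"
  assumes "j \<le> N" "pol j \<noteq> 0"
    and "\<And>b. (\<Sum>k\<le>N. poly (pol k) (of_int b) * xcoeff Y (b + int k)) = 0"
  shows "dfin Y"
proof -
  define pol' where "pol' k = pcompose (pol k) [:- of_nat k, 1:]" for k
  define R where "R = Max ((\<lambda>k. degree (pol' k)) ` {..N})"
  have R: "degree (pol' k) \<le> R" if "k \<le> N" for k
    unfolding R_def using that by (intro Max_ge) auto
  define P where "P i = (\<Sum>k\<le>N. lift_const (coeff (pol' k) i) * xpow (- int k))" for i
  have PL: "P i \<in> Lpoly" for i by (auto simp: P_def)
  have "xcoeff (\<Sum>i\<le>R. P i * (theta ^^ i) Y) b = 0" for b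
  proof -
    have "xcoeff (\<Sum>i\<le>R. P i * (theta ^^ i) Y) b
        = (\<Sum>i\<le>R. \<Sum>k\<le>N. coeff (pol' k) i * (of_int (b + int k) ^ i * xcoeff Y (b + int k)))"
      by (simp add: P_def sum_distrib_right mult.assoc)
    also have "\<dots> = (\<Sum>k\<le>N. (\<Sum>i\<le>R. coeff (pol' k) i * of_int (b + int k) ^ i) * xcoeff Y (b + int k))"
      by (subst sum.swap) (simp add: sum_distrib_right mult.assoc)
    also have "\<dots> = (\<Sum>k\<le>N. poly (pol k) (of_int b) * xcoeff Y (b + int k))"
    proof (intro sum.cong refl)
      fix k assume "k \<in> {..N}"
      then have "(\<Sum>i\<le>R. coeff (pol' k) i * of_int (b + int k) ^ i) = poly (pol' k) (of_int (b + int k))"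
        unfolding poly_altdef using R[of k] by (intro sum.mono_neutral_right) (auto simp: coeff_eq_0)
      also have "\<dots> = poly (pol k) (of_int b)"
        by (simp add: pol'_def poly_pcompose)
      finally show "(\<Sum>i\<le>R. coeff (pol' k) i * of_int (b + int k) ^ i) * xcoeff Y (b + int k)
          = poly (pol k) (of_int b) * xcoeff Y (b + int k)" by simp
    qed
    finally show ?thesis using assms(3) by simp
  qed
  then have rel: "theta_rel R P Y"
    unfolding theta_rel_def using PL by (auto intro!: xcoeff_eqI simp del: xcoeff_sum)
  have "pol' j \<noteq> 0"
    using assms(2) by (auto simp: pol'_def pcompose_eq_0_iff)
  then have "lead_coeff (pol' j) \<noteq> 0" by simp
  moreover have "xcoeff (P i) (- int j) = coeff (pol' j) i" for i
    using assms(1) by (simp add: P_def xcoeff_xpow if_distrib[of "\<lambda>x. _ * x"] sum.delta cong: if_cong)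
  ultimately have "P (degree (pol' j)) \<noteq> 0" by (metis xcoeff_0)
  then show ?thesis
    using dfin_of_theta_rel(2)[OF rel] R[OF assms(1)] by blast
qed

definition bspan :: "'c::field_char_0 fls fps set \<Rightarrow> int \<Rightarrow> 'c fls fps \<Rightarrow> bool" where
  "bspan G B x \<longleftrightarrow> (\<exists>m. (\<forall>g. band B (m g)) \<and> x = (\<Sum>g\<in>G. m g * g))"

lemma bspan_0 [simp]: "bspan G B 0"
  unfolding bspan_def by (intro exI[of _ "\<lambda>_. 0"]) simp

lemma bspan_mono: "bspan G B x \<Longrightarrow> B \<le> C \<Longrightarrow> bspan G C x"
  unfolding bspan_def by (elim exE conjE, rule exI, rule conjI) (auto intro: band_mono)

lemma bspan_add: "bspan G B x \<Longrightarrow> bspan G B y \<Longrightarrow> bspan G B (x + y)"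
  unfolding bspan_def
  by (elim exE conjE, rule_tac x = "\<lambda>g. m g + ma g" in exI)
    (auto simp: sum.distrib distrib_right intro: band_add)

lemma bspan_mult:
  assumes "band C p" "bspan G B x"
  shows "bspan G (B + C) (p * x)"
proof -
  obtain m where m: "\<And>g. band B (m g)" "x = (\<Sum>g\<in>G. m g * g)" using assms(2) by (auto simp: bspan_def)
  have "p * x = (\<Sum>g\<in>G. (p * m g) * g)" unfolding m(2) by (simp add: sum_distrib_left mult.assoc)
  then show ?thesis
    unfolding bspan_def using band_mult[OF assms(1) m(1)]
    by (intro exI[of _ "\<lambda>g. p * m g"]) (auto simp: add.commute)
qed

lemma bspan_sum: "(\<And>i. i \<in> I \<Longrightarrow> bspan G B (f i)) \<Longrightarrow> bspan G B (sum f I)"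
  by (induction I rule: infinite_finite_induct) (auto intro: bspan_add)

lemma bspan_bind:
  assumes "\<And>g. g \<in> G \<Longrightarrow> bspan G B0 (f g)" "\<And>g. band B (m g)"
  shows "bspan G (B + B0) (\<Sum>g\<in>G. m g * f g)"
  using bspan_mult[OF assms(2) assms(1)] by (intro bspan_sum) (auto simp: add.commute)

lemma lspan_imp_bspan:
  assumes "finite G" "x \<in> lspan G"
  shows "\<exists>B\<ge>0. bspan G B x"
proof -
  obtain m where m: "\<forall>g. m g \<in> Lpoly" "x = (\<Sum>g\<in>G. m g * g)"
    using lspan_finite_repr[OF assms] by blast
  define m' where "m' g = (if g \<in> G then m g else 0)" for g
  obtain B where B: "B \<ge> 0" "\<forall>g\<in>G. band B (m g)" using Lpoly_bands[OF assms(1), of m] m(1) by auto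
  then have "\<forall>g. band B (m' g)" "x = (\<Sum>g\<in>G. m' g * g)" by (auto simp: m'_def m(2))
  then show ?thesis using B(1) unfolding bspan_def by blast
qed

lemma lspan_imp_bspan_family:
  assumes "finite G" "finite X" "\<And>x. x \<in> X \<Longrightarrow> f x \<in> lspan G"
  shows "\<exists>B\<ge>0. \<forall>x\<in>X. bspan G B (f x)"
  using assms(2,3)
proof (induction X rule: finite_induct)
  case (insert x X)
  then obtain B where B: "B \<ge> 0" "\<forall>x\<in>X. bspan G B (f x)" by auto
  obtain C where C: "C \<ge> 0" "bspan G C (f x)" using lspan_imp_bspan[OF assms(1)] insert.prems by blast
  show ?case using B C by (intro exI[of _ "max B C"]) (auto intro: bspan_mono)
qed auto

locale power_family =
  fixes G :: "'c::field_char_0 fls fps set" and q \<kappa> \<mu> F :: "'c fls fps" and B0 :: int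
  assumes fin_G: "finite G" and q_nonzero: "q \<noteq> 0" and B0: "B0 \<ge> 0"
    and band_q: "band B0 q"
    and theta_G: "\<And>g. g \<in> G \<Longrightarrow> bspan G B0 (q * theta g)"
    and mu_G: "\<And>g. g \<in> G \<Longrightarrow> bspan G B0 (q * \<mu> * g)"
    and kappa_G: "\<And>g. g \<in> G \<Longrightarrow> bspan G B0 (\<kappa> * g)"
    and theta_mu: "q * theta \<mu> = \<mu> * \<kappa>"
    and F: "bspan G B0 F"
begin

lemma bspan_kappa: "bspan G B x \<Longrightarrow> bspan G (B + B0) (\<kappa> * x)"
proof -
  assume "bspan G B x"
  then obtain m where m: "\<And>g. band B (m g)" "x = (\<Sum>g\<in>G. m g * g)" by (auto simp: bspan_def)
  have "\<kappa> * x = (\<Sum>g\<in>G. m g * (\<kappa> * g))"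
    unfolding m(2) by (simp add: sum_distrib_left mult.left_commute)
  then show ?thesis using bspan_bind[OF kappa_G m(1)] by simp
qed

lemma bspan_mu: "bspan G B x \<Longrightarrow> bspan G (B + B0) (q * \<mu> * x)"
proof -
  assume "bspan G B x"
  then obtain m where m: "\<And>g. band B (m g)" "x = (\<Sum>g\<in>G. m g * g)" by (auto simp: bspan_def)
  have "q * \<mu> * x = (\<Sum>g\<in>G. m g * (q * \<mu> * g))"
    unfolding m(2) by (simp add: sum_distrib_left mult.left_commute)
  then show ?thesis using bspan_bind[OF mu_G m(1)] by simp
qed

lemma bspan_theta: "bspan G B x \<Longrightarrow> bspan G (B + B0) (q * theta x)"
proof -
  assume "bspan G B x"
  then obtain m where m: "\<And>g. band B (m g)" "x = (\<Sum>g\<in>G. m g * g)" by (auto simp: bspan_def)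
  have 1: "q * theta x = q * (\<Sum>g\<in>G. theta (m g) * g) + (\<Sum>g\<in>G. m g * (q * theta g))"
    unfolding m(2) by (simp add: theta_mult sum_distrib_left sum.distrib algebra_simps)
  have "bspan G B (\<Sum>g\<in>G. theta (m g) * g)"
    unfolding bspan_def using band_theta[OF m(1)] by (intro exI[of _ "\<lambda>g. theta (m g)"]) auto
  from bspan_mult[OF band_q this] show ?thesis
    unfolding 1 using bspan_bind[OF theta_G m(1)] by (auto intro: bspan_add)
qed

definition fam :: "nat \<Rightarrow> int \<Rightarrow> (nat \<Rightarrow> 'c fls fps) \<Rightarrow> bool" where
  "fam j B \<Phi> \<longleftrightarrow> (\<exists>y. (\<forall>i. bspan G B (y i)) \<and>
     (\<forall>b. \<Phi> b = \<mu> ^ b * (\<Sum>i\<le>j. of_nat b ^ i * y i)))"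

lemma fam_mono:
  assumes "fam j B \<Phi>" "j \<le> k" "B \<le> C"
  shows "fam k C \<Phi>"
proof -
  obtain y where y: "\<And>i. bspan G B (y i)" "\<And>b. \<Phi> b = \<mu> ^ b * (\<Sum>i\<le>j. of_nat b ^ i * y i)"
    using assms(1) by (auto simp: fam_def)
  define y' where "y' i = (if i \<le> j then y i else 0)" for i
  have "(\<Sum>i\<le>j. of_nat b ^ i * y i) = (\<Sum>i\<le>k. of_nat b ^ i * y' i)" for b :: nat
    using assms(2) by (intro sum.mono_neutral_cong_left) (auto simp: y'_def)
  moreover have "\<forall>i. bspan G C (y' i)"
    using y(1) assms(3) by (auto simp: y'_def intro: bspan_mono)
  ultimately show ?thesis unfolding fam_def y(2) by (intro exI[of _ y']) auto
qed

lemma fam_add: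
  assumes "fam j B \<Phi>" "fam j B \<Psi>"
  shows "fam j B (\<lambda>b. \<Phi> b + \<Psi> b)"
proof -
  obtain y where y: "\<And>i. bspan G B (y i)" "\<And>b. \<Phi> b = \<mu> ^ b * (\<Sum>i\<le>j. of_nat b ^ i * y i)"
    using assms(1) by (auto simp: fam_def)
  obtain z where z: "\<And>i. bspan G B (z i)" "\<And>b. \<Psi> b = \<mu> ^ b * (\<Sum>i\<le>j. of_nat b ^ i * z i)"
    using assms(2) by (auto simp: fam_def)
  show ?thesis unfolding fam_def y(2) z(2) using bspan_add[OF y(1) z(1)]
    by (intro exI[of _ "\<lambda>i. y i + z i"]) (auto simp: algebra_simps sum.distrib)
qed

lemma fam_mult:
  assumes "fam j B \<Phi>" "band C p"
  shows "fam j (B + C) (\<lambda>b. p * \<Phi> b)"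
proof -
  obtain y where y: "\<And>i. bspan G B (y i)" "\<And>b. \<Phi> b = \<mu> ^ b * (\<Sum>i\<le>j. of_nat b ^ i * y i)"
    using assms(1) by (auto simp: fam_def)
  show ?thesis unfolding fam_def y(2) using bspan_mult[OF assms(2) y(1)]
    by (intro exI[of _ "\<lambda>i. p * y i"]) (auto simp: sum_distrib_left algebra_simps)
qed

lemma fam_of_nat_mult:
  assumes "fam j B \<Phi>"
  shows "fam (Suc j) B (\<lambda>b. of_nat b * \<Phi> b)"
proof -
  obtain y where y: "\<And>i. bspan G B (y i)" "\<And>b. \<Phi> b = \<mu> ^ b * (\<Sum>i\<le>j. of_nat b ^ i * y i)"
    using assms(1) by (auto simp: fam_def)
  have "of_nat b * \<Phi> b = \<mu> ^ b * (\<Sum>i\<le>Suc j. of_nat b ^ i * (if i = 0 then 0 else y (i - 1)))" for b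
    unfolding y(2) sum.atMost_Suc_shift by (simp add: sum_distrib_left algebra_simps)
  then show ?thesis unfolding fam_def using y(1)
    by (intro exI[of _ "\<lambda>i. if i = 0 then 0 else y (i - 1)"]) auto
qed

lemma fam_of_nat_power_mult: "fam j B \<Phi> \<Longrightarrow> fam (j + l) B (\<lambda>b. of_nat b ^ l * \<Phi> b)"
proof (induction l)
  case (Suc l)
  then show ?case using fam_of_nat_mult[of "j + l" B "\<lambda>b. of_nat b ^ l * \<Phi> b"]
    by (simp add: mult.assoc)
qed simp

lemma fam_theta:
  assumes "fam j B \<Phi>"
  shows "fam (Suc j) (B + B0) (\<lambda>b. q * theta (\<Phi> b))"
proof -
  obtain y where y: "\<And>i. bspan G B (y i)" "\<And>b. \<Phi> b = \<mu> ^ b * (\<Sum>i\<le>j. of_nat b ^ i * y i)"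
    using assms(1) by (auto simp: fam_def)
  have th: "theta (of_nat b ^ i * x) = of_nat b ^ i * theta x" for b i and x :: "'c fls fps"
    by (metis of_nat_power of_nat_eq_lift_const theta_lift_const_mult)
  have A: "fam j (B + B0) (\<lambda>b. \<mu> ^ b * (\<Sum>i\<le>j. of_nat b ^ i * (q * theta (y i))))"
    unfolding fam_def using bspan_theta[OF y(1)] by (intro exI[of _ "\<lambda>i. q * theta (y i)"]) auto
  have K: "fam j (B + B0) (\<lambda>b. \<mu> ^ b * (\<Sum>i\<le>j. of_nat b ^ i * (\<kappa> * y i)))"
    unfolding fam_def using bspan_kappa[OF y(1)] by (intro exI[of _ "\<lambda>i. \<kappa> * y i"]) auto
  have "q * theta (\<Phi> b) = of_nat b * (\<mu> ^ b * (\<Sum>i\<le>j. of_nat b ^ i * (\<kappa> * y i)))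
      + \<mu> ^ b * (\<Sum>i\<le>j. of_nat b ^ i * (q * theta (y i)))" for b
  proof -
    define S where "S = (\<Sum>i\<le>j. of_nat b ^ i * y i)"
    have "q * theta (\<mu> ^ b) = of_nat b * \<mu> ^ b * \<kappa>"
    proof (cases b)
      case (Suc c)
      have "q * theta (\<mu> ^ b) = of_nat b * \<mu> ^ c * (q * theta \<mu>)"
        unfolding Suc theta_power by (simp add: mult_ac)
      then show ?thesis by (simp add: theta_mu Suc mult_ac)
    qed simp
    then have "q * theta (\<mu> ^ b * S) = of_nat b * \<mu> ^ b * (\<kappa> * S) + \<mu> ^ b * (q * theta S)"
      by (simp only: theta_mult distrib_left mult.assoc[symmetric]) (simp only: mult_ac)
    moreover have "\<kappa> * S = (\<Sum>i\<le>j. of_nat b ^ i * (\<kappa> * y i))"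
      unfolding S_def sum_distrib_left by (simp add: mult_ac)
    moreover have "q * theta S = (\<Sum>i\<le>j. of_nat b ^ i * (q * theta (y i)))"
      unfolding S_def theta_sum th sum_distrib_left by (simp add: mult_ac)
    ultimately show ?thesis by (simp add: y(2) S_def[symmetric] mult.assoc)
  qed
  then show ?thesis
    using fam_add[OF fam_of_nat_mult[OF K] fam_mono[OF A, of "Suc j" "B + B0"]] by simp
qed

lemma fam_power:
  "fam n (B0 * (1 + int k + int n)) (\<lambda>b. q ^ (k + n) * (theta ^^ n) (\<mu> ^ (b + k) * F))"
proof (induction n)
  case 0
  have "bspan G (B0 * (1 + int k)) ((q * \<mu>) ^ k * F)"
  proof (induction k)
    case (Suc k)
    then show ?case using bspan_mu[OF Suc] by (simp add: algebra_simps)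
  qed (use F in simp)
  then show ?case
    unfolding fam_def by (intro exI[of _ "\<lambda>_. (q * \<mu>) ^ k * F"]) (auto simp: power_add power_mult_distrib mult_ac)
next
  case (Suc n)
  define z where "z b = (theta ^^ n) (\<mu> ^ (b + k) * F)" for b
  define B where "B = B0 * (1 + int k + int n)"
  have IH: "fam n B (\<lambda>b. q ^ (k + n) * z b)" using Suc by (simp add: z_def B_def)
  have "q * theta (q ^ (k + n) * z b)
      = of_nat (k + n) * theta q * (q ^ (k + n) * z b) + q ^ (k + Suc n) * theta (z b)" for b
  proof -
    define m where "m = k + n"
    have "m = 0 \<or> q * q ^ (m - Suc 0) = q ^ m"
      by (cases m) simp_all
    then have "q * theta (q ^ m * z b) = of_nat m * theta q * (q ^ m * z b) + q ^ Suc m * theta (z b)"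
      by (auto simp: theta_mult theta_power algebra_simps)
    then show ?thesis by (simp add: m_def)
  qed
  then have eq: "q ^ (k + Suc n) * (theta ^^ Suc n) (\<mu> ^ (b + k) * F)
      = q * theta (q ^ (k + n) * z b) + (- of_nat (k + n) * theta q) * (q ^ (k + n) * z b)" for b
    by (simp add: z_def algebra_simps)
  have "- of_nat (k + n) * theta q = lift_const (- of_nat (k + n)) * theta q"
    by (metis lift_const_minus of_nat_eq_lift_const)
  then have "band B0 (- of_nat (k + n) * theta q)"
    using band_lift_const_mult[OF band_theta[OF band_q]] by metis
  from fam_mult[OF IH this] have "fam n (B + B0) (\<lambda>b. (- of_nat (k + n) * theta q) * (q ^ (k + n) * z b))" .
  from fam_add[OF fam_theta[OF IH] fam_mono[OF this, of "Suc n" "B + B0"]]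
  have "fam (Suc n) (B + B0) (\<lambda>b. q ^ (k + Suc n) * (theta ^^ Suc n) (\<mu> ^ (b + k) * F))"
    unfolding eq by simp
  moreover have "B + B0 = B0 * (1 + int k + int (Suc n))"
    by (simp add: B_def algebra_simps)
  ultimately show ?case by metis
qed

text \<open>There are \<open>(N + 1)^3\<close> series \<open>b^l \<theta>^n (\<mu>^(b+k) F)\<close>; after clearing the denominator \<open>q^(2N)\<close> they
  lie in a space of dimension \<open>O(N^2)\<close>.\<close>

lemma coefficient_recurrence:
  "\<exists>N c. (\<exists>k\<le>N. \<exists>l\<le>N. \<exists>n\<le>N. c k l n \<noteq> 0) \<and>
     (\<forall>b a. (\<Sum>k\<le>N. \<Sum>l\<le>N. \<Sum>n\<le>N. c k l n * of_nat b ^ l * of_int a ^ n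
        * xcoeff (\<mu> ^ (b + k) * F) a) = 0)"
proof -
  define bn where "bn = nat B0"
  define C where "C = card G * (2 * bn + 1)"
  define N where "N = 4 * C"
  define B where "B = B0 * (1 + 2 * int N)"
  define \<Phi> where "\<Phi> = (\<lambda>(k, l, n) b. of_nat b ^ l * (q ^ (2 * N) * (theta ^^ n) (\<mu> ^ (b + k) * F)))"
  define I where "I = {..N} \<times> {..N} \<times> {..N}"
  have "fam (2 * N) B (\<Phi> i)" if iI: "i \<in> I" for i
  proof -
    obtain k l n where i: "i = (k, l, n)" "k \<le> N" "l \<le> N" "n \<le> N"
      using iI by (cases i) (auto simp: I_def)
    have "band (int (2 * N - (k + n)) * B0) (q ^ (2 * N - (k + n)))"
      by (rule band_power[OF band_q])
    from fam_of_nat_power_mult[OF fam_mult[OF fam_power this], of n l k]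
    have "fam (n + l) (B0 * (1 + int k + int n) + int (2 * N - (k + n)) * B0)
        (\<lambda>b. of_nat b ^ l * (q ^ (2 * N - (k + n)) * (q ^ (k + n) * (theta ^^ n) (\<mu> ^ (b + k) * F))))" .
    moreover have "q ^ (2 * N - (k + n)) * (q ^ (k + n) * x) = q ^ (2 * N) * x" for x
      using i by (simp add: mult.assoc[symmetric] power_add[symmetric])
    moreover have "B0 * (1 + int k + int n) + int (2 * N - (k + n)) * B0 = B"
      using i by (simp add: B_def of_nat_diff algebra_simps)
    ultimately have "fam (n + l) B (\<Phi> i)"
      by (simp add: \<Phi>_def i(1))
    then show ?thesis by (rule fam_mono) (use i in auto)
  qed
  then have "\<forall>i. \<exists>y. i \<in> I \<longrightarrow> (\<forall>j. bspan G B (y j)) \<and>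
     (\<forall>b. \<Phi> i b = \<mu> ^ b * (\<Sum>j\<le>2 * N. of_nat b ^ j * y j))"
    unfolding fam_def by blast
  from choice[OF this] obtain y where y: "\<And>i j. i \<in> I \<Longrightarrow> bspan G B (y i j)"
    "\<And>i b. i \<in> I \<Longrightarrow> \<Phi> i b = \<mu> ^ b * (\<Sum>j\<le>2 * N. of_nat b ^ j * y i j)"
    by blast
  have "\<forall>i j. \<exists>m. i \<in> I \<longrightarrow> (\<forall>g. band B (m g)) \<and> y i j = (\<Sum>g\<in>G. m g * g)"
    using y(1) unfolding bspan_def by blast
  then obtain m where m: "\<And>i j g. i \<in> I \<Longrightarrow> band B (m i j g)"
    "\<And>i j. i \<in> I \<Longrightarrow> y i j = (\<Sum>g\<in>G. m i j g * g)"
    by metis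
  define J where "J = {..2 * N} \<times> G \<times> {-B..B}"
  have Bn: "B = int (bn * (2 * N + 1))"
    using B0 by (simp add: B_def bn_def algebra_simps)
  have "card J = (2 * N + 1) * (card G * (2 * (bn * (2 * N + 1)) + 1))"
  proof -
    have "card {- int n..int n} = 2 * n + 1" for n
      by (simp add: nat_eq_iff)
    then have "card {-B..B} = 2 * (bn * (2 * N + 1)) + 1"
      unfolding Bn .
    then show ?thesis
      by (simp only: J_def card_cartesian_product card_atMost Suc_eq_plus1)
  qed
  also have "\<dots> \<le> (2 * N + 1) * (card G * ((2 * bn + 1) * (2 * N + 1)))"
    by (intro mult_left_mono) (auto simp: algebra_simps)
  also have "\<dots> = C * ((2 * N + 1) * (2 * N + 1))"
    by (simp add: C_def algebra_simps)
  also have "\<dots> \<le> C * ((2 * (N + 1)) * (2 * (N + 1)))"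
    by (intro mult_left_mono mult_mono) auto
  also have "\<dots> = N * ((N + 1) * (N + 1))"
    by (simp add: N_def algebra_simps)
  also have "\<dots> < (N + 1) * ((N + 1) * (N + 1))"
    by simp
  also have "\<dots> = card I"
    by (simp add: I_def)
  finally have card: "card J < card I" .
  define v where "v = (\<lambda>i (j, g, a). xcoeff (m i j g) a)"
  have "\<exists>c. (\<forall>i. c i \<in> UNIV) \<and> (\<exists>i\<in>I. c i \<noteq> 0) \<and> (\<forall>j\<in>J. (\<Sum>i\<in>I. c i * v i j) = 0)"
    using fin_G card by (intro exists_linear_dependence) (auto simp: I_def J_def)
  then obtain c where c: "\<exists>i\<in>I. c i \<noteq> 0" "\<And>j. j \<in> J \<Longrightarrow> (\<Sum>i\<in>I. c i * v i j) = 0" by blast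
  have m0: "(\<Sum>i\<in>I. lift_const (c i) * m i j g) = 0" if "j \<le> 2 * N" "g \<in> G" for j g
  proof -
    define M where "M = (\<Sum>i\<in>I. lift_const (c i) * m i j g)"
    have "band B M"
      unfolding M_def using m(1) by (intro band_sum band_lift_const_mult)
    moreover have "xcoeff M a = 0" if "a \<in> {-B..B}" for a
      using c(2)[of "(j, g, a)"] that \<open>j \<le> 2 * N\<close> \<open>g \<in> G\<close> by (simp add: M_def v_def J_def)
    then have "(\<Sum>k\<in>{-B..B}. lift_const (xcoeff M k) * xpow k) = 0"
      by (intro sum.neutral) auto
    ultimately show ?thesis using band_expansion[of B M] unfolding M_def[symmetric] by argo
  qed
  have comb: "(\<Sum>i\<in>I. lift_const (c i) * \<Phi> i b) = 0" for b
  proof -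
    have "(\<Sum>i\<in>I. lift_const (c i) * \<Phi> i b)
        = (\<Sum>i\<in>I. \<mu> ^ b * (\<Sum>j\<le>2 * N. of_nat b ^ j * (\<Sum>g\<in>G. lift_const (c i) * m i j g * g)))"
      by (intro sum.cong refl) (simp add: y(2) m(2) sum_distrib_left mult_ac)
    also have "\<dots> = \<mu> ^ b * (\<Sum>j\<le>2 * N. of_nat b ^ j * (\<Sum>g\<in>G. (\<Sum>i\<in>I. lift_const (c i) * m i j g) * g))"
      unfolding sum_distrib_left sum_distrib_right
      by (subst sum.swap, rule sum.cong[OF refl], subst sum.swap) simp
    also have "\<dots> = 0" by (simp add: m0)
    finally show ?thesis .
  qed
  have rel: "(\<Sum>(k,l,n)\<in>I. c (k,l,n) * of_nat b ^ l * of_int a ^ n * xcoeff (\<mu> ^ (b + k) * F) a) = 0"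
    for b :: nat and a
  proof -
    have th: "xcoeff (of_nat b ^ l * x) a = of_nat b ^ l * xcoeff x a" for l x
      by (metis of_nat_power of_nat_eq_lift_const xcoeff_lift_const_mult)
    have "q ^ (2 * N) * (\<Sum>(k,l,n)\<in>I. lift_const (c (k,l,n)) * (of_nat b ^ l * (theta ^^ n) (\<mu> ^ (b + k) * F))) = 0"
      using comb[of b] unfolding \<Phi>_def sum_distrib_left case_prod_unfold by (simp add: mult_ac)
    then have "(\<Sum>(k,l,n)\<in>I. lift_const (c (k,l,n)) * (of_nat b ^ l * (theta ^^ n) (\<mu> ^ (b + k) * F))) = 0"
      using q_nonzero by simp
    then have "xcoeff (\<Sum>(k,l,n)\<in>I. lift_const (c (k,l,n)) * (of_nat b ^ l * (theta ^^ n) (\<mu> ^ (b + k) * F))) a = 0"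
      by simp
    then show ?thesis
      by (simp add: case_prod_unfold th mult.assoc)
  qed
  show ?thesis
  proof (rule exI[of _ N], rule exI[of _ "\<lambda>k l n. c (k, l, n)"], rule conjI)
    show "\<exists>k\<le>N. \<exists>l\<le>N. \<exists>n\<le>N. c (k, l, n) \<noteq> 0"
      using c(1) by (auto simp: I_def)
    show "\<forall>b a. (\<Sum>k\<le>N. \<Sum>l\<le>N. \<Sum>n\<le>N. c (k, l, n) * of_nat b ^ l * of_int a ^ n
        * xcoeff (\<mu> ^ (b + k) * F) a) = 0"
      using rel by (simp add: I_def sum.cartesian_product)
  qed
qed

end

lemma eventually_columns_dfin:
  assumes "power_family G q \<kappa> \<mu> F B0"
  shows "\<exists>a0. \<forall>a\<ge>a0. \<forall>Y. (\<forall>b. xcoeff Y b = (if b \<ge> 0 then xcoeff (\<mu> ^ nat b * F) a else 0)) \<longrightarrow> dfin Y"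
proof -
  interpret power_family G q \<kappa> \<mu> F B0 by fact
  obtain N c k0 l0 n0 where N: "k0 \<le> N" "l0 \<le> N" "n0 \<le> N" "c k0 l0 n0 \<noteq> 0"
    and rel: "\<And>b a. (\<Sum>k\<le>N. \<Sum>l\<le>N. \<Sum>n\<le>N. c k l n * of_nat b ^ l * of_int a ^ n
        * xcoeff (\<mu> ^ (b + k) * F) a) = 0"
    using coefficient_recurrence by blast
  define e where "e k l a = (\<Sum>n\<le>N. c k l n * of_int a ^ n)" for k l and a :: int
  define f where "f = (\<Sum>n\<le>N. monom (c k0 l0 n) n)"
  have pf: "poly f (of_int a) = e k0 l0 a" for a
    by (simp add: f_def e_def poly_sum poly_monom)
  have "coeff f n0 = c k0 l0 n0"
    using N by (simp add: f_def coeff_sum)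
  then have "f \<noteq> 0" using N by auto
  then have "finite {x. poly f x = 0}" by (rule poly_roots_finite)
  moreover have "inj (of_int :: int \<Rightarrow> 'a fps)"
  proof (rule injI)
    fix x y :: int
    assume "of_int x = (of_int y :: 'a fps)"
    then have "(of_int x :: 'a fps) $ 0 = of_int y $ 0" by simp
    then show "x = y" by (simp add: fps_of_int[symmetric])
  qed
  ultimately have fin: "finite (of_int -` {x. poly f x = 0} :: int set)" (is "finite ?S")
    by (intro finite_vimageI)
  define a1 where "a1 = Max (insert 0 ?S) + 1"
  have a1: "a < a1" if "a \<in> ?S" for a
    using Max_ge[of "insert 0 ?S" a] fin that by (simp add: a1_def)
  have nz: "e k0 l0 a \<noteq> 0" if "a \<ge> a1" for a
    using a1[of a] that pf[of a] by force
  have "dfin Y" if "a \<ge> a1" and Y: "\<And>b. xcoeff Y b = (if b \<ge> 0 then xcoeff (\<mu> ^ nat b * F) a else 0)" for a Y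
  proof -
    define w where "w = (\<Prod>i\<in>{1..N}. [:of_nat i, 1:] :: 'a fps poly)"
    define s where "s k = (\<Sum>l\<le>N. monom (e k l a) l)" for k
    have ps: "poly (s k) x = (\<Sum>l\<le>N. e k l a * x ^ l)" for k x
      by (simp add: s_def poly_sum poly_monom)
    have "w \<noteq> 0" by (simp add: w_def)
    have "coeff (s k0) l0 = e k0 l0 a" using N by (simp add: s_def coeff_sum)
    then have "s k0 \<noteq> 0" using nz[OF that(1)] by auto
    show ?thesis
    proof (rule dfin_of_recurrence[where N = N and j = k0 and pol = "\<lambda>k. w * s k"])
      fix b :: int
      have pw: "poly w (of_int b) = 0" if "- int N \<le> b" "b < 0"
        unfolding w_def poly_prod using that
        by (intro prod_zero bexI[of _ "nat (- b)"]) auto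
      consider "b \<ge> 0" | "- int N \<le> b" "b < 0" | "b < - int N" by linarith
      then have "poly w (of_int b) * (\<Sum>k\<le>N. poly (s k) (of_int b) * xcoeff Y (b + int k)) = 0"
      proof cases
        case 1
        have "(\<Sum>k\<le>N. poly (s k) (of_int b) * xcoeff Y (b + int k))
           = (\<Sum>k\<le>N. \<Sum>l\<le>N. \<Sum>n\<le>N. c k l n * of_nat (nat b) ^ l * of_int a ^ n
               * xcoeff (\<mu> ^ (nat b + k) * F) a)"
          using 1 by (intro sum.cong refl)
            (simp add: ps e_def Y sum_distrib_right sum_distrib_left nat_add_distrib mult_ac)
        then show ?thesis using rel by simp
      next
        case 2
        then show ?thesis using pw by simp
      next
        case 3
        then have "(\<Sum>k\<le>N. poly (s k) (of_int b) * xcoeff Y (b + int k)) = 0"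
          by (intro sum.neutral) (auto simp: Y)
        then show ?thesis by simp
      qed
      then show "(\<Sum>k\<le>N. poly (w * s k) (of_int b) * xcoeff Y (b + int k)) = 0"
        by (simp add: sum_distrib_left mult.assoc)
    qed (use N \<open>w \<noteq> 0\<close> \<open>s k0 \<noteq> 0\<close> in auto)
  qed
  then show ?thesis by blast
qed


section \<open>Solving the kernel equation in a half-plane\<close>

locale half_plane = square_root \<rho> for \<rho> :: "'c::field_char_0 fls fps" +
  fixes P0 Pf Pb :: "'c fls fps" and H src :: "nat \<Rightarrow> 'c fls fps" and Q :: nat
  assumes P0: "P0 \<in> Lpoly" and Pf: "Pf \<in> Lpoly" "Pf \<noteq> 0" and Pb: "Pb \<in> Lpoly" "Pb \<noteq> 0"
    and discriminant: "\<rho> * \<rho> = (1 - fps_X * P0) * (1 - fps_X * P0) - 4 * (fps_X * Pf) * (fps_X * Pb)"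
    and src: "\<And>\<eta>. src \<eta> \<in> Lpoly" "\<And>\<eta>. \<eta> > Q \<Longrightarrow> src \<eta> = 0"
    and kernel: "\<And>\<eta>. \<eta> \<ge> 1 \<Longrightarrow>
      (1 - fps_X * P0) * H \<eta> = src \<eta> + fps_X * Pf * H (\<eta> - 1) + fps_X * Pb * H (Suc \<eta>)"
begin

abbreviation \<pi> where "\<pi> \<equiv> fps_X * Pb"
abbreviation \<pi>' where "\<pi>' \<equiv> fps_X * Pf"

definition half :: "'c fls fps" where "half = lift_const (fps_const (1 / 2))"

definition u :: "'c fls fps" where "u = half * (1 - fps_X * P0 + \<rho>)"
definition v :: "'c fls fps" where "v = half * (1 - fps_X * P0 - \<rho>)"

lemma half: "2 * half = 1"
proof -
  have "2 * half = lift_const (2 * fps_const (1 / 2))"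
    by (simp add: half_def lift_const_mult numeral_eq_lift_const)
  also have "2 * fps_const (1 / 2) = (1 :: 'c fps)"
    by (simp add: numeral_fps_const)
  finally show ?thesis by simp
qed

lemma two_mult_half: "2 * (half * x) = x"
  using half by (simp add: mult.assoc[symmetric])

lemma half_Lpoly: "half \<in> Lpoly"
  by (simp add: half_def)

lemma pi_Lpoly: "\<pi> \<in> Lpoly" "\<pi>' \<in> Lpoly" "\<pi> \<noteq> 0" "\<pi>' \<noteq> 0"
  using Pf Pb by auto

lemma u_plus_v: "u + v = 1 - fps_X * P0"
proof -
  have "u + v = 2 * (half * (1 - fps_X * P0))" by (simp add: u_def v_def algebra_simps)
  then show ?thesis by (simp add: two_mult_half)
qed

lemma two_v: "2 * v = 1 - fps_X * P0 - \<rho>"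
  by (simp add: v_def two_mult_half)

lemma two_u: "2 * u = 1 - fps_X * P0 + \<rho>"
  by (simp add: u_def two_mult_half)

lemma u_mult_v: "u * v = \<pi>' * \<pi>"
proof -
  have "4 * (u * v) = (2 * u) * (2 * v)" by simp
  also have "\<dots> = (1 - fps_X * P0) * (1 - fps_X * P0) - \<rho> * \<rho>"
    unfolding two_u two_v by (simp add: algebra_simps)
  also have "\<dots> = 4 * (\<pi>' * \<pi>)"
    unfolding discriminant by (simp add: algebra_simps)
  finally show ?thesis by simp
qed

lemma u_nth_0: "u $ 0 = 1"
proof -
  have "u $ 0 = fls_const (1 / 2) * 2"
    by (simp add: u_def half_def rho_nth_0 lift_const_def)
  also have "\<dots> = fls_const (1 / 2) * fls_const 2"
    by (metis fls_const_numeral)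
  also have "\<dots> = 1" by (simp del: fls_const_numeral)
  finally show ?thesis .
qed

definition uinv where "uinv = inverse u"

lemma u_uinv: "u * uinv = 1"
  unfolding uinv_def by (rule inverse_mult_eq_1') (simp add: u_nth_0)

lemma alg_v: "alg v"
  unfolding v_def using half_Lpoly P0
  by (intro alg_mult[OF alg_Lpoly] alg_diff[OF alg_Lpoly alg_rho]) auto

lemma alg_uinv: "alg uinv"
proof (rule alg_cancel[of "\<pi>' * \<pi>"])
  have "\<pi>' * \<pi> * uinv = v"
    unfolding u_mult_v[symmetric] using u_uinv by (metis mult.assoc mult.commute mult_1_right)
  then show "alg (\<pi>' * \<pi> * uinv)" using alg_v by simp
qed (use pi_Lpoly in auto)

definition \<mu> where "\<mu> = \<pi> * uinv"
definition lam where "lam = \<pi>' * uinv"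

lemma pi_lambda: "\<pi> * lam = v" and pi'_mu: "\<pi>' * \<mu> = v"
proof -
  have "\<pi> * lam = u * v * uinv" by (simp add: u_mult_v lam_def mult_ac)
  also have "\<dots> = v" using u_uinv by (metis mult.assoc mult.commute mult_1_right)
  finally show "\<pi> * lam = v" .
  then show "\<pi>' * \<mu> = v" by (simp add: \<mu>_def lam_def mult_ac)
qed

lemma lambda_u: "lam * u = \<pi>'" and mu_u: "\<mu> * u = \<pi>"
  using u_uinv by (simp_all add: lam_def \<mu>_def mult.assoc mult.commute[of uinv])

lemma alg_mu: "alg \<mu>"
  unfolding \<mu>_def by (rule alg_mult[OF alg_Lpoly[OF pi_Lpoly(1)] alg_uinv])

text \<open>The residual of \<open>H \<eta> = \<lambda> H (\<eta> - 1)\<close>; it is propagated only downwards, by a factor \<open>\<mu> = O(t)\<close>,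
  and hence vanishes beyond the sources.\<close>

definition e where "e \<eta> = u * H \<eta> - \<pi>' * H (\<eta> - 1)"

lemma e_rec:
  assumes "\<eta> \<ge> 1"
  shows "e \<eta> = src \<eta> + \<mu> * e (Suc \<eta>)"
proof -
  have "\<mu> * e (Suc \<eta>) = (\<mu> * u) * H (Suc \<eta>) - (\<pi>' * \<mu>) * H \<eta>"
    by (simp add: e_def algebra_simps)
  also have "\<dots> = \<pi> * H (Suc \<eta>) - v * H \<eta>" by (simp add: mu_u pi'_mu)
  finally have "src \<eta> + \<mu> * e (Suc \<eta>) = src \<eta> + \<pi> * H (Suc \<eta>) - v * H \<eta>" by simp
  also have "src \<eta> + \<pi> * H (Suc \<eta>) = (u + v) * H \<eta> - \<pi>' * H (\<eta> - 1)"
    unfolding u_plus_v using kernel[OF assms] by simp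
  finally show ?thesis by (simp add: e_def algebra_simps)
qed

lemma mu_nth_0: "\<mu> $ 0 = 0"
  by (simp add: \<mu>_def mult.assoc)

lemma e_beyond: "\<eta> > Q \<Longrightarrow> e \<eta> = 0"
proof -
  have "\<forall>\<eta>>Q. e \<eta> $ n = 0" for n
  proof (induction n rule: less_induct)
    case (less n)
    show ?case
    proof (intro allI impI)
      fix \<eta> assume \<eta>: "Q < \<eta>"
      have "\<mu> $ i * e (Suc \<eta>) $ (n - i) = 0" if "i \<le> n" for i
        using less[of "n - i"] \<eta> that mu_nth_0 by (cases "i = 0") auto
      then have "(\<mu> * e (Suc \<eta>)) $ n = 0"
        unfolding fps_mult_nth by (intro sum.neutral) auto
      then show "e \<eta> $ n = 0" using e_rec[of \<eta>] src(2)[of \<eta>] \<eta> by simp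
    qed
  qed
  then show "\<eta> > Q \<Longrightarrow> e \<eta> = 0" by (simp add: fps_eq_iff)
qed

lemma alg_e: "\<eta> \<ge> 1 \<Longrightarrow> alg (e \<eta>)"
proof (induction "Q - \<eta>" arbitrary: \<eta>)
  case 0
  then show ?case
  proof (cases "\<eta> > Q")
    case False
    then show ?thesis using e_rec[of \<eta>] 0 e_beyond[of "Suc \<eta>"] src(1) by auto
  qed (auto simp: e_beyond)
next
  case (Suc k)
  then have "alg (e (Suc \<eta>))" by auto
  then show ?case
    unfolding e_rec[OF Suc.prems] by (intro alg_add alg_mult alg_mu) (rule alg_Lpoly[OF src(1)])
qed

lemma first_row: "2 * \<pi> * H 1 = (1 - fps_X * P0 - \<rho>) * H 0 + 2 * \<mu> * e 1"
proof -
  have "\<mu> * e 1 = (\<mu> * u) * H 1 - (\<pi>' * \<mu>) * H 0" by (simp add: e_def algebra_simps)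
  then have "\<pi> * H 1 = v * H 0 + \<mu> * e 1" by (simp add: mu_u pi'_mu)
  then have "2 * (\<pi> * H 1) = (2 * v) * H 0 + 2 * (\<mu> * e 1)" by (simp add: algebra_simps)
  then show ?thesis unfolding two_v by (simp add: mult.assoc)
qed

lemma alg_mu_e: "alg (2 * \<mu> * e 1)"
  by (intro alg_mult alg_mu alg_e alg_Lpoly[OF Lpoly_numeral]) simp

lemma row_step:
  assumes "\<eta> \<ge> 1"
  shows "H \<eta> = uinv * (\<pi>' * H (\<eta> - 1) + e \<eta>)"
proof -
  have "uinv * (\<pi>' * H (\<eta> - 1) + e \<eta>) = (u * uinv) * H \<eta>"
    by (simp add: e_def algebra_simps)
  then show ?thesis by (simp add: u_uinv)
qed

lemma dfin_rows:
  assumes "dfin (H 0)"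
  shows "dfin (H \<eta>)"
proof (induction \<eta>)
  case (Suc \<eta>)
  have "dfin (uinv * (\<pi>' * H \<eta> + e (Suc \<eta>)))"
    by (intro dfin_mult[OF dfin_alg[OF alg_uinv]] dfin_add dfin_Lpoly_mult pi_Lpoly Suc
        dfin_alg[OF alg_e]) simp
  then show ?case using row_step[of "Suc \<eta>"] by simp
qed (rule assms)

lemma row_power: "H (Suc Q + b) = lam ^ b * H (Suc Q)"
proof (induction b)
  case (Suc b)
  have "H (Suc Q + Suc b) = uinv * (\<pi>' * H (Suc Q + b))"
    using row_step[of "Suc Q + Suc b"] e_beyond[of "Suc Q + Suc b"] by simp
  then show ?case unfolding Suc by (simp add: lam_def mult_ac)
qed simp

lemma theta_lambda:
  "4 * \<Delta> * \<pi> * \<pi>' * theta lam = lam * (4 * \<Delta> * \<pi> * theta \<pi>' - v * (2 * \<Delta> * theta (1 - fps_X * P0) + \<rho> * theta \<Delta>))"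
proof -
  have tu: "2 * \<Delta> * (2 * theta u) = 2 * \<Delta> * theta (1 - fps_X * P0) + \<rho> * theta \<Delta>"
  proof -
    have "2 * theta u = theta (1 - fps_X * P0 + \<rho>)"
      by (simp only: theta_numeral_mult[symmetric] two_u)
    then show ?thesis by (simp only: theta_add distrib_left Delta_theta_rho)
  qed
  have tl: "theta lam * u = theta \<pi>' - lam * theta u"
    using arg_cong[OF lambda_u, of theta] by (simp add: theta_mult algebra_simps)
  have "u * (\<pi> * \<pi>' * theta lam) = \<pi> * \<pi>' * (theta lam * u)" by (simp add: mult_ac)
  also have "\<dots> = \<pi> * \<pi>' * theta \<pi>' - \<pi>' * (\<pi> * lam) * theta u"
    unfolding tl by (simp add: algebra_simps)
  also have "\<dots> = (lam * u) * (\<pi> * theta \<pi>' - v * theta u)"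
    unfolding pi_lambda lambda_u by (simp add: algebra_simps)
  also have "\<dots> = u * (lam * (\<pi> * theta \<pi>' - v * theta u))" by (simp add: mult_ac)
  finally have 1: "\<pi> * \<pi>' * theta lam = lam * (\<pi> * theta \<pi>' - v * theta u)"
    using u_nth_0 by (metis fps_zero_nth mult_left_cancel zero_neq_one)
  have "4 * \<Delta> * \<pi> * \<pi>' * theta lam = 4 * \<Delta> * (\<pi> * \<pi>' * theta lam)" by (simp add: mult_ac)
  also have "\<dots> = lam * (4 * \<Delta> * \<pi> * theta \<pi>' - v * (2 * \<Delta> * (2 * theta u)))"
    unfolding 1 by (simp add: algebra_simps)
  also have "\<dots> = lam * (4 * \<Delta> * \<pi> * theta \<pi>' - v * (2 * \<Delta> * theta (1 - fps_X * P0) + \<rho> * theta \<Delta>))"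
    unfolding tu ..
  finally show ?thesis .
qed

lemma dfin_columns:
  assumes "dfin (H 0)"
  shows "\<exists>a0. \<forall>a\<ge>a0. \<forall>Y. (\<forall>b. xcoeff Y b = (if b \<ge> 1 then xcoeff (H (nat b)) a else 0)) \<longrightarrow> dfin Y"
proof -
  define F where "F = H (Suc Q)"
  obtain e0 G0 where G0: "theta_stable e0 G0" "F \<in> lspan G0"
    using dfin_rows[OF assms, of "Suc Q"] by (auto simp: F_def dfin_def)
  have D: "2 * \<Delta> \<in> Lpoly" "2 * \<Delta> \<noteq> 0"
    using Lpoly_mult[OF Lpoly_numeral rho_square] rho_nonzero by auto
  have "theta \<Delta> * \<rho> \<in> lspan {1, \<rho>}"
    by (intro lspan_scale Lpoly_theta rho_square lspan_base) simp
  then have "2 * \<Delta> * theta \<rho> \<in> lspan {1, \<rho>}"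
    by (simp only: Delta_theta_rho mult.commute[of \<rho> "theta \<Delta>"])
  then have R: "theta_stable (2 * \<Delta>) {1, \<rho>}"
    using D by (simp add: theta_stable_def)
  define e' where "e' = e0 * (2 * \<Delta>)"
  define G where "G = (\<lambda>(g, h). g * h) ` (G0 \<times> {1, \<rho>})"
  have e0: "e0 \<in> Lpoly" "e0 \<noteq> 0" using G0(1) by (auto simp: theta_stable_def)
  have R': "theta_stable e' {1, \<rho>}"
    using theta_stable_scale[OF R e0] by (simp only: e'_def mult.commute)
  have G: "theta_stable e' G"
    unfolding G_def by (rule theta_stable_mult[OF theta_stable_scale[OF G0(1) D, folded e'_def] R'])
  have "G0 \<subseteq> G" unfolding G_def by force
  then have F: "F \<in> lspan G" using lspan_mono G0(2) by blast
  have rho: "\<rho> * x \<in> lspan G" if "x \<in> lspan G" for x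
    using that
  proof (induction rule: lspan.induct)
    case (cons m g x)
    then obtain g0 h where g: "g0 \<in> G0" "g = g0 * h" "h = 1 \<or> h = \<rho>" by (auto simp: G_def)
    have "g0 \<in> G" "g0 * \<rho> \<in> G" using g(1) by (force simp: G_def)+
    moreover have "\<rho> * g = g0 * \<rho> \<or> \<rho> * g = \<Delta> * g0" using g(2,3) by (auto simp: mult_ac)
    ultimately have "\<rho> * g \<in> lspan G"
      using lspan_base[of _ G] lspan_scale[OF rho_square] by metis
    moreover have "\<rho> * (m * g + x) = m * (\<rho> * g) + \<rho> * x" by (simp add: algebra_simps)
    ultimately show ?case using cons by (metis lspan_add lspan_scale)
  qed simp
  define S where "S = {f. \<forall>x\<in>lspan G. f * x \<in> lspan G}"
  have S_add: "f + g \<in> S" if "f \<in> S" "g \<in> S" for f g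
    using that by (auto simp: S_def distrib_right)
  have S_diff: "f - g \<in> S" if "f \<in> S" "g \<in> S" for f g
    using that by (auto simp: S_def left_diff_distrib)
  have S_mult: "f * g \<in> S" if "f \<in> S" "g \<in> S" for f g
    using that by (auto simp: S_def mult.assoc)
  have S_L: "f \<in> S" if "f \<in> Lpoly" for f
    using that by (auto simp: S_def)
  have S_rho: "\<rho> \<in> S" using rho by (simp add: S_def)
  define c where "c = 1 - fps_X * P0"
  have c: "c \<in> Lpoly" unfolding c_def using P0 by auto
  have S_v: "v \<in> S"
    unfolding v_def c_def[symmetric] by (intro S_mult S_diff S_rho S_L half_Lpoly c)
  define \<kappa>0 where "\<kappa>0 = 4 * \<Delta> * \<pi> * theta \<pi>' - v * (2 * \<Delta> * theta c + \<rho> * theta \<Delta>)"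
  have "fps_X \<in> S" "Pb \<in> S" "theta \<pi>' \<in> S" "2 \<in> S" "4 \<in> S" "theta c \<in> S" "theta \<Delta> \<in> S"
    by (intro S_L Lpoly_theta Lpoly_numeral Lpoly_fps_X c Pb pi_Lpoly rho_square)+
  then have S_kappa: "\<kappa>0 \<in> S"
    unfolding \<kappa>0_def by (intro S_mult S_diff S_add S_v S_rho)
  define d where "d = 4 * \<Delta> * \<pi> * \<pi>'"
  have d: "d \<in> Lpoly" "d \<noteq> 0"
  proof -
    have "4 * \<Delta> \<in> Lpoly" by (rule Lpoly_mult[OF Lpoly_numeral rho_square])
    then show "d \<in> Lpoly" unfolding d_def by (intro Lpoly_mult[OF Lpoly_mult] pi_Lpoly)
    show "d \<noteq> 0" using pi_Lpoly rho_nonzero by (simp add: d_def)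
  qed
  define q where "q = e' * d"
  define \<kappa> where "\<kappa> = e' * \<kappa>0"
  have e': "e' \<in> Lpoly" "e' \<noteq> 0" "finite G" using G by (auto simp: theta_stable_def)
  have 1: "q * theta g \<in> lspan G" if "g \<in> G" for g
  proof -
    have "d * (e' * theta g) \<in> lspan G" using G that d by (auto simp: theta_stable_def)
    then show ?thesis by (simp add: q_def mult_ac)
  qed
  have 2: "q * lam * g \<in> lspan G" if "g \<in> G" for g
  proof -
    have "q * lam * g = (e' * (4 * \<Delta> * \<pi>')) * ((\<pi> * lam) * g)" by (simp add: q_def d_def mult_ac)
    moreover have "v * g \<in> lspan G" using S_v that by (auto simp: S_def intro: lspan_base)
    moreover have "e' * (4 * \<Delta> * \<pi>') \<in> Lpoly"
      by (intro Lpoly_mult[OF e'(1)] Lpoly_mult[OF Lpoly_mult[OF Lpoly_numeral rho_square]] pi_Lpoly)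
    ultimately show ?thesis unfolding pi_lambda by (metis lspan_scale)
  qed
  have 3: "\<kappa> * g \<in> lspan G" if "g \<in> G" for g
    using S_mult[OF S_L[OF e'(1)] S_kappa] that by (auto simp: S_def \<kappa>_def intro: lspan_base)
  have 4: "q * theta lam = lam * \<kappa>"
  proof -
    have "q * theta lam = e' * (4 * \<Delta> * \<pi> * \<pi>' * theta lam)" by (simp add: q_def d_def mult_ac)
    then show ?thesis unfolding theta_lambda by (simp add: \<kappa>_def \<kappa>0_def c_def mult_ac)
  qed
  obtain B1 where B1: "\<forall>x\<in>G. bspan G B1 (q * theta x)"
    using lspan_imp_bspan_family[OF e'(3) e'(3), of "\<lambda>g. q * theta g"] 1 by blast
  obtain B2 where B2: "\<forall>x\<in>G. bspan G B2 (q * lam * x)"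
    using lspan_imp_bspan_family[OF e'(3) e'(3), of "\<lambda>g. q * lam * g"] 2 by blast
  obtain B3 where B3: "\<forall>x\<in>G. bspan G B3 (\<kappa> * x)"
    using lspan_imp_bspan_family[OF e'(3) e'(3), of "\<lambda>g. \<kappa> * g"] 3 by blast
  obtain B4 where B4: "B4 \<ge> 0" "bspan G B4 F" using lspan_imp_bspan[OF e'(3) F] by blast
  obtain B5 where B5: "band B5 q" using Lpoly_mult[OF e'(1) d(1)] by (auto simp: q_def Lpoly_def)
  define B0 where "B0 = Max {B1, B2, B3, B4, B5}"
  have le: "B1 \<le> B0" "B2 \<le> B0" "B3 \<le> B0" "B4 \<le> B0" "B5 \<le> B0"
    unfolding B0_def by (intro Max_ge; simp)+
  have pf: "power_family G q \<kappa> lam F B0"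
  proof
    show "bspan G B0 (q * theta g)" if "g \<in> G" for g using bspan_mono[OF _ le(1)] B1 that by blast
    show "bspan G B0 (q * lam * g)" if "g \<in> G" for g using bspan_mono[OF _ le(2)] B2 that by blast
    show "bspan G B0 (\<kappa> * g)" if "g \<in> G" for g using bspan_mono[OF _ le(3)] B3 that by blast
    show "bspan G B0 F" using bspan_mono[OF B4(2) le(4)] .
    show "band B0 q" using band_mono[OF B5 le(5)] .
    show "q * theta lam = lam * \<kappa>" by (rule 4)
    show "q \<noteq> 0" using e' d by (simp add: q_def)
  qed (use e' B4 le in auto)
  obtain a0 where a0: "\<And>a Y. a \<ge> a0 \<Longrightarrow>
      (\<And>b. xcoeff Y b = (if b \<ge> 0 then xcoeff (lam ^ nat b * F) a else 0)) \<Longrightarrow> dfin Y"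
    using eventually_columns_dfin[OF pf] by blast
  have "dfin Y" if a: "a \<ge> a0" and Y: "\<And>b. xcoeff Y b = (if b \<ge> 1 then xcoeff (H (nat b)) a else 0)" for a Y
  proof -
    define Y1 where "Y1 = (\<Sum>\<eta>\<in>{1..Q}. lift_const (xcoeff (H \<eta>) a) * xpow (int \<eta>))"
    have Y1: "xcoeff Y1 b = (if 1 \<le> b \<and> b \<le> int Q then xcoeff (H (nat b)) a else 0)" for b
    proof -
      have "xcoeff Y1 b = (\<Sum>\<eta>\<in>{1..Q}. if \<eta> = nat b \<and> b \<ge> 1 then xcoeff (H \<eta>) a else 0)"
        unfolding Y1_def xcoeff_sum by (intro sum.cong) (auto simp: xcoeff_xpow)
      also have "\<dots> = (if 1 \<le> b \<and> b \<le> int Q then xcoeff (H (nat b)) a else 0)"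
        by (cases "b \<ge> 1") (auto simp: nat_le_iff le_nat_iff)
      finally show ?thesis .
    qed
    have "dfin (xpow (- int (Suc Q)) * (Y - Y1))"
    proof (rule a0[OF a])
      fix b
      have "xcoeff (H (nat (b + int (Suc Q)))) a = xcoeff (lam ^ nat b * F) a" if "b \<ge> 0"
      proof -
        have "nat (b + int (Suc Q)) = Suc Q + nat b" using that by simp
        then show ?thesis using row_power[of "nat b"] by (simp only: F_def)
      qed
      then show "xcoeff (xpow (- int (Suc Q)) * (Y - Y1)) b = (if b \<ge> 0 then xcoeff (lam ^ nat b * F) a else 0)"
        by (simp only: xcoeff_xpow_mult xcoeff_diff Y Y1 diff_minus_eq_add) auto
    qed
    then have "dfin (Y - Y1)" by (rule dfin_cancel) auto
    moreover have "dfin Y1" unfolding Y1_def by (intro dfin_Lpoly) auto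
    ultimately show ?thesis using dfin_add[of "Y - Y1" Y1] by simp
  qed
  then show ?thesis by blast
qed

end


lemma one_sided_mono: "one_sided pos m F \<Longrightarrow> m' \<le> m \<Longrightarrow> one_sided pos m' F"
  by (auto simp: one_sided_def intro: supp_ge_mono supp_le_mono split: if_splits)

lemma one_sided_add: "one_sided pos m F \<Longrightarrow> one_sided pos m G \<Longrightarrow> one_sided pos m (F + G)"
  and one_sided_diff: "one_sided pos m F \<Longrightarrow> one_sided pos m G \<Longrightarrow> one_sided pos m (F - G)"
  by (auto simp: one_sided_def intro: supp_ge_add supp_le_add supp_ge_diff supp_le_diff split: if_splits)

lemma one_sided_band: "band B F \<Longrightarrow> one_sided pos (- B) F"
  by (auto simp: one_sided_def band_def)

lemma one_sided_band_mult:
  assumes "band B P" "one_sided pos m F"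
  shows "one_sided pos (m - B) (P * F)"
  using assms supp_ge_mult[of "- B" P m F] supp_le_mult[of B P "- m" F]
  by (auto simp: one_sided_def band_def split: if_splits)

lemma one_sided_both: "one_sided pos (- B) F \<Longrightarrow> one_sided (\<not> pos) (- B) F \<Longrightarrow> band B F"
  by (auto simp: one_sided_def band_def split: if_splits)

lemma one_sided_nth:
  "one_sided pos m F \<longleftrightarrow> (\<forall>n a. (if pos then a else - a) < m \<longrightarrow> F $ n $$ a = 0)"
  by (auto simp: one_sided_def supp_ge_def supp_le_def)

definition series_of :: "(nat \<Rightarrow> int \<Rightarrow> 'c) \<Rightarrow> 'c::field_char_0 fls fps" where
  "series_of g = Abs_fps (\<lambda>n. Abs_fls (g n))"

lemma series_of_nth:
  assumes "\<And>n. \<exists>N. \<forall>a<N. g n a = 0"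
  shows "series_of g $ n $$ a = g n a"
proof -
  obtain N where "\<forall>a<N. g n a = 0" using assms by blast
  then show ?thesis by (simp add: series_of_def nth_Abs_fls_lower_bound[of N])
qed

definition side_part :: "bool \<Rightarrow> 'c::field_char_0 fls fps \<Rightarrow> 'c fls fps" where
  "side_part pos F = series_of (\<lambda>n a. if (if pos then a > 0 else a < 0) then F $ n $$ a else 0)"

lemma side_part_nth [simp]:
  "side_part pos F $ n $$ a = (if (if pos then a > 0 else a < 0) then F $ n $$ a else 0)"
  unfolding side_part_def
proof (rule series_of_nth)
  show "\<exists>N. \<forall>a<N. (if (if pos then a > 0 else a < 0) then F $ n $$ a else 0) = 0" for n
    by (rule exI[of _ "fls_subdegree (F $ n)"]) simp
qed

lemma one_sided_side_part: "one_sided pos 1 (side_part pos F)"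
  by (auto simp: one_sided_nth)

lemma band_side_parts: "band 0 (F - (side_part pos F + side_part (\<not> pos) F))"
  by (auto simp: band_iff)

lemma band_side_part: "one_sided pos 0 F \<Longrightarrow> band 0 (F - side_part pos F)"
  by (auto simp: band_iff one_sided_nth)

lemma fps_const_Lpoly: "(\<And>a. \<bar>a\<bar> > B \<Longrightarrow> c $$ a = 0) \<Longrightarrow> fps_const c \<in> Lpoly"
  by (auto simp: Lpoly_def band_iff intro!: exI[of _ B])

lemma Lpoly_bounded: "(\<And>n a. \<bar>a\<bar> > B \<Longrightarrow> F $ n $$ a = 0) \<Longrightarrow> F \<in> Lpoly"
  by (auto simp: Lpoly_def band_iff intro!: exI[of _ B])

definition kpoly :: "(int \<Rightarrow> 'c) \<Rightarrow> 'c::field_char_0 fls fps" where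
  "kpoly c = (\<Sum>i\<in>{-1,0,1}. lift_const (fps_const (c i)) * xpow i)"

lemma kpoly_mult_nth [simp]:
  "(kpoly c * F) $ n $$ a = (\<Sum>i\<in>{-1,0,1}. c i * F $ n $$ (a - i))"
  by (simp add: kpoly_def distrib_right mult.assoc)

lemma band_kpoly: "band 1 (kpoly c)"
  unfolding kpoly_def by (intro band_sum band_lift_const_mult band_xpow) auto

lemma kpoly_Lpoly: "kpoly c \<in> Lpoly"
  using band_kpoly by (auto simp: Lpoly_def)

lemma band_fps_X_mult: "band B F \<Longrightarrow> band B (fps_X * F)"
  by (simp add: fps_X_eq_lift_const band_lift_const_mult)

lemma kpoly_nonzero:
  assumes "i \<in> {-1,0,1}" "c i \<noteq> 0"
  shows "kpoly c \<noteq> 0"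
proof
  assume "kpoly c = 0"
  then have "xcoeff (kpoly c) i = 0" by simp
  then show False using assms by (auto simp: kpoly_def xcoeff_xpow xcoeff_lift_const)
qed

lemma exists_square_root:
  fixes D :: "'c::field_char_0 fls fps"
  assumes "D $ 0 = 1"
  shows "\<exists>\<rho>. \<rho> * \<rho> = D \<and> \<rho> $ 0 = 1"
proof -
  define \<rho> where "\<rho> = fps_radical (\<lambda>_ _. 1) 2 D"
  have "\<rho> ^ Suc 1 = D"
    unfolding \<rho>_def using power_radical[of D "\<lambda>_ _. 1" 1] assms by (simp add: numeral_2_eq_2)
  then show ?thesis
    by (intro exI[of _ \<rho>]) (simp add: \<rho>_def)
qed

section \<open>Walks on the cone as arrays\<close>

text \<open>Membership in the half-open quadrant \<open>s\<close>, which depends on \<open>s\<close> modulo 4 only.\<close>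

definition inq :: "int \<Rightarrow> int \<Rightarrow> int \<Rightarrow> bool" where
  "inq s a b \<longleftrightarrow> (if s mod 4 = 0 then a > 0 \<and> b \<ge> 0 else if s mod 4 = 1 then a \<le> 0 \<and> b > 0
     else if s mod 4 = 2 then a < 0 \<and> b \<le> 0 else a \<ge> 0 \<and> b < 0)"

definition cell :: "int \<Rightarrow> int \<Rightarrow> int \<Rightarrow> int \<Rightarrow> int \<Rightarrow> bool" where
  "cell lo hi s a b \<longleftrightarrow> lo \<le> s \<and> s \<le> hi \<and> inq s a b \<and> (s = lo \<longrightarrow> a \<noteq> 0 \<and> b \<noteq> 0)"

locale walk_array =
  fixes w :: "int \<Rightarrow> int \<Rightarrow> 'c::field_char_0" and lo hi :: int
    and f :: "nat \<Rightarrow> int \<Rightarrow> int \<Rightarrow> int \<Rightarrow> 'c" and s0 p0 q0 :: int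
  assumes init: "f 0 s a b = (if cell lo hi s a b \<and> s = s0 \<and> a = p0 \<and> b = q0 then 1 else 0)"
    and step: "f (Suc n) s a b = (if cell lo hi s a b
        then \<Sum>i\<in>{-1,0,1}. \<Sum>j\<in>{-1,0,1}. w i j * (\<Sum>s'\<in>{s-1,s,s+1}. f n s' (a - i) (b - j)) else 0)"
    and weights: "\<exists>i\<in>{-1,0,1}. w i 1 \<noteq> 0" "\<exists>i\<in>{-1,0,1}. w i (- 1) \<noteq> 0"
      "\<exists>j\<in>{-1,0,1}. w 1 j \<noteq> 0" "\<exists>j\<in>{-1,0,1}. w (- 1) j \<noteq> 0"
begin

lemma f_zero: "\<not> cell lo hi s a b \<Longrightarrow> f n s a b = 0"
  by (cases n) (auto simp: init step)

lemma f_zero_inq: "\<not> inq s a b \<Longrightarrow> f n s a b = 0"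
  by (rule f_zero) (simp add: cell_def)

lemma f_bound: "\<bar>p0\<bar> + int n < \<bar>a\<bar> \<or> \<bar>q0\<bar> + int n < \<bar>b\<bar> \<Longrightarrow> f n s a b = 0"
proof (induction n arbitrary: s a b)
  case (Suc n)
  have "f n s' (a - i) (b - j) = 0" if "i \<in> {-1,0,1}" "j \<in> {-1,0,1}" for s' i j
    using that Suc.prems by (intro Suc.IH) auto
  then show ?case by (auto simp: step)
qed (auto simp: init)

definition row :: "int \<Rightarrow> int \<Rightarrow> 'c fls fps" where
  "row s b = series_of (\<lambda>n a. f n s a b)"

definition col :: "int \<Rightarrow> int \<Rightarrow> 'c fls fps" where
  "col s a = series_of (\<lambda>n b. f n s a b)"

lemma row_nth [simp]: "row s b $ n $$ a = f n s a b"
  unfolding row_def by (rule series_of_nth, rule_tac x = "- \<bar>p0\<bar> - int n" in exI) (auto intro!: f_bound)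

lemma col_nth [simp]: "col s a $ n $$ b = f n s a b"
  unfolding col_def by (rule series_of_nth, rule_tac x = "- \<bar>q0\<bar> - int n" in exI) (auto intro!: f_bound)

end

locale even_cone = walk_array w lo hi f s0 p0 q0
  for w :: "int \<Rightarrow> int \<Rightarrow> 'c::field_char_0" and lo hi f s0 p0 q0 +
  fixes c0 :: int and m :: nat
  assumes lo: "lo = 2 * c0" and hi: "hi = 2 * c0 + 2 * int m - 1" and m: "m \<ge> 1"
begin

definition up :: "nat \<Rightarrow> bool" where "up i \<longleftrightarrow> even (c0 + int i)"

definition sg :: "nat \<Rightarrow> int" where "sg i = (if up i then 1 else - 1)"

lemma up_Suc [simp]: "up (Suc i) \<longleftrightarrow> \<not> up i"
  by (simp add: up_def)

lemma sg_Suc: "sg (Suc i) = - sg i"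
  by (simp add: sg_def)

definition qr :: "nat \<Rightarrow> int" where "qr i = 2 * (c0 + int i)"

lemma qr_Suc: "qr (Suc i) = qr i + 2"
  by (simp add: qr_def)

lemma inq_qr:
  "inq (qr i) a b \<longleftrightarrow> (if up i then a > 0 \<and> b \<ge> 0 else a < 0 \<and> b \<le> 0)"
  "inq (qr i + 1) a b \<longleftrightarrow> (if up i then a \<le> 0 \<and> b > 0 else a \<ge> 0 \<and> b < 0)"
  "inq (qr i + 2) a b \<longleftrightarrow> (if up i then a < 0 \<and> b \<le> 0 else a > 0 \<and> b \<ge> 0)"
  "inq (qr i - 1) a b \<longleftrightarrow> (if up i then a \<ge> 0 \<and> b < 0 else a \<le> 0 \<and> b > 0)"
  "inq (qr i - 2) a b \<longleftrightarrow> (if up i then a < 0 \<and> b \<le> 0 else a > 0 \<and> b \<ge> 0)"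
proof -
  have "qr i mod 4 = 0" "(qr i + 1) mod 4 = 1" "(qr i + 2) mod 4 = 2" "(qr i - 1) mod 4 = 3"
    "(qr i - 2) mod 4 = 2" if "up i"
    using that unfolding up_def qr_def by presburger+
  moreover have "qr i mod 4 = 2" "(qr i + 1) mod 4 = 3" "(qr i + 2) mod 4 = 0" "(qr i - 1) mod 4 = 1"
    "(qr i - 2) mod 4 = 0" if "\<not> up i"
    using that unfolding up_def qr_def by presburger+
  ultimately show
    "inq (qr i) a b \<longleftrightarrow> (if up i then a > 0 \<and> b \<ge> 0 else a < 0 \<and> b \<le> 0)"
    "inq (qr i + 1) a b \<longleftrightarrow> (if up i then a \<le> 0 \<and> b > 0 else a \<ge> 0 \<and> b < 0)"
    "inq (qr i + 2) a b \<longleftrightarrow> (if up i then a < 0 \<and> b \<le> 0 else a > 0 \<and> b \<ge> 0)"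
    "inq (qr i - 1) a b \<longleftrightarrow> (if up i then a \<ge> 0 \<and> b < 0 else a \<le> 0 \<and> b > 0)"
    "inq (qr i - 2) a b \<longleftrightarrow> (if up i then a < 0 \<and> b \<le> 0 else a > 0 \<and> b \<ge> 0)"
    unfolding inq_def by (cases "up i"; simp)+
qed

text \<open>Half-plane \<open>i\<close> consists of the quadrants \<open>qr i\<close> and \<open>qr i + 1\<close>; the index \<open>\<eta>\<close> of a row is its
  distance from the axis, and row 0 consists of the two bounding rays, of which the second belongs
  to the next half-plane.\<close>

definition A :: "nat \<Rightarrow> 'c fls fps" where "A i = row (qr i) 0"

definition HR :: "nat \<Rightarrow> nat \<Rightarrow> 'c fls fps" where "HR i \<eta> = row (qr i) (sg i * int \<eta>)"

definition HL :: "nat \<Rightarrow> nat \<Rightarrow> 'c fls fps" where "HL i \<eta> = row (qr i + 1) (sg i * int \<eta>)"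

definition H :: "nat \<Rightarrow> nat \<Rightarrow> 'c fls fps" where
  "H i \<eta> = (if \<eta> = 0 then A i + A (Suc i) else HR i \<eta> + HL i \<eta>)"

abbreviation Pp :: "int \<Rightarrow> 'c fls fps" where "Pp k \<equiv> kpoly (\<lambda>i. w i k)"

definition src :: "nat \<Rightarrow> nat \<Rightarrow> 'c fls fps" where
  "src i \<eta> = fps_const (H i \<eta> $ 0)"

lemma A_ends: "A 0 = 0" "A m = 0"
proof -
  have "f n (qr 0) a 0 = 0" for n a
    by (rule f_zero) (simp add: cell_def lo qr_def)
  moreover have "f n (qr m) a 0 = 0" for n a
    by (rule f_zero) (simp add: cell_def hi qr_def)
  ultimately show "A 0 = 0" "A m = 0" by (auto simp: A_def intro!: fls_fps_eqI)
qed

lemma one_sided_A: "one_sided (up i) 1 (A i)"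
  by (auto simp: one_sided_nth A_def inq_qr intro!: f_zero_inq)

lemma one_sided_HR: "one_sided (up i) 1 (HR i \<eta>)"
  by (auto simp: one_sided_nth HR_def inq_qr intro!: f_zero_inq)

lemma one_sided_HL: "one_sided (\<not> up i) 0 (HL i \<eta>)"
  by (auto simp: one_sided_nth HL_def inq_qr intro!: f_zero_inq)

lemma src_Lpoly: "src i \<eta> \<in> Lpoly"
proof -
  have "H i \<eta> $ 0 $$ a = 0" if "\<bar>a\<bar> > \<bar>p0\<bar>" for a
    using that by (auto simp: H_def A_def HR_def HL_def f_bound)
  then show ?thesis unfolding src_def by (rule fps_const_Lpoly)
qed

lemma src_eq_0: "\<eta> > nat \<bar>q0\<bar> \<Longrightarrow> src i \<eta> = 0"
proof -
  assume "\<eta> > nat \<bar>q0\<bar>"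
  then have "\<bar>sg i * int \<eta>\<bar> > \<bar>q0\<bar>" "\<eta> \<noteq> 0" by (auto simp: sg_def)
  then have "H i \<eta> $ 0 = 0"
    by (intro fls_eqI) (simp add: H_def HR_def HL_def f_bound)
  then show ?thesis by (simp add: src_def)
qed

lemma plane_step:
  assumes "i < m" "\<eta> \<ge> 1"
  shows "H i \<eta> $ Suc n $$ a = (\<Sum>k\<in>{-1,0,1}. w k 0 * H i \<eta> $ n $$ (a - k)
     + w k (sg i) * H i (\<eta> - 1) $ n $$ (a - k) + w k (- sg i) * H i (Suc \<eta>) $ n $$ (a - k))"
proof -
  define h where "h a b = H i (nat (sg i * b)) $ n $$ a" for a b
  define s where "s = qr i"
  have rng: "lo \<le> s" "s + 1 \<le> hi" using assms(1) by (auto simp: s_def qr_def lo hi)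
  have H1: "H i \<eta> $ n $$ a = f n s a (sg i * int \<eta>) + f n (s + 1) a (sg i * int \<eta>)" for n a
    using assms(2) by (simp add: H_def HR_def HL_def s_def)
  have hh: "h a b = (if b = 0 then f n s a 0 + f n (s + 2) a 0 else f n s a b + f n (s + 1) a b)"
    if "sg i * b \<ge> 0" for a b
  proof (cases "b = 0")
    case False
    define e where "e = nat (sg i * b)"
    have "e \<noteq> 0" "sg i * int e = b"
      using that False by (auto simp: e_def sg_def split: if_splits)
    then show ?thesis using False by (simp add: h_def H_def HR_def HL_def s_def flip: e_def)
  qed (simp add: h_def H_def A_def s_def qr_Suc)
  have Z: "f n t x y = 0" if "\<not> inq t x y" for t x y using that by (rule f_zero_inq)
  define b where "b = sg i * int \<eta>"
  have b: "sg i * b \<ge> 1" using assms(2) by (simp add: b_def sg_def)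
  have inner: "(if inq s a b then \<Sum>s'\<in>{s-1,s,s+1}. f n s' (a - k) (b - j)
      else \<Sum>s'\<in>{s,s+1,s+2}. f n s' (a - k) (b - j)) = h (a - k) (b - j)"
    if "k \<in> {-1,0,1}" "j \<in> {-1,0,1}" for k j
  proof -
    have y: "sg i * (b - j) \<ge> 0" using b that by (auto simp: sg_def split: if_splits)
    have "f n (s - 1) (a - k) (b - j) = 0"
      using y by (intro Z) (auto simp: s_def inq_qr sg_def split: if_splits)
    moreover have "f n (s + 1) (a - k) (b - j) = 0" if "b - j = 0"
      using that by (intro Z) (auto simp: s_def inq_qr)
    moreover have "f n (s + 2) (a - k) (b - j) = 0" if "b - j \<noteq> 0 \<or> inq s a b"
      using that y \<open>k \<in> {-1,0,1}\<close> by (intro Z) (auto simp: s_def inq_qr sg_def split: if_splits)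
    ultimately show ?thesis
      unfolding hh[OF y] by (cases "b - j = 0"; cases "inq s a b") simp_all
  qed
  have "f (Suc n) s a b + f (Suc n) (s + 1) a b = (\<Sum>k\<in>{-1,0,1}. \<Sum>j\<in>{-1,0,1}. w k j * h (a - k) (b - j))"
  proof (cases "inq s a b")
    case True
    have "\<not> inq (s + 1) a b" "a \<noteq> 0" "b \<noteq> 0" using True b by (auto simp: s_def inq_qr sg_def split: if_splits)
    then have "f (Suc n) (s + 1) a b = 0" "cell lo hi s a b"
      using True rng by (auto simp: f_zero_inq cell_def)
    then have "f (Suc n) s a b + f (Suc n) (s + 1) a b
        = (\<Sum>i\<in>{-1,0,1}. \<Sum>j\<in>{-1,0,1}. w i j * (\<Sum>s'\<in>{s-1,s,s+1}. f n s' (a - i) (b - j)))"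
      by (simp only: step if_True add_0_right)
    also have "\<dots> = (\<Sum>k\<in>{-1,0,1}. \<Sum>j\<in>{-1,0,1}. w k j * h (a - k) (b - j))"
      using inner True by (intro sum.cong refl) (simp only: if_True)
    finally show ?thesis .
  next
    case False
    have "inq (s + 1) a b" using False b by (auto simp: s_def inq_qr sg_def split: if_splits)
    then have "f (Suc n) s a b = 0" "cell lo hi (s + 1) a b"
      using False rng by (auto simp: f_zero_inq cell_def)
    moreover have "{s + 1 - 1, s + 1, s + 1 + 1} = {s, s + 1, s + 2}" by auto
    ultimately have "f (Suc n) s a b + f (Suc n) (s + 1) a b
        = (\<Sum>i\<in>{-1,0,1}. \<Sum>j\<in>{-1,0,1}. w i j * (\<Sum>s'\<in>{s,s+1,s+2}. f n s' (a - i) (b - j)))"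
      by (simp only: step if_True add_0_left)
    also have "\<dots> = (\<Sum>k\<in>{-1,0,1}. \<Sum>j\<in>{-1,0,1}. w k j * h (a - k) (b - j))"
      using inner False by (intro sum.cong refl) (simp only: if_False)
    finally show ?thesis .
  qed
  moreover have "h x b = H i \<eta> $ n $$ x" "h x (b - sg i) = H i (\<eta> - 1) $ n $$ x"
    "h x (b + sg i) = H i (Suc \<eta>) $ n $$ x" for x
  proof -
    have "sg i * b = int \<eta>" "sg i * (b - sg i) = int (\<eta> - 1)" "sg i * (b + sg i) = int (Suc \<eta>)"
      using assms(2) by (auto simp: b_def sg_def)
    then show "h x b = H i \<eta> $ n $$ x" "h x (b - sg i) = H i (\<eta> - 1) $ n $$ x"
      "h x (b + sg i) = H i (Suc \<eta>) $ n $$ x" unfolding h_def by (simp_all only: nat_int)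
  qed
  ultimately show ?thesis
    unfolding H1 b_def[symmetric] by (cases "up i") (auto simp: sg_def algebra_simps)
qed

lemma ray_step:
  assumes "0 < i" "i < m"
  shows "A i $ Suc n $$ a = (if (if up i then a > 0 else a < 0) then
     (\<Sum>k\<in>{-1,0,1}. w k 0 * A i $ n $$ (a - k)
     + w k (- sg i) * H i 1 $ n $$ (a - k) + w k (sg i) * H (i - 1) 1 $ n $$ (a - k)) else 0)"
proof (cases "if up i then a > 0 else a < 0")
  case True
  define s where "s = qr i"
  have "lo < s" "s \<le> hi" using assms by (auto simp: s_def qr_def lo hi)
  then have cell: "cell lo hi s a 0" using True by (auto simp: cell_def s_def inq_qr)
  have Z: "f n t x y = 0" if "\<not> inq t x y" for t x y using that by (rule f_zero_inq)
  obtain i' where i': "i = Suc i'" using assms by (cases i) auto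
  have qi: "qr (i - 1) = s - 2" "sg (i - 1) = - sg i" by (simp_all add: i' s_def qr_Suc sg_Suc)
  have 0: "(\<Sum>s'\<in>{s-1,s,s+1}. f n s' x 0) = A i $ n $$ x" for x
    by (simp add: A_def s_def inq_qr Z)
  have 1: "(\<Sum>s'\<in>{s-1,s,s+1}. f n s' x (sg i)) = H i 1 $ n $$ x" for x
    by (simp add: H_def HR_def HL_def s_def inq_qr Z sg_def)
  have 2: "(\<Sum>s'\<in>{s-1,s,s+1}. f n s' (a - k) (- sg i)) = H (i - 1) 1 $ n $$ (a - k)" if "k \<in> {-1,0,1}" for k
  proof -
    have "H (i - 1) 1 $ n $$ (a - k) = f n (s - 2) (a - k) (- sg i) + f n (s - 1) (a - k) (- sg i)"
      using qi by (simp add: H_def HR_def HL_def)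
    moreover have "f n (s - 2) (a - k) (- sg i) = 0" "f n s (a - k) (- sg i) = 0" "f n (s + 1) (a - k) (- sg i) = 0"
      using True that by (auto intro!: Z simp: s_def inq_qr sg_def split: if_splits)
    ultimately show ?thesis by simp
  qed
  have "A i $ Suc n $$ a = (\<Sum>k\<in>{-1,0,1}. \<Sum>j\<in>{-1,0,1}. w k j * (\<Sum>s'\<in>{s-1,s,s+1}. f n s' (a - k) (0 - j)))"
    using cell by (simp only: A_def row_nth step s_def[symmetric] if_True)
  also have "\<dots> = (\<Sum>k\<in>{-1,0,1}. w k 0 * A i $ n $$ (a - k)
     + w k (- sg i) * H i 1 $ n $$ (a - k) + w k (sg i) * H (i - 1) 1 $ n $$ (a - k))"
  proof (intro sum.cong refl)
    fix k :: int assume k: "k \<in> {-1,0,1}"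
    have "(\<Sum>j\<in>{-1,0,1}. g j) = g 0 + g (- sg i) + g (sg i)" for g :: "int \<Rightarrow> 'c"
      by (simp add: sg_def)
    then have "(\<Sum>j\<in>{-1,0,1}. w k j * (\<Sum>s'\<in>{s-1,s,s+1}. f n s' (a - k) (0 - j)))
      = w k 0 * (\<Sum>s'\<in>{s-1,s,s+1}. f n s' (a - k) (0 - 0))
       + w k (- sg i) * (\<Sum>s'\<in>{s-1,s,s+1}. f n s' (a - k) (0 - - sg i))
       + w k (sg i) * (\<Sum>s'\<in>{s-1,s,s+1}. f n s' (a - k) (0 - sg i))" by blast
    then show "(\<Sum>j\<in>{-1,0,1}. w k j * (\<Sum>s'\<in>{s-1,s,s+1}. f n s' (a - k) (0 - j)))
      = w k 0 * A i $ n $$ (a - k) + w k (- sg i) * H i 1 $ n $$ (a - k)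
        + w k (sg i) * H (i - 1) 1 $ n $$ (a - k)"
      using 0 1 2[OF k] by (simp only: diff_0 diff_zero minus_minus)
  qed
  finally show ?thesis using True by simp
next
  case False
  then have "\<not> inq (qr i) a 0" by (auto simp: inq_qr split: if_splits)
  then show ?thesis using False by (simp add: A_def f_zero_inq)
qed

lemma plane_kernel:
  assumes "i < m" "\<eta> \<ge> 1"
  shows "(1 - fps_X * Pp 0) * H i \<eta> = src i \<eta> + fps_X * Pp (sg i) * H i (\<eta> - 1)
    + fps_X * Pp (- sg i) * H i (Suc \<eta>)"
proof -
  have "H i \<eta> = src i \<eta> + fps_X * (Pp 0 * H i \<eta> + Pp (sg i) * H i (\<eta> - 1) + Pp (- sg i) * H i (Suc \<eta>))"
  proof (rule fls_fps_eqI)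
    fix n a
    show "H i \<eta> $ n $$ a = (src i \<eta> + fps_X * (Pp 0 * H i \<eta> + Pp (sg i) * H i (\<eta> - 1)
        + Pp (- sg i) * H i (Suc \<eta>))) $ n $$ a"
    proof (cases n)
      case (Suc k)
      then show ?thesis using plane_step[OF assms, of k a] by (simp add: src_def add_ac)
    qed (simp add: src_def)
  qed
  then show ?thesis by (simp add: algebra_simps)
qed

lemma ray_kernel:
  assumes "0 < i" "i < m"
  shows "A i = fps_const (A i $ 0) + side_part (up i) (fps_X * Pp 0 * A i)
    + side_part (up i) (fps_X * Pp (- sg i) * H i 1) + side_part (up i) (fps_X * Pp (sg i) * H (i - 1) 1)"
proof (rule fls_fps_eqI)
  fix n a
  show "A i $ n $$ a = (fps_const (A i $ 0) + side_part (up i) (fps_X * Pp 0 * A i)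
    + side_part (up i) (fps_X * Pp (- sg i) * H i 1)
    + side_part (up i) (fps_X * Pp (sg i) * H (i - 1) 1)) $ n $$ a"
  proof (cases n)
    case (Suc k)
    then show ?thesis using ray_step[OF assms, of k a] by (simp add: mult.assoc add_ac)
  qed (simp add: mult.assoc)
qed

subsection \<open>Rows are D-finite\<close>

lemma Pp_nonzero: "Pp 1 \<noteq> 0" "Pp (- 1) \<noteq> 0" "Pp (sg i) \<noteq> 0" "Pp (- sg i) \<noteq> 0"
proof -
  show *: "Pp 1 \<noteq> 0" "Pp (- 1) \<noteq> 0"
    using weights kpoly_nonzero[of _ "\<lambda>i. w i 1"] kpoly_nonzero[of _ "\<lambda>i. w i (- 1)"] by blast+
  show "Pp (sg i) \<noteq> 0" "Pp (- sg i) \<noteq> 0" using * by (auto simp: sg_def)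
qed

definition \<rho> :: "'c fls fps" where
  "\<rho> = (SOME \<rho>. \<rho> * \<rho> = (1 - fps_X * Pp 0) * (1 - fps_X * Pp 0) - 4 * (fps_X * Pp 1) * (fps_X * Pp (- 1))
     \<and> \<rho> $ 0 = 1)"

lemma rho: "\<rho> * \<rho> = (1 - fps_X * Pp 0) * (1 - fps_X * Pp 0) - 4 * (fps_X * Pp 1) * (fps_X * Pp (- 1))"
    "\<rho> $ 0 = 1"
proof -
  have "\<exists>\<rho>. \<rho> * \<rho> = (1 - fps_X * Pp 0) * (1 - fps_X * Pp 0) - 4 * (fps_X * Pp 1) * (fps_X * Pp (- 1))
     \<and> \<rho> $ 0 = 1"
    by (rule exists_square_root) (simp add: mult.assoc)
  from someI_ex[OF this] show
    "\<rho> * \<rho> = (1 - fps_X * Pp 0) * (1 - fps_X * Pp 0) - 4 * (fps_X * Pp 1) * (fps_X * Pp (- 1))"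
    "\<rho> $ 0 = 1" unfolding \<rho>_def by blast+
qed

sublocale square_root \<rho>
proof
  show "\<rho> * \<rho> \<in> Lpoly"
    unfolding rho by (intro Lpoly_diff Lpoly_mult Lpoly_1 Lpoly_fps_X Lpoly_numeral kpoly_Lpoly)
qed (rule rho)

lemma half_plane:
  assumes "i < m"
  shows "half_plane \<rho> (Pp 0) (Pp (sg i)) (Pp (- sg i)) (H i) (src i) (nat \<bar>q0\<bar>)"
proof
  show "\<rho> * \<rho> = (1 - fps_X * Pp 0) * (1 - fps_X * Pp 0) - 4 * (fps_X * Pp (sg i)) * (fps_X * Pp (- sg i))"
    unfolding rho by (cases "up i") (simp_all add: sg_def mult_ac)
qed (use assms plane_kernel src_Lpoly src_eq_0 kpoly_Lpoly Pp_nonzero in auto)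

text \<open>\<open>X i\<close> describes the steps of half-plane \<open>i\<close> onto its boundary line, of which \<open>Bp i\<close> and
  \<open>Bm (i + 1)\<close> are the parts landing on the rays \<open>i\<close> and \<open>i + 1\<close>.  The missing constant term is
  the loss at the origin.  The values of \<open>D\<close> at the ends agree with \<open>Bp i - Bm i\<close> for the
  convention \<open>Bp i + Bm i = 0\<close> on the killing rays.\<close>

definition X :: "nat \<Rightarrow> 'c fls fps" where "X i = fps_X * Pp (- sg i) * H i 1"

definition Bp :: "nat \<Rightarrow> 'c fls fps" where "Bp i = side_part (up i) (X i)"

definition Bm :: "nat \<Rightarrow> 'c fls fps" where "Bm i = side_part (up i) (X (i - 1))"

definition D :: "nat \<Rightarrow> 'c fls fps" where
  "D i = (if i = 0 then 2 * Bp 0 else if i = m then - (2 * Bm m) else Bp i - Bm i)"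

lemma X_split: "band 0 (X i - (Bp i + Bm (Suc i)))"
  using band_side_parts[of "X i" "up i"] by (simp add: Bp_def Bm_def)

lemma numeral_one_sided: "one_sided pos r F \<Longrightarrow> one_sided pos r (numeral k * F)"
  by (auto simp: one_sided_def numeral_eq_lift_const intro: supp_ge_lift_const_mult supp_le_lift_const_mult
      split: if_splits)

lemma one_sided_D: "i \<le> m \<Longrightarrow> one_sided (up i) 1 (D i)"
proof -
  have B: "one_sided (up i) 1 (Bp i)" "one_sided (up i) 1 (Bm i)" for i
    by (simp_all add: Bp_def Bm_def one_sided_side_part)
  have neg: "one_sided pos 1 F \<Longrightarrow> one_sided pos 1 (- F)" for pos F
    by (auto simp: one_sided_def intro: supp_ge_minus supp_le_minus split: if_splits)
  show ?thesis
    using B by (auto simp: D_def intro: one_sided_diff numeral_one_sided neg)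
qed

lemma flow:
  assumes "i \<le> m"
  shows "\<exists>z\<in>Lpoly. (i < m \<longrightarrow> 2 * Bp i = (1 - fps_X * Pp 0) * A i + z + D i)
    \<and> (i > 0 \<longrightarrow> 2 * Bm i = (1 - fps_X * Pp 0) * A i + z - D i)"
proof -
  consider "i = 0" | "i = m" "i > 0" | "0 < i" "i < m" using assms by linarith
  then show ?thesis
  proof cases
    case 1
    then show ?thesis using A_ends m by (intro bexI[of _ 0]) (auto simp: D_def)
  next
    case 2
    then show ?thesis using A_ends by (intro bexI[of _ 0]) (auto simp: D_def)
  next
    case 3
    define \<kappa> where "\<kappa> = fps_X * Pp 0 * A i - side_part (up i) (fps_X * Pp 0 * A i)"
    have "one_sided (up i) 0 (fps_X * Pp 0 * A i)"
    proof -
      have "band 1 (fps_X * Pp 0)"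
        by (rule band_fps_X_mult[OF band_kpoly])
      from one_sided_band_mult[OF this one_sided_A] show ?thesis by simp
    qed
    then have \<kappa>: "\<kappa> \<in> Lpoly"
      unfolding \<kappa>_def using band_side_part by (auto simp: Lpoly_def)
    have s: "fps_const (A i $ 0) \<in> Lpoly"
      by (rule fps_const_Lpoly[of "\<bar>p0\<bar>"]) (simp add: A_def f_bound)
    have "sg (i - 1) = - sg i" using sg_Suc[of "i - 1"] 3 by simp
    then have "A i = fps_const (A i $ 0) + side_part (up i) (fps_X * Pp 0 * A i) + Bp i + Bm i"
      using ray_kernel[OF 3] by (simp add: Bp_def Bm_def X_def)
    then have "(1 - fps_X * Pp 0) * A i = fps_const (A i $ 0) - \<kappa> + Bp i + Bm i"
      by (simp add: \<kappa>_def algebra_simps)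
    then show ?thesis
      using 3 \<kappa> s by (intro bexI[of _ "\<kappa> - fps_const (A i $ 0)"]) (auto simp: D_def algebra_simps)
  qed
qed

lemma chain:
  assumes "i < m"
  shows "\<exists>s. alg s \<and> D (Suc i) - D i = \<rho> * (A i + A (Suc i)) + s"
proof -
  interpret hp: half_plane \<rho> "Pp 0" "Pp (sg i)" "Pp (- sg i)" "H i" "src i" "nat \<bar>q0\<bar>"
    by (rule half_plane[OF assms])
  obtain z where z: "z \<in> Lpoly" "2 * Bp i = (1 - fps_X * Pp 0) * A i + z + D i"
    using flow[of i] assms by auto
  obtain z' where z': "z' \<in> Lpoly" "2 * Bm (Suc i) = (1 - fps_X * Pp 0) * A (Suc i) + z' - D (Suc i)"
    using flow[of "Suc i"] assms by auto
  define k where "k = X i - (Bp i + Bm (Suc i))"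
  have k: "k \<in> Lpoly" using X_split by (auto simp: k_def Lpoly_def)
  define E where "E = 2 * hp.\<mu> * hp.e 1"
  have "2 * X i = (1 - fps_X * Pp 0 - \<rho>) * (A i + A (Suc i)) + E"
    using hp.first_row by (simp add: X_def H_def E_def mult.assoc)
  then have "(1 - fps_X * Pp 0 - \<rho>) * (A i + A (Suc i)) + E = 2 * Bp i + 2 * Bm (Suc i) + 2 * k"
    by (simp add: k_def algebra_simps)
  then have "D (Suc i) - D i = \<rho> * (A i + A (Suc i)) + (z + z' + 2 * k - E)"
    unfolding z z' by (simp add: algebra_simps)
  moreover have "alg (z + z' + 2 * k - E)"
    unfolding E_def by (intro alg_diff hp.alg_mu_e alg_Lpoly Lpoly_add Lpoly_mult z z' k Lpoly_numeral)
  ultimately show ?thesis by blast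
qed

lemma dfin_A_D:
  assumes "i \<le> m"
  shows "dfin (A i) \<and> dfin (D i)"
proof -
  obtain s where s: "\<And>i. i < m \<Longrightarrow> alg (s i) \<and> D (Suc i) - D i = \<rho> * (A i + A (Suc i)) + s i"
    using chain by metis
  have up: "(even i = even c0) = up i" for i by (auto simp: up_def)
  show ?thesis
    by (rule chain_dfin[where m = m and s = s and par = "even c0"])
      (use m A_ends s one_sided_A one_sided_D assms in \<open>auto simp: up\<close>)
qed

lemma dfin_numeral_cancel: "dfin (numeral k * F) \<Longrightarrow> dfin F"
  by (rule dfin_cancel) auto

lemma dfin_Bp: "i < m \<Longrightarrow> dfin (Bp i)" and dfin_Bm: "0 < i \<Longrightarrow> i \<le> m \<Longrightarrow> dfin (Bm i)"
proof -
  have E: "dfin ((1 - fps_X * Pp 0) * A i)" if "i \<le> m" for i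
    using dfin_A_D[OF that] by (intro dfin_Lpoly_mult Lpoly_diff Lpoly_mult kpoly_Lpoly) auto
  show "dfin (Bp i)" if i: "i < m"
  proof -
    obtain z where "z \<in> Lpoly" "2 * Bp i = (1 - fps_X * Pp 0) * A i + z + D i"
      using flow[of i] i by auto
    then have "dfin (2 * Bp i)"
      using E[of i] dfin_A_D[of i] i by (simp add: dfin_add dfin_Lpoly)
    then show ?thesis by (rule dfin_numeral_cancel)
  qed
  show "dfin (Bm i)" if i: "0 < i" "i \<le> m"
  proof -
    obtain z where "z \<in> Lpoly" "2 * Bm i = (1 - fps_X * Pp 0) * A i + z - D i"
      using flow[of i] i by auto
    then have "dfin (2 * Bm i)"
      using E[of i] dfin_A_D[of i] i by (simp add: dfin_add dfin_diff dfin_Lpoly)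
    then show ?thesis by (rule dfin_numeral_cancel)
  qed
qed

lemma dfin_first_half_rows:
  assumes "i < m"
  shows "dfin (HR i 1)" "dfin (HL i 1)"
proof -
  define k where "k = X i - (Bp i + Bm (Suc i))"
  have k: "one_sided pos (- 1) k" for pos
    using one_sided_band[OF X_split] unfolding k_def by (rule one_sided_mono) simp
  define P where "P = fps_X * Pp (- sg i)"
  have P: "P \<in> Lpoly" "P \<noteq> 0" "band 1 P"
    using Pp_nonzero kpoly_Lpoly by (auto simp: P_def intro: band_fps_X_mult band_kpoly)
  have "X i = P * HR i 1 + P * HL i 1" by (simp add: X_def P_def H_def algebra_simps)
  then have eq: "P * HR i 1 - Bp i = Bm (Suc i) + k - P * HL i 1"
    by (simp add: k_def algebra_simps)
  have 1: "one_sided (up i) (- 1) (P * HR i 1 - Bp i)"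
    using one_sided_band_mult[OF P(3) one_sided_HR, of i 1] one_sided_side_part[of "up i" "X i"]
    by (auto simp: Bp_def intro!: one_sided_diff intro: one_sided_mono)
  have 2: "one_sided (\<not> up i) (- 1) (Bm (Suc i) + k - P * HL i 1)"
    using one_sided_band_mult[OF P(3) one_sided_HL, of i 1] one_sided_side_part[of "\<not> up i" "X i"] k
    by (auto simp: Bm_def intro!: one_sided_diff one_sided_add intro: one_sided_mono)
  have L: "P * HR i 1 - Bp i \<in> Lpoly"
    using one_sided_both[OF 1 2[folded eq]] by (auto simp: Lpoly_def)
  have "dfin (P * HR i 1)"
    using dfin_add[OF dfin_Lpoly[OF L] dfin_Bp[OF assms]] by simp
  then show "dfin (HR i 1)" by (rule dfin_cancel[OF _ P(1,2)])
  have "P * HL i 1 = Bm (Suc i) + k - (P * HR i 1 - Bp i)" using eq by simp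
  moreover have "k \<in> Lpoly" using X_split unfolding k_def by (auto simp: Lpoly_def)
  moreover have "dfin (Bm (Suc i))" using assms by (intro dfin_Bm) auto
  ultimately have "dfin (P * HL i 1)"
    using dfin_diff[OF dfin_add[OF _ dfin_Lpoly] dfin_Lpoly[OF L]] by metis
  then show "dfin (HL i 1)" by (rule dfin_cancel[OF _ P(1,2)])
qed

lemma dfin_second_half_rows:
  assumes "i < m"
  shows "dfin (HR i 2)" "dfin (HL i 2)"
proof -
  define Pf Pb C where "Pf = fps_X * Pp (sg i)" and "Pb = fps_X * Pp (- sg i)" and "C = 1 - fps_X * Pp 0"
  have Pf: "Pf \<in> Lpoly" "band 1 Pf" and Pb: "Pb \<in> Lpoly" "Pb \<noteq> 0" "band 1 Pb" and C: "C \<in> Lpoly" "band 1 C"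
  proof -
    show "C \<in> Lpoly" unfolding C_def by (intro Lpoly_diff Lpoly_mult kpoly_Lpoly) auto
  qed (use Pp_nonzero kpoly_Lpoly in
      \<open>auto simp: Pf_def Pb_def C_def intro: band_fps_X_mult band_kpoly intro!: band_diff band_1\<close>)
  obtain B where B: "B \<ge> 1" "band B (src i 1)"
  proof -
    obtain B where "band B (src i 1)" using src_Lpoly by (auto simp: Lpoly_def)
    then show ?thesis by (intro that[of "max 1 B"]) (auto intro: band_mono)
  qed
  define GR where "GR = C * HR i 1 - Pf * A i - Pb * HR i 2"
  define GL where "GL = C * HL i 1 - Pf * A (Suc i) - Pb * HL i 2"
  have eq: "GR = src i 1 - GL"
    using plane_kernel[OF assms, of 1]
    by (simp add: H_def GR_def GL_def C_def Pf_def Pb_def numeral_2_eq_2 algebra_simps)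
  have 1: "one_sided (up i) (- B) GR"
    using one_sided_band_mult[OF C(2) one_sided_HR, of i 1] one_sided_band_mult[OF Pf(2) one_sided_A, of i]
      one_sided_band_mult[OF Pb(3) one_sided_HR, of i 2] B
    unfolding GR_def by (intro one_sided_diff) (erule one_sided_mono; simp)+
  have 2: "one_sided (\<not> up i) (- B) GL"
    using one_sided_band_mult[OF C(2) one_sided_HL, of i 1]
      one_sided_band_mult[OF Pf(2) one_sided_A, of "Suc i", unfolded up_Suc]
      one_sided_band_mult[OF Pb(3) one_sided_HL, of i 2] B
    unfolding GL_def by (intro one_sided_diff) (erule one_sided_mono; simp)+
  have "one_sided (\<not> up i) (- B) GR"
    unfolding eq by (intro one_sided_diff one_sided_band B 2)
  then have GR: "GR \<in> Lpoly" using one_sided_both[OF 1] by (auto simp: Lpoly_def)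
  then have GL: "GL \<in> Lpoly" using eq src_Lpoly[of i 1] by (metis Lpoly_diff diff_diff_eq2 add_diff_cancel_left')
  have A: "dfin (A i)" "dfin (A (Suc i))" using dfin_A_D assms by auto
  have "dfin (C * HR i 1 - Pf * A i - GR)"
    by (intro dfin_diff dfin_Lpoly_mult C Pf A dfin_Lpoly[OF GR] dfin_first_half_rows assms)
  then have "dfin (Pb * HR i 2)" by (simp add: GR_def)
  then show "dfin (HR i 2)" by (rule dfin_cancel[OF _ Pb(1,2)])
  have "dfin (C * HL i 1 - Pf * A (Suc i) - GL)"
    by (intro dfin_diff dfin_Lpoly_mult C Pf A dfin_Lpoly[OF GL] dfin_first_half_rows assms)
  then have "dfin (Pb * HL i 2)" by (simp add: GL_def)
  then show "dfin (HL i 2)" by (rule dfin_cancel[OF _ Pb(1,2)])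
qed

lemma quadrant_cases:
  obtains "s < lo \<or> hi < s" | i where "i < m" "s = qr i" | i where "i < m" "s = qr i + 1"
proof (cases "s < lo \<or> hi < s")
  case False
  define i where "i = nat (s div 2 - c0)"
  have "i < m" "s = qr i \<or> s = qr i + 1"
    using False unfolding i_def lo hi qr_def by auto
  then show ?thesis using that by blast
qed (use that in blast)

theorem dfin_row:
  assumes "\<bar>b\<bar> \<le> 2"
  shows "dfin (row s b)"
proof -
  have sgb: "b = sg i * e" if "sg i * b = e" for i e
    using that by (auto simp: sg_def split: if_splits)
  show ?thesis
  proof (cases s rule: quadrant_cases)
    case 1
    then have "row s b = 0" by (intro fls_fps_eqI) (auto intro!: f_zero simp: cell_def)
    then show ?thesis by simp
  next
    case (2 i)
    have "row s b = 0" if "sg i * b < 0"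
      using that 2 by (intro fls_fps_eqI) (auto intro!: f_zero_inq simp: inq_qr sg_def split: if_splits)
    moreover have "row s b = A i" if "b = 0" using that 2 by (simp add: A_def)
    moreover have "row s b = HR i 1" if "sg i * b = 1"
      using sgb[OF that] 2 by (simp add: HR_def)
    moreover have "row s b = HR i 2" if "sg i * b = 2"
      using sgb[OF that] 2 by (simp add: HR_def)
    moreover have "sg i * b < 0 \<or> b = 0 \<or> sg i * b = 1 \<or> sg i * b = 2"
      using assms by (auto simp: sg_def)
    ultimately show ?thesis
      using 2 dfin_A_D[of i] dfin_first_half_rows[of i] dfin_second_half_rows[of i] by auto
  next
    case (3 i)
    have "row s b = 0" if "sg i * b \<le> 0"
      using that 3 by (intro fls_fps_eqI) (auto intro!: f_zero_inq simp: inq_qr sg_def split: if_splits)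
    moreover have "row s b = HL i 1" if "sg i * b = 1"
      using sgb[OF that] 3 by (simp add: HL_def)
    moreover have "row s b = HL i 2" if "sg i * b = 2"
      using sgb[OF that] 3 by (simp add: HL_def)
    moreover have "sg i * b \<le> 0 \<or> sg i * b = 1 \<or> sg i * b = 2"
      using assms by (auto simp: sg_def)
    ultimately show ?thesis
      using 3 dfin_first_half_rows[of i] dfin_second_half_rows[of i] by auto
  qed
qed

subsection \<open>Columns are D-finite\<close>

definition hc :: "nat \<Rightarrow> int \<Rightarrow> 'c fls fps" where
  "hc i a = series_of (\<lambda>n b. if b \<ge> 1 then H i (nat b) $ n $$ a else 0)"

lemma hc_nth [simp]: "hc i a $ n $$ b = (if b \<ge> 1 then H i (nat b) $ n $$ a else 0)"
  unfolding hc_def by (rule series_of_nth) (auto intro!: exI[of _ 0])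

lemma H_nth: "\<eta> \<ge> 1 \<Longrightarrow> H i \<eta> $ n $$ a = f n (qr i) a (sg i * int \<eta>) + f n (qr i + 1) a (sg i * int \<eta>)"
  by (simp add: H_def HR_def HL_def)

lemma H_beyond:
  assumes "int \<eta> > \<bar>q0\<bar> + int n"
  shows "H i \<eta> $ n $$ a = 0"
proof -
  have "\<bar>sg i * int \<eta>\<bar> > \<bar>q0\<bar> + int n" using assms by (simp add: sg_def)
  then show ?thesis using assms by (subst H_nth) (auto simp: f_bound)
qed

lemma hc_kernel:
  assumes "i < m"
  shows "hc i a - fps_X * (\<Sum>k\<in>{-1,0,1}. kpoly (\<lambda>j. w k (sg i * j)) * hc i (a - k)) \<in> Lpoly"
proof (rule Lpoly_bounded[of "\<bar>q0\<bar> + 2"])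
  fix n and b :: int
  assume b: "\<bar>q0\<bar> + 2 < \<bar>b\<bar>"
  define R where "R = (\<Sum>k\<in>{-1,0,1}. kpoly (\<lambda>j. w k (sg i * j)) * hc i (a - k))"
  have R: "R $ n $$ b = (\<Sum>k\<in>{-1,0,1}. \<Sum>j\<in>{-1,0,1}. w k (sg i * j) * hc i (a - k) $ n $$ (b - j))" for n
    unfolding R_def fps_sum_nth fls_sum_nth kpoly_mult_nth ..
  have "hc i a $ n $$ b = (fps_X * R) $ n $$ b"
  proof (cases "b < 0")
    case True
    then have "R $ n $$ b = 0" for n unfolding R using b by simp
    then show ?thesis using True by simp
  next
    case False
    define \<eta> where "\<eta> = nat b"
    have \<eta>: "b = int \<eta>" "\<eta> \<ge> 2" "\<eta> > nat \<bar>q0\<bar>" using b False by (auto simp: \<eta>_def)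
    show ?thesis
    proof (cases n)
      case 0
      have "H i \<eta> $ 0 $$ a = 0" by (rule H_beyond) (use \<eta> in simp)
      then show ?thesis using \<eta> 0 by simp
    next
      case (Suc n')
      have "int \<eta> - 1 = int (\<eta> - 1)" "int \<eta> + 1 = int (Suc \<eta>)" using \<eta> by auto
      then have nth: "hc i x $ n' $$ int \<eta> = H i \<eta> $ n' $$ x" "hc i x $ n' $$ (int \<eta> - 1) = H i (\<eta> - 1) $ n' $$ x"
        "hc i x $ n' $$ (int \<eta> + 1) = H i (Suc \<eta>) $ n' $$ x" for x
        using \<eta>(2) by (simp_all only: hc_nth nat_int) auto
      have "R $ n' $$ b = H i \<eta> $ Suc n' $$ a"
        unfolding R plane_step[OF assms, of \<eta> n' a, OF order_trans[OF one_le_numeral \<eta>(2)]]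
      proof (intro sum.cong refl)
        fix k
        have "(\<Sum>j\<in>{-1,0,1}. w k (sg i * j) * hc i (a - k) $ n' $$ (b - j))
          = w k (- sg i) * hc i (a - k) $ n' $$ (int \<eta> + 1) + (w k 0 * hc i (a - k) $ n' $$ int \<eta>
            + w k (sg i) * hc i (a - k) $ n' $$ (int \<eta> - 1))"
          by (simp add: \<eta>(1) del: hc_nth)
        then show "(\<Sum>j\<in>{-1,0,1}. w k (sg i * j) * hc i (a - k) $ n' $$ (b - j))
          = w k 0 * H i \<eta> $ n' $$ (a - k) + w k (sg i) * H i (\<eta> - 1) $ n' $$ (a - k)
            + w k (- sg i) * H i (Suc \<eta>) $ n' $$ (a - k)"
          unfolding nth by (simp only: add_ac)
      qed
      then show ?thesis using \<eta> Suc by simp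
    qed
  qed
  then show "(hc i a - fps_X * (\<Sum>k\<in>{-1,0,1}. kpoly (\<lambda>j. w k (sg i * j)) * hc i (a - k))) $ n $$ b = 0"
    unfolding R_def[symmetric] by simp
qed

lemma dfin_hc:
  assumes "i < m"
  shows "dfin (hc i a)"
proof -
  interpret hp: half_plane \<rho> "Pp 0" "Pp (sg i)" "Pp (- sg i)" "H i" "src i" "nat \<bar>q0\<bar>"
    by (rule half_plane[OF assms])
  have "dfin (H i 0)"
    using dfin_A_D[of i] dfin_A_D[of "Suc i"] assms by (simp add: H_def dfin_add)
  from hp.dfin_columns[OF this] obtain a0 where a0: "\<And>a Y. a \<ge> a0 \<Longrightarrow>
      (\<And>b. xcoeff Y b = (if b \<ge> 1 then xcoeff (H i (nat b)) a else 0)) \<Longrightarrow> dfin Y"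
    by blast
  have hc: "dfin (hc i a)" if "a \<ge> a0" for a
    by (rule a0[OF that], rule fps_ext) simp
  define K where "K k = kpoly (\<lambda>j. w k (sg i * j))" for k
  have KL: "K k \<in> Lpoly" for k by (simp add: K_def kpoly_Lpoly)
  obtain j where j: "j \<in> {-1,0,1}" "w 1 j \<noteq> 0" using weights by blast
  have "w 1 (sg i * (sg i * j)) \<noteq> 0" "sg i * j \<in> {-1,0,1}" using j by (auto simp: sg_def)
  then have K1: "K 1 \<noteq> 0"
    unfolding K_def by (intro kpoly_nonzero[where c = "\<lambda>j. w 1 (sg i * j)" and i = "sg i * j"])
  have down: "dfin (hc i (a - 1))" if "dfin (hc i a)" "dfin (hc i (a + 1))" for a
  proof -
    define R where "R = hc i a - fps_X * (\<Sum>k\<in>{-1,0,1}. K k * hc i (a - k))"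
    have R: "R \<in> Lpoly" using hc_kernel[OF assms, of a] by (simp only: R_def K_def)
    have "(fps_X * K 1) * hc i (a - 1)
        = hc i a - fps_X * K 0 * hc i a - fps_X * K (- 1) * hc i (a + 1) - R"
      by (simp add: R_def algebra_simps)
    moreover have "dfin (hc i a - fps_X * K 0 * hc i a - fps_X * K (- 1) * hc i (a + 1) - R)"
      by (intro dfin_diff dfin_Lpoly_mult Lpoly_mult that KL Lpoly_fps_X dfin_Lpoly[OF R])
    ultimately have "dfin ((fps_X * K 1) * hc i (a - 1))" by metis
    then show ?thesis
      by (rule dfin_cancel) (use K1 KL in auto)
  qed
  have "dfin (hc i a) \<and> dfin (hc i (a + 1))" if "a \<le> a0" for a
    using that by (induction a rule: int_le_induct) (use hc down in \<open>auto\<close>)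
  then show ?thesis using hc by (cases "a \<le> a0") auto
qed

theorem dfin_col: "dfin (col s a)"
proof -
  have side: "dfin (col s a)"
    if i: "i < m" and s: "s = qr i \<or> s = qr i + 1"
      and other: "\<And>n b. sg i * b \<ge> 1 \<Longrightarrow> H i (nat (sg i * b)) $ n $$ a = f n s a b" for i
  proof -
    define Z where "Z = series_of (\<lambda>n b. hc i a $ n $$ (sg i * b))"
    have Z: "Z $ n $$ b = hc i a $ n $$ (sg i * b)" for n b
      unfolding Z_def
    proof (rule series_of_nth)
      fix n
      have "hc i a $ n $$ (sg i * b) = 0" if "b < - \<bar>q0\<bar> - int n" for b
        using that by (auto simp: sg_def intro!: H_beyond)
      then show "\<exists>N. \<forall>b<N. hc i a $ n $$ (sg i * b) = 0" by blast
    qed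
    have "dfin Z"
    proof (cases "up i")
      case True
      then have "Z = hc i a" by (intro fls_fps_eqI) (simp only: Z sg_def if_True mult_1)
      then show ?thesis using dfin_hc[OF i] by simp
    next
      case False
      show ?thesis
        by (rule dfin_reflect[OF dfin_hc[OF i, of a]]) (simp only: Z sg_def False if_False mult_minus1)
    qed
    moreover have "col s a - Z \<in> Lpoly"
    proof (rule Lpoly_bounded[of 0])
      fix n and b :: int
      assume "0 < \<bar>b\<bar>"
      then have "sg i * b \<ge> 1 \<or> sg i * b < 0" by (cases "up i") (auto simp: sg_def)
      then consider "sg i * b \<ge> 1" | "sg i * b < 0" by blast
      then show "(col s a - Z) $ n $$ b = 0"
      proof cases
        case 1
        then show ?thesis using other[OF 1] by (simp add: Z)
      next
        case 2
        then have "f n s a b = 0"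
          using s by (intro f_zero_inq) (auto simp: inq_qr sg_def split: if_splits)
        then show ?thesis using 2 by (simp add: Z)
      qed
    qed
    ultimately show ?thesis using dfin_add[OF dfin_Lpoly, of "col s a - Z" Z] by simp
  qed
  have split: "H i (nat (sg i * b)) $ n $$ a = f n (qr i) a b + f n (qr i + 1) a b" if "sg i * b \<ge> 1" for i n b
  proof -
    define e where "e = nat (sg i * b)"
    have "e \<ge> 1" "sg i * int e = b" using that by (auto simp: e_def sg_def split: if_splits)
    then show ?thesis using H_nth[of e i n a] by (simp add: e_def)
  qed
  show ?thesis
  proof (cases s rule: quadrant_cases)
    case 1
    then have "col s a = 0" by (intro fls_fps_eqI) (auto intro!: f_zero simp: cell_def)
    then show ?thesis by simp
  next
    case (2 i)
    show ?thesis
    proof (cases "if up i then a > 0 else a < 0")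
      case True
      then have "f n (qr i + 1) a b = 0" for n b by (intro f_zero_inq) (auto simp: inq_qr split: if_splits)
      then show ?thesis using side[of i] split[of i] 2 by simp
    next
      case False
      then have "col s a = 0"
        using 2 by (intro fls_fps_eqI) (auto intro!: f_zero_inq simp: inq_qr split: if_splits)
      then show ?thesis by simp
    qed
  next
    case (3 i)
    show ?thesis
    proof (cases "if up i then a \<le> 0 else a \<ge> 0")
      case True
      then have "f n (qr i) a b = 0" for n b by (intro f_zero_inq) (auto simp: inq_qr split: if_splits)
      then show ?thesis using side[of i] split[of i] 3 by simp
    next
      case False
      then have "col s a = 0"
        using 3 by (intro fls_fps_eqI) (auto intro!: f_zero_inq simp: inq_qr split: if_splits)
      then show ?thesis by simp
    qed
  qed
qed

end


section \<open>All cones with an even number of quadrants\<close>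

lemma inq_rotate: "inq s a b \<longleftrightarrow> inq (s - 1) b (- a)"
proof -
  have "s mod 4 = 0 \<and> (s - 1) mod 4 = 3 \<or> s mod 4 = 1 \<and> (s - 1) mod 4 = 0
      \<or> s mod 4 = 2 \<and> (s - 1) mod 4 = 1 \<or> s mod 4 = 3 \<and> (s - 1) mod 4 = 2"
    by presburger
  then show ?thesis unfolding inq_def by auto
qed

lemma cell_rotate: "cell (lo + 1) (hi + 1) s a b \<longleftrightarrow> cell lo hi (s - 1) b (- a)"
  unfolding cell_def inq_rotate[of s] by auto

lemma inq_unique:
  assumes "inq s a b" "inq t a b" "\<bar>s - t\<bar> \<le> 1"
  shows "s = t"
proof (rule ccontr)
  assume "s \<noteq> t"
  then have "t = s + 1 \<or> t = s - 1" using assms(3) by auto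
  moreover have "s mod 4 = 0 \<and> (s + 1) mod 4 = 1 \<or> s mod 4 = 1 \<and> (s + 1) mod 4 = 2
      \<or> s mod 4 = 2 \<and> (s + 1) mod 4 = 3 \<or> s mod 4 = 3 \<and> (s + 1) mod 4 = 0"
    by presburger
  moreover have "s mod 4 = 0 \<and> (s - 1) mod 4 = 3 \<or> s mod 4 = 1 \<and> (s - 1) mod 4 = 0
      \<or> s mod 4 = 2 \<and> (s - 1) mod 4 = 1 \<or> s mod 4 = 3 \<and> (s - 1) mod 4 = 2"
    by presburger
  ultimately show False using assms(1,2) unfolding inq_def by auto
qed

lemma inq_neighbour:
  assumes "\<bar>a\<bar> \<ge> 2" "\<bar>b\<bar> \<ge> 2" "i \<in> {-1,0,1}" "j \<in> {-1,0,1}"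
  shows "inq s (a - i) (b - j) \<longleftrightarrow> inq s a b"
proof -
  have "0 < a - i \<longleftrightarrow> 0 < a" "a - i < 0 \<longleftrightarrow> a < 0" "a - i \<le> 0 \<longleftrightarrow> a \<le> 0" "0 \<le> a - i \<longleftrightarrow> 0 \<le> a"
    "0 < b - j \<longleftrightarrow> 0 < b" "b - j < 0 \<longleftrightarrow> b < 0" "b - j \<le> 0 \<longleftrightarrow> b \<le> 0" "0 \<le> b - j \<longleftrightarrow> 0 \<le> b"
    using assms by auto
  then show ?thesis unfolding inq_def by (simp only:)
qed

context walk_array
begin

lemma rotated:
  "walk_array (\<lambda>i j. w j (- i)) (lo + 1) (hi + 1) (\<lambda>n s a b. f n (s - 1) b (- a)) (s0 + 1) (- q0) p0"
proof
  show "f 0 (s - 1) b (- a) = (if cell (lo + 1) (hi + 1) s a b \<and> s = s0 + 1 \<and> a = - q0 \<and> b = p0 then 1 else 0)"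
    for s a b
    unfolding cell_rotate init by auto
  show "f (Suc n) (s - 1) b (- a) = (if cell (lo + 1) (hi + 1) s a b
      then \<Sum>i\<in>{-1,0,1}. \<Sum>j\<in>{-1,0,1}. w j (- i) * (\<Sum>s'\<in>{s-1,s,s+1}. f n (s' - 1) (b - j) (- (a - i))) else 0)"
    for n s a b
    unfolding cell_rotate step by (simp add: algebra_simps minus_diff_commute)
  show "\<exists>i\<in>{-1,0,1}. w 1 (- i) \<noteq> 0" "\<exists>i\<in>{-1,0,1}. w (- 1) (- i) \<noteq> 0"
    using weights(3,4) by auto
  show "\<exists>j\<in>{-1,0,1}. w j (- 1) \<noteq> 0" "\<exists>j\<in>{-1,0,1}. w j (- (- 1)) \<noteq> 0"
    using weights(1,2) by auto
qed

lemma even_cone: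
  assumes "even lo" "lo \<le> hi" "odd (hi - lo)"
  shows "even_cone w lo hi f s0 p0 q0 (lo div 2) (nat ((hi - lo + 1) div 2))"
proof
  show "lo = 2 * (lo div 2)" using assms by simp
  have "hi = 2 * (lo div 2) + 2 * ((hi - lo + 1) div 2) - 1" "1 \<le> (hi - lo + 1) div 2"
    using assms by presburger+
  then show "hi = 2 * (lo div 2) + 2 * int (nat ((hi - lo + 1) div 2)) - 1"
    "1 \<le> nat ((hi - lo + 1) div 2)" by simp_all
qed

theorem dfin_row_col:
  assumes "lo \<le> hi" "odd (hi - lo)"
  shows "\<bar>b\<bar> \<le> 2 \<Longrightarrow> dfin (row s b)" "\<bar>a\<bar> \<le> 2 \<Longrightarrow> dfin (col s a)"
proof -
  have "(\<bar>b\<bar> \<le> 2 \<longrightarrow> dfin (row s b)) \<and> (\<bar>a\<bar> \<le> 2 \<longrightarrow> dfin (col s a))"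
  proof (cases "even lo")
    case True
    interpret even_cone w lo hi f s0 p0 q0 "lo div 2" "nat ((hi - lo + 1) div 2)"
      by (rule even_cone[OF True assms])
    show ?thesis using dfin_row dfin_col by blast
  next
    case False
    interpret r: walk_array "\<lambda>i j. w j (- i)" "lo + 1" "hi + 1" "\<lambda>n s a b. f n (s - 1) b (- a)"
      "s0 + 1" "- q0" p0 by (rule rotated)
    interpret re: even_cone "\<lambda>i j. w j (- i)" "lo + 1" "hi + 1" "\<lambda>n s a b. f n (s - 1) b (- a)"
      "s0 + 1" "- q0" p0 "(lo + 1) div 2" "nat ((hi + 1 - (lo + 1) + 1) div 2)"
      by (rule r.even_cone) (use False assms in auto)
    have "row s b = r.col (s + 1) (- b)" by (rule fls_fps_eqI) simp
    moreover have "dfin (col s a)" if "\<bar>a\<bar> \<le> 2"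
      by (rule dfin_reflect[OF re.dfin_row[OF that, of "s + 1"]]) simp
    ultimately show ?thesis using re.dfin_col by simp
  qed
  then show "\<bar>b\<bar> \<le> 2 \<Longrightarrow> dfin (row s b)" "\<bar>a\<bar> \<le> 2 \<Longrightarrow> dfin (col s a)" by auto
qed

lemma bulk_step:
  assumes "\<bar>a\<bar> \<ge> 2" "\<bar>b\<bar> \<ge> 2"
  shows "f (Suc n) s a b = (\<Sum>i\<in>{-1,0,1}. \<Sum>j\<in>{-1,0,1}. w i j * f n s (a - i) (b - j))"
proof (cases "cell lo hi s a b")
  case True
  have "(\<Sum>s'\<in>{s-1,s,s+1}. f n s' (a - i) (b - j)) = f n s (a - i) (b - j)"
    if "i \<in> {-1,0,1}" "j \<in> {-1,0,1}" for i j
  proof -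
    have "inq s (a - i) (b - j)"
      using True inq_neighbour[OF assms that] by (simp add: cell_def)
    then have "f n (s - 1) (a - i) (b - j) = 0" "f n (s + 1) (a - i) (b - j) = 0"
      using inq_unique[of s "a - i" "b - j" "s - 1"] inq_unique[of s "a - i" "b - j" "s + 1"]
      by (auto intro!: f_zero_inq)
    then show ?thesis by simp
  qed
  then show ?thesis
    unfolding step using True by (simp only: if_True cong: sum.cong)
next
  case False
  have "f n s (a - i) (b - j) = 0" if "i \<in> {-1,0,1}" "j \<in> {-1,0,1}" for i j
    using False inq_neighbour[OF assms that, of s] assms by (intro f_zero) (auto simp: cell_def)
  then show ?thesis using False by (simp only: step if_False) (simp only: mult_zero_right sum.neutral_const cong: sum.cong)
qed

end

section \<open>From rows to the bivariate series\<close>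

lemma fls_const_sum: "fls_const (\<Sum>i\<in>I. f i) = (\<Sum>i\<in>I. fls_const (f i))"
  by (induction I rule: infinite_finite_induct) (simp_all flip: fls_plus_const)

lemma series_x_nth:
  assumes "finite {(a, b). g a b n \<noteq> 0}"
  shows "series_x g $ n $$ a $$ b = g a b n"
proof -
  have "series_x g $ n $$ a $$ b
      = (\<Sum>(a', b')\<in>{(a, b). g a b n \<noteq> 0}. if a = a' then (if b = b' then g a' b' n else 0) else 0)"
    unfolding series_x_def fps_nth_Abs_fps fls_sum_nth case_prod_unfold
    by (intro sum.cong refl) (simp add: fls_X_intpow_times_conv_shift)
  also have "\<dots> = (\<Sum>x\<in>{(a, b). g a b n \<noteq> 0}. if x = (a, b) then g a b n else 0)"
    by (intro sum.cong refl) (auto split: if_splits)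
  also have "\<dots> = g a b n" using assms by (simp add: sum.delta)
  finally show ?thesis .
qed

lemma series_y_conv_series_x:
  "series_y g = series_x (\<lambda>a b. g b a)"
proof (rule fps_ext)
  fix n
  show "series_y g $ n = series_x (\<lambda>a b. g b a) $ n"
    unfolding series_x_def series_y_def fps_nth_Abs_fps
    by (rule sum.reindex_bij_witness[of _ prod.swap prod.swap]) auto
qed

lemma D_finite_series_x:
  fixes g :: "int \<Rightarrow> int \<Rightarrow> nat \<Rightarrow> real" and w :: "int \<Rightarrow> int \<Rightarrow> real"
  assumes fin: "\<And>n. finite {(a, b). g a b n \<noteq> 0}"
    and row: "\<And>b n a. row b $ n $$ a = fls_const (g a b n)" "\<And>b. \<bar>b\<bar> \<le> 2 \<Longrightarrow> dfin (row b)"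
    and bulk: "\<And>a b n. \<bar>a\<bar> \<ge> 2 \<Longrightarrow> \<bar>b\<bar> \<ge> 2 \<Longrightarrow>
      g a b (Suc n) = (\<Sum>i\<in>{-1,0,1}. \<Sum>j\<in>{-1,0,1}. w i j * g (a - i) (b - j) n)"
    and start: "\<And>a b. \<bar>a\<bar> > B \<Longrightarrow> g a b 0 = 0"
  shows "D_finite (series_x g)"
proof -
  define F where "F = series_x g"
  have F: "F $ n $$ a $$ b = g a b n" for n a b
    unfolding F_def by (rule series_x_nth[OF fin])
  define c where "c i j = (fls_const (w i j) :: real fls)" for i j
  define J where "J n a b = g a b n - (if n = 0 then 0
      else \<Sum>j\<in>{-1,0,1}. \<Sum>i\<in>{-1,0,1}. w i j * g (a - i) (b - j) (n - 1))" for n a b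
  have J0: "J n a b = 0" if "\<bar>a\<bar> > max 2 B" "\<bar>b\<bar> \<ge> 2" for n a b
  proof (cases n)
    case 0
    then show ?thesis using start[of a b] that by (simp add: J_def)
  next
    case (Suc k)
    have "g a b n = (\<Sum>j\<in>{-1,0,1}. \<Sum>i\<in>{-1,0,1}. w i j * g (a - i) (b - j) k)"
      unfolding Suc by (subst sum.swap, rule bulk) (use that in auto)
    then show ?thesis by (simp only: J_def Suc) simp
  qed
  define P where "P j = kpoly (\<lambda>i. c i j)" for j
  define Y where "Y b = (lift_const (fps_const (fls_X_intpow b)) :: real fls fls fps)" for b
  define R where "R b = row b - fps_X * (\<Sum>j\<in>{-1,0,1}. P j * row (b - j))" for b
  have R: "R b $ n $$ a = fls_const (J n a b)" for b n a
  proof (cases n)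
    case 0
    then show ?thesis by (simp add: R_def J_def row(1))
  next
    case (Suc k)
    have "(\<Sum>j\<in>{-1,0,1}. P j * row (b - j)) $ k $$ a
        = (\<Sum>j\<in>{-1,0,1}. \<Sum>i\<in>{-1,0,1}. fls_const (w i j * g (a - i) (b - j) k))"
      unfolding fps_sum_nth fls_sum_nth P_def kpoly_mult_nth c_def row(1) fls_const_mult_const ..
    also have "\<dots> = fls_const (\<Sum>j\<in>{-1,0,1}. \<Sum>i\<in>{-1,0,1}. w i j * g (a - i) (b - j) k)"
      by (simp only: fls_const_sum)
    finally show ?thesis
      using Suc by (simp only: R_def J_def fps_sub_nth fls_minus_nth row(1)) (simp flip: fls_minus_const)
  qed
  have dR: "dfin (R b)" if "b \<in> {-1,0,1}" for b
    unfolding R_def P_def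
    by (intro dfin_diff row(2) dfin_Lpoly_mult dfin_sum kpoly_Lpoly Lpoly_fps_X) (use that in auto)
  define Kp where "Kp = (\<Sum>j\<in>{-1,0,1}. Y j * P j)"
  have YL: "Y b \<in> Lpoly" for b by (simp add: Y_def)
  have Ynth: "(Y b * G) $ n $$ a $$ b' = G $ n $$ a $$ (b' - b)" for b b' G n a
    unfolding Y_def lift_const_mult_nth by (simp add: fls_X_intpow_times_conv_shift)
  define Z where "Z = (1 - fps_X * Kp) * F - (\<Sum>b\<in>{-1,0,1}. Y b * R b)"
  have KF: "((1 - fps_X * Kp) * F) $ n $$ a $$ b = J n a b" for n a b
  proof -
    have *: "(Kp * F) $ k $$ a $$ b = (\<Sum>j\<in>{-1,0,1}. \<Sum>i\<in>{-1,0,1}. w i j * g (a - i) (b - j) k)" for k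
      unfolding Kp_def sum_distrib_right mult.assoc fps_sum_nth fls_sum_nth Ynth P_def kpoly_mult_nth c_def
      by (simp add: F)
    have "(1 - fps_X * Kp) * F = F - fps_X * (Kp * F)" by (simp add: algebra_simps)
    then show ?thesis using F * by (cases n) (simp_all only: fps_sub_nth fls_minus_nth J_def, simp_all)
  qed
  have "Z $ n $$ a = 0" if "\<bar>a\<bar> > max 2 B" for n a
  proof (rule fls_eqI)
    fix b
    have "Z $ n $$ a $$ b = J n a b - (\<Sum>b'\<in>{-1,0,1}. if b = b' then J n a b' else 0)"
      unfolding Z_def fps_sub_nth fls_minus_nth KF fps_sum_nth fls_sum_nth Ynth R
      by (intro arg_cong2[of _ _ _ _ "(-)"] refl sum.cong) auto
    also have "\<dots> = 0" using J0[OF that, of b n] by (auto simp: abs_if split: if_splits)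
    finally show "Z $ n $$ a $$ b = (0 :: real fls) $$ b" by simp
  qed
  then have Z: "Z \<in> Lpoly" by (rule Lpoly_bounded)
  have "dfin (\<Sum>b\<in>{-1,0,1}. Y b * R b)"
    by (intro dfin_sum dfin_Lpoly_mult YL dR)
  from dfin_add[OF dfin_Lpoly[OF Z] this] have "dfin ((1 - fps_X * Kp) * F)"
    by (simp only: Z_def diff_add_cancel)
  moreover have "Kp \<in> Lpoly"
    unfolding Kp_def P_def by (intro Lpoly_sum Lpoly_mult YL kpoly_Lpoly)
  then have "1 - fps_X * Kp \<in> Lpoly" by auto
  moreover have "(1 - fps_X * Kp) $ 0 \<noteq> 0" by simp
  then have "1 - fps_X * Kp \<noteq> 0" by (metis fps_zero_nth)
  ultimately have "dfin F" using dfin_cancel by blast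
  then show ?thesis unfolding F_def by (rule D_finite_if_dfin)
qed

section \<open>The walks of the cone\<close>

lemma bij_rot: "bij rot"
  by (rule o_bij[of "\<lambda>(a, b). (b, - a)"]) (auto simp: rot_def fun_eq_iff)

lemma rot_pow_add_1: "rot_pow (s + 1) = rot \<circ> rot_pow s"
proof (cases "s \<ge> 0")
  case True
  then show ?thesis by (simp add: rot_pow_def nat_add_distrib)
next
  case False
  obtain k where k: "nat (- s) = Suc k" "nat (- (s + 1)) = k" using False
    by (cases "nat (- s)") auto
  have "rot \<circ> (inv rot ^^ Suc k) = inv rot ^^ k"
    using bij_rot by (simp add: fun_eq_iff bij_is_surj surj_f_inv_f)
  then show ?thesis using False k by (cases "s = - 1") (auto simp: rot_pow_def)
qed

lemma mem_rot_image: "(a, b) \<in> rot ` X \<longleftrightarrow> (b, - a) \<in> X"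
  by (force simp: rot_def image_iff)

lemma rotation_induct:
  fixes X :: "int \<Rightarrow> (int \<times> int) set" and C :: "int \<Rightarrow> int \<Rightarrow> int \<Rightarrow> bool"
  assumes "\<And>a b. (a, b) \<in> X 0 \<longleftrightarrow> C 0 a b"
    and "\<And>s. X (s + 1) = rot ` X s" "\<And>s a b. C s a b \<longleftrightarrow> C (s - 1) b (- a)"
  shows "(a, b) \<in> X s \<longleftrightarrow> C s a b"
proof (induction s arbitrary: a b rule: int_induct[where k = 0])
  case base
  then show ?case by (rule assms(1))
next
  case (step1 s)
  then show ?case using assms(2)[of s] assms(3)[of "s + 1" a b] by (simp add: mem_rot_image)
next
  case (step2 s)
  have "(a, b) \<in> X (s - 1) \<longleftrightarrow> (- b, a) \<in> X s"
    using assms(2)[of "s - 1"] by (simp add: mem_rot_image)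
  then show ?case using step2(2)[of "- b" a] assms(3)[of s "- b" a] by simp
qed

lemma mem_quadrant': "(a, b) \<in> quadrant' s \<longleftrightarrow> inq s a b"
  by (rule rotation_induct[where C = inq])
    (auto simp: quadrant'_def rot_pow_add_1 image_comp[symmetric] inq_rotate[symmetric], auto simp: rot_pow_def inq_def)

lemma mem_quadrant: "(a, b) \<in> quadrant s \<longleftrightarrow> inq s a b \<and> a \<noteq> 0 \<and> b \<noteq> 0"
  by (rule rotation_induct[where C = "\<lambda>s a b. inq s a b \<and> a \<noteq> 0 \<and> b \<noteq> 0"])
    (auto simp: quadrant_def rot_pow_add_1 image_comp[symmetric] inq_rotate[symmetric], auto simp: rot_pow_def inq_def)

lemma mem_cone: "(s, (a, b)) \<in> cone L K \<longleftrightarrow> cell (- int L) (int K) s a b"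
  by (cases "s = - int L") (auto simp: cone_def Gam_def Gam'_def mem_quadrant mem_quadrant' cell_def)

locale cone_walk =
  fixes S :: "(int \<times> int) set" and w :: "int \<times> int \<Rightarrow> real" and L K :: nat and u :: "int \<times> (int \<times> int)"
  assumes S: "S \<subseteq> {-1, 0, 1} \<times> {-1, 0, 1}"
begin

definition total :: "int \<times> (int \<times> int) \<Rightarrow> nat \<Rightarrow> real" where
  "total v n = (\<Sum>ps\<in>walks S L K u v n. walk_weight w ps)"

definition preds :: "int \<times> (int \<times> int) \<Rightarrow> (int \<times> (int \<times> int)) set" where
  "preds v = {v'. allowed S v' v}"

lemma walks_0: "walks S L K u v 0 = (if u = v \<and> u \<in> cone L K then {[u]} else {})"
  unfolding walks_def length_Suc_conv by (auto; metis surj_pair)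

lemma walks_Suc:
  "walks S L K u v (Suc n) = (if v \<in> cone L K then (\<lambda>ps. ps @ [v]) ` (\<Union>v'\<in>preds v. walks S L K u v' n) else {})"
proof (intro equalityI subsetI)
  fix ps assume "ps \<in> walks S L K u v (Suc n)"
  then have ps: "length ps = Suc (Suc n)" "hd ps = u" "last ps = v" "set ps \<subseteq> cone L K"
    "\<And>i. i < Suc n \<Longrightarrow> allowed S (ps ! i) (ps ! Suc i)" by (auto simp: walks_def)
  define qs where "qs = butlast ps"
  have psq: "ps = qs @ [v]" using ps(1,3) by (metis append_butlast_last_id length_0_conv nat.simps(3) qs_def)
  have lq: "length qs = Suc n" using ps(1) by (simp add: qs_def)
  then have "qs \<noteq> []" by auto
  have nth: "qs ! i = ps ! i" if "i \<le> n" for i using that lq by (simp add: psq nth_append)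
  have "last qs = qs ! n" using lq by (simp add: last_conv_nth \<open>qs \<noteq> []\<close>)
  moreover have "ps ! Suc n = v" using lq by (simp add: psq nth_append)
  ultimately have "allowed S (last qs) v" using ps(5)[of n] nth[of n] by simp
  moreover have "qs \<in> walks S L K u (last qs) n"
    using ps lq nth \<open>qs \<noteq> []\<close> by (auto simp: walks_def psq hd_append)
  moreover have "v \<in> cone L K" using ps(4) by (simp add: psq)
  ultimately show "ps \<in> (if v \<in> cone L K then (\<lambda>ps. ps @ [v]) ` (\<Union>v'\<in>preds v. walks S L K u v' n) else {})"
    using psq by (auto simp: preds_def)
next
  fix ps assume "ps \<in> (if v \<in> cone L K then (\<lambda>ps. ps @ [v]) ` (\<Union>v'\<in>preds v. walks S L K u v' n) else {})"
  then obtain qs v' where v: "v \<in> cone L K" and ps: "ps = qs @ [v]" and v': "allowed S v' v" "qs \<in> walks S L K u v' n"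
    by (auto simp: preds_def split: if_splits)
  then have qs: "length qs = Suc n" "hd qs = u" "last qs = v'" "set qs \<subseteq> cone L K"
    "\<And>i. i < n \<Longrightarrow> allowed S (qs ! i) (qs ! Suc i)" by (auto simp: walks_def)
  then have "qs \<noteq> []" by auto
  have "qs ! n = v'" using qs by (simp add: last_conv_nth \<open>qs \<noteq> []\<close>)
  then have "allowed S (ps ! i) (ps ! Suc i)" if "i < Suc n" for i
    using that qs(1,5) v'(1) by (auto simp: ps nth_append less_Suc_eq)
  then show "ps \<in> walks S L K u v (Suc n)"
    using qs v \<open>qs \<noteq> []\<close> by (auto simp: walks_def ps)
qed

lemma preds_conv:
  "preds (s, (a, b)) = (\<lambda>((i, j), s'). (s', (a - i, b - j))) ` (S \<times> {s-1,s,s+1})"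
proof (intro equalityI subsetI)
  fix v assume "v \<in> preds (s, (a, b))"
  then obtain s' x y where v: "v = (s', (x, y))" "(a - x, b - y) \<in> S" "\<bar>s' - s\<bar> \<le> 1"
    by (cases v) (auto simp: preds_def allowed_def)
  then have "v = (\<lambda>((i, j), s'). (s', (a - i, b - j))) ((a - x, b - y), s')" "s' \<in> {s-1,s,s+1}" by auto
  then show "v \<in> (\<lambda>((i, j), s'). (s', (a - i, b - j))) ` (S \<times> {s-1,s,s+1})" using v(2) by blast
qed (auto simp: preds_def allowed_def)

lemma finite_S: "finite S"
  by (rule finite_subset[OF S]) simp

lemma finite_preds: "finite (preds v)"
  using finite_S by (cases v, cases "snd v") (simp add: preds_conv)

lemma finite_walks: "finite (walks S L K u v n)"
proof (induction n arbitrary: v)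
  case (Suc n)
  have "finite (\<Union>v'\<in>preds v. walks S L K u v' n)"
    by (rule finite_UN_I[OF finite_preds Suc])
  then show ?case by (subst walks_Suc) (simp only: finite_imageI finite.emptyI simp_thms split: if_split)
qed (simp add: walks_0)

lemma walk_weight_snoc:
  assumes "qs \<in> walks S L K u v' n"
  shows "walk_weight w (qs @ [v]) = walk_weight w qs * w (snd v - snd v')"
proof -
  have qs: "length qs = Suc n" "last qs = v'" "qs \<noteq> []" using assms by (auto simp: walks_def)
  then have "qs ! n = v'" by (simp add: last_conv_nth)
  then show ?thesis using qs(1) by (simp add: walk_weight_def nth_append)
qed

lemma total_0: "total v 0 = (if u = v \<and> u \<in> cone L K then 1 else 0)"
  by (auto simp: total_def walks_0 walk_weight_def)

lemma total_Suc:
  "total v (Suc n) = (if v \<in> cone L K then \<Sum>v'\<in>preds v. w (snd v - snd v') * total v' n else 0)"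
proof (cases "v \<in> cone L K")
  case True
  have "total v (Suc n) = (\<Sum>ps\<in>(\<Union>v'\<in>preds v. walks S L K u v' n). walk_weight w (ps @ [v]))"
    unfolding total_def walks_Suc using True by (simp add: sum.reindex inj_on_def)
  also have "\<dots> = (\<Sum>v'\<in>preds v. \<Sum>ps\<in>walks S L K u v' n. walk_weight w (ps @ [v]))"
  proof (rule sum.UNION_disjoint)
    show "\<forall>v1\<in>preds v. \<forall>v2\<in>preds v. v1 \<noteq> v2 \<longrightarrow> walks S L K u v1 n \<inter> walks S L K u v2 n = {}"
      by (auto simp: walks_def)
  qed (simp_all add: finite_preds finite_walks)
  also have "\<dots> = (\<Sum>v'\<in>preds v. w (snd v - snd v') * total v' n)"
    unfolding total_def sum_distrib_left
    by (intro sum.cong refl) (simp add: walk_weight_snoc mult.commute)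
  finally show ?thesis using True by simp
qed (simp add: total_def walks_Suc)

definition wt :: "int \<Rightarrow> int \<Rightarrow> real" where "wt i j = (if (i, j) \<in> S then w (i, j) else 0)"

lemma total_step:
  "total (s, (a, b)) (Suc n) = (if cell (- int L) (int K) s a b
     then \<Sum>i\<in>{-1,0,1}. \<Sum>j\<in>{-1,0,1}. wt i j * (\<Sum>s'\<in>{s-1,s,s+1}. total (s', (a - i, b - j)) n) else 0)"
proof (cases "cell (- int L) (int K) s a b")
  case True
  have "total (s, (a, b)) (Suc n) = (\<Sum>v'\<in>preds (s, (a, b)). w ((a, b) - snd v') * total v' n)"
    using True by (simp add: total_Suc mem_cone)
  also have "\<dots> = (\<Sum>((i, j), s')\<in>S \<times> {s-1,s,s+1}. w (i, j) * total (s', (a - i, b - j)) n)"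
    unfolding preds_conv by (subst sum.reindex) (auto simp: inj_on_def intro!: sum.cong)
  also have "\<dots> = (\<Sum>x\<in>S. \<Sum>s'\<in>{s-1,s,s+1}. wt (fst x) (snd x) * total (s', (a - fst x, b - snd x)) n)"
    by (subst sum.cartesian_product, rule sum.cong) (auto simp: wt_def)
  also have "\<dots> = (\<Sum>(i, j)\<in>S. wt i j * (\<Sum>s'\<in>{s-1,s,s+1}. total (s', (a - i, b - j)) n))"
    by (simp only: sum_distrib_left case_prod_unfold)
  also have "\<dots> = (\<Sum>(i, j)\<in>{-1,0,1} \<times> {-1,0,1}. wt i j * (\<Sum>s'\<in>{s-1,s,s+1}. total (s', (a - i, b - j)) n))"
    using S by (intro sum.mono_neutral_left) (auto simp: wt_def)
  finally show ?thesis using True by (simp only: sum.cartesian_product if_True)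
qed (simp add: total_Suc mem_cone)

end

theorem theorem6p2:
  fixes S :: "(int \<times> int) set" and w :: "int \<times> int \<Rightarrow> real"
    and L K :: nat and p q j :: int
  assumes "S \<subseteq> {-1, 0, 1} \<times> {-1, 0, 1} - {(0, 0)}"
    and "non_singular S"
    and "\<And>s. s \<in> S \<Longrightarrow> w s > 0"
    and "L + K + 1 \<ge> 2" and "even (L + K + 1)"
    and "p > 0" and "q \<ge> 0"
    and "- int L \<le> j" and "j \<le> int K"
  shows "D_finite (series_x (q_total S w L K (p, q) j)) \<and>
         D_finite (series_y (q_total S w L K (p, q) j))"
proof -
  interpret cone_walk S w L K "(0, (p, q))"
    by unfold_locales (use assms(1) in blast)
  define f where "f n s a b = (fls_const (total (s, (a, b)) n) :: real fls)" for n s a b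
  have direction: "\<exists>(i, j)\<in>S. x * of_int i + y * of_int j > 0" if "(x, y) \<noteq> (0, 0)" for x y :: real
    using assms(2) that unfolding non_singular_def by blast
  have nz: "fls_const (wt i j) \<noteq> 0" "i \<in> {-1,0,1}" "j \<in> {-1,0,1}" if "(i, j) \<in> S" for i j
    using that assms(1) assms(3)[of "(i, j)"] by (auto simp: wt_def)
  interpret walk_array "\<lambda>i j. fls_const (wt i j)" "- int L" "int K" f 0 p q
  proof
    show "f 0 s a b = (if cell (- int L) (int K) s a b \<and> s = 0 \<and> a = p \<and> b = q then 1 else 0)" for s a b
      by (auto simp: f_def total_0 mem_cone)
    show "f (Suc n) s a b = (if cell (- int L) (int K) s a b then \<Sum>i\<in>{-1,0,1}. \<Sum>j\<in>{-1,0,1}.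
        fls_const (wt i j) * (\<Sum>s'\<in>{s-1,s,s+1}. f n s' (a - i) (b - j)) else 0)" for n s a b
    proof (cases "cell (- int L) (int K) s a b")
      case True
      then show ?thesis
        unfolding f_def total_step by (simp only: if_True fls_const_sum fls_const_mult_const[symmetric])
    qed (simp add: f_def total_step)
    show "\<exists>i\<in>{-1,0,1}. fls_const (wt i 1) \<noteq> 0"
      using direction[of 0 1] nz by fastforce
    show "\<exists>i\<in>{-1,0,1}. fls_const (wt i (- 1)) \<noteq> 0"
      using direction[of 0 "- 1"] nz by fastforce
    show "\<exists>j\<in>{-1,0,1}. fls_const (wt 1 j) \<noteq> 0"
      using direction[of 1 0] nz by fastforce
    show "\<exists>j\<in>{-1,0,1}. fls_const (wt (- 1) j) \<noteq> 0"
      using direction[of "- 1" 0] nz by fastforce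
  qed
  define g where "g = q_total S w L K (p, q) j"
  have g: "f n j a b = fls_const (g a b n)" for n a b
    by (simp add: f_def g_def q_total_def total_def)
  have "odd (int K - - int L)" using assms(5) by (simp add: add.commute)
  moreover have "- int L \<le> int K" by simp
  ultimately have dfin: "\<And>b. \<bar>b\<bar> \<le> 2 \<Longrightarrow> dfin (row j b)" "\<And>a. \<bar>a\<bar> \<le> 2 \<Longrightarrow> dfin (col j a)"
    using dfin_row_col by blast+
  have g0: "g a b n = 0" if "\<bar>p\<bar> + int n < \<bar>a\<bar> \<or> \<bar>q\<bar> + int n < \<bar>b\<bar>" for a b n
    using f_bound[OF that, of j] by (simp add: g)
  have fin: "finite {(a, b). g a b n \<noteq> 0}" for n
  proof (rule finite_subset)
    show "{(a, b). g a b n \<noteq> 0} \<subseteq> {- (\<bar>p\<bar> + int n)..\<bar>p\<bar> + int n} \<times> {- (\<bar>q\<bar> + int n)..\<bar>q\<bar> + int n}"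
      using g0 by (force simp: abs_le_iff)
  qed simp
  have bulk: "g a b (Suc n) = (\<Sum>i\<in>{-1,0,1}. \<Sum>j\<in>{-1,0,1}. wt i j * g (a - i) (b - j) n)"
    if "\<bar>a\<bar> \<ge> 2" "\<bar>b\<bar> \<ge> 2" for a b n
  proof -
    have "fls_const (g a b (Suc n)) = fls_const (\<Sum>i\<in>{-1,0,1}. \<Sum>j\<in>{-1,0,1}. wt i j * g (a - i) (b - j) n)"
      using bulk_step[OF that, of n j] unfolding g by (simp only: fls_const_sum fls_const_mult_const)
    from arg_cong[OF this, of "\<lambda>F. F $$ 0"] show ?thesis by simp
  qed
  have "D_finite (series_x g)"
    by (rule D_finite_series_x[where row = "row j" and w = wt and B = "\<bar>p\<bar>"])
      (use fin dfin bulk g g0 in auto)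
  moreover have "D_finite (series_x (\<lambda>a b. g b a))"
  proof (rule D_finite_series_x[where row = "col j" and w = "\<lambda>i j. wt j i" and B = "\<bar>q\<bar>"])
    show "finite {(a, b). g b a n \<noteq> 0}" for n
      using finite_imageI[OF fin[of n], of prod.swap] by (rule rev_finite_subset) force
    show "g b a (Suc n) = (\<Sum>i\<in>{-1,0,1}. \<Sum>j\<in>{-1,0,1}. wt j i * g (b - j) (a - i) n)"
      if "\<bar>a\<bar> \<ge> 2" "\<bar>b\<bar> \<ge> 2" for a b n
      by (subst sum.swap) (rule bulk[OF that(2,1)])
  qed (use dfin g g0 in auto)
  ultimately show ?thesis
    unfolding series_y_conv_series_x g_def by blast
qed

end
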